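(* Let $q$ be a real sequence with $q\in\ell^1_2(\mathbb{Z})$, let $H=-\Delta_L+q$ on $\ell^2(\mathbb{Z})$, $(Hu)_n=-(u_{n+1}-2u_n+u_{n-1})+q_nu_n$, and let $P_c$ be the orthogonal projection onto the continuous spectral subspace of $H$. Assume the non-resonant case, i.e. neither $\omega=0$ nor $\omega=4$ is a resonance of $H$. Then $$\|\mathrm{e}^{-\mathrm{i}tH}P_c\|_{\ell^1_1\to\ell^\infty_{-1}}=\mathcal{O}(t^{-4/3}),\quad t\to\infty.$$
   Context: For $\sigma\in\mathbb{R}$, $\ell^1_\sigma$ has norm $\sum_n(1+|n|)^\sigma|u(n)|$ and $\ell^\infty_\sigma$ has norm $\sup_n(1+|n|)^\sigma|u(n)|$. For $\omega\in\{0,4\}$, $\omega$ is called a resonance of $H$ if the equation $Hu=\omega u$ (understood pointwise on $\mathbb{Z}$) has a nonzero bounded solution $u\in\ell^\infty(\mathbb{Z})$. *)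

theory Defs
  imports "HOL-Analysis.Analysis"
begin

definition l2 :: "(int \<Rightarrow> complex) \<Rightarrow> bool" where
  "l2 u \<longleftrightarrow> (\<lambda>n. (cmod (u n))^2) summable_on UNIV"

definition l2_inner :: "(int \<Rightarrow> complex) \<Rightarrow> (int \<Rightarrow> complex) \<Rightarrow> complex" where
  "l2_inner v u = (\<Sum>\<^sub>\<infinity>n. v n * cnj (u n))"

definition l1w :: "real \<Rightarrow> (int \<Rightarrow> complex) \<Rightarrow> bool" where
  "l1w \<sigma> u \<longleftrightarrow> (\<lambda>n. (1 + real_of_int \<bar>n\<bar>) powr \<sigma> * cmod (u n)) summable_on UNIV"

definition l1w_norm :: "real \<Rightarrow> (int \<Rightarrow> complex) \<Rightarrow> real" where
  "l1w_norm \<sigma> u = (\<Sum>\<^sub>\<infinity>n. (1 + real_of_int \<bar>n\<bar>) powr \<sigma> * cmod (u n))"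

definition Hop :: "(int \<Rightarrow> real) \<Rightarrow> (int \<Rightarrow> complex) \<Rightarrow> (int \<Rightarrow> complex)" where
  "Hop q u = (\<lambda>n. - (u (n + 1) - 2 * u n + u (n - 1)) + complex_of_real (q n) * u n)"

definition resonance :: "(int \<Rightarrow> real) \<Rightarrow> real \<Rightarrow> bool" where
  "resonance q \<omega> \<longleftrightarrow> (\<exists>u. u \<noteq> (\<lambda>_. 0) \<and> bounded (range u) \<and>
       Hop q u = (\<lambda>n. complex_of_real \<omega> * u n))"

definition eigvec :: "(int \<Rightarrow> real) \<Rightarrow> (int \<Rightarrow> complex) \<Rightarrow> bool" where
  "eigvec q u \<longleftrightarrow> l2 u \<and> u \<noteq> (\<lambda>_. 0) \<and> (\<exists>e. Hop q u = (\<lambda>n. e * u n))"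

text \<open>Continuous spectral subspace: orthogonal complement of the pure point subspace
  (closed span of eigenvectors).\<close>
definition Hc :: "(int \<Rightarrow> real) \<Rightarrow> (int \<Rightarrow> complex) set" where
  "Hc q = {v. l2 v \<and> (\<forall>u. eigvec q u \<longrightarrow> l2_inner v u = 0)}"

definition Pc :: "(int \<Rightarrow> real) \<Rightarrow> (int \<Rightarrow> complex) \<Rightarrow> (int \<Rightarrow> complex)" where
  "Pc q u = (THE w. w \<in> Hc q \<and> (\<forall>v\<in>Hc q. l2_inner (\<lambda>n. u n - w n) v = 0))"

text \<open>e^{-itH} u, via the exponential series of the bounded operator H (evaluated
  coordinatewise, which agrees with the l^2-convergent series).\<close>
definition evol :: "(int \<Rightarrow> real) \<Rightarrow> real \<Rightarrow> (int \<Rightarrow> complex) \<Rightarrow> (int \<Rightarrow> complex)" where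
  "evol q t u = (\<lambda>n. \<Sum>k. ((- \<i> * complex_of_real t) ^ k / fact k) * ((Hop q ^^ k) u) n)"

end

(*
  With z = 2 - \<zeta> - 1/\<zeta>, the Jost solutions are \<zeta>^(+-n) times power series in \<zeta> whose
  coefficients satisfy a Volterra recursion; one decay weight on q is spent on bounding the l^1 norm
  of the coefficients and the second one on the l^1 norm of the differentiated series, with linear
  and quadratic growth in n on the wrong half line.

  Contracting a contour in the \<zeta>-disc identifies P_c with the integral over the unit circle of
  the jump of the resolvent, since the poles inside are simple and their residues are combinations
  of eigenvectors. Hence exp(-itH) P_c has the kernel
  (1/2 pi) int exp(-it(2 - 2 cos x)) (1 - \<zeta>^2) f_+(max) f_-(min) / w dx with \<zeta> = exp(ix),
  where w is \<zeta> times the Wronskian and does not vanish on the circle in the nonresonant case.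
  The factor 1 - \<zeta>^2 is a multiple of the derivative of the phase, so an integration by parts
  gains 1/t. The differentiated amplitude is an absolutely convergent Fourier series times a C^1
  function, and the van der Corput bound O(t^(-1/3)), uniform in the added frequency, supplies the
  rest. The quadratic growth is harmless because f_-(k) is only needed for k <= n.
*)
theory Submission
  imports Defs "HOL-Complex_Analysis.Complex_Analysis"
begin

section \<open>Oscillatory integrals\<close>

text \<open>The van der Corput bound asks for a C^1 amplitude, while one integration by parts
  already spends the single derivative that q in l^1_2 grants. After it, w' is merely an absolutely
  convergent series. So 1/w is kept as the C^1 function it is, while w' and both Jost series are
  expanded into pure frequencies; the bound absorbs these because adding m x to the phase leaves its
  second derivative alone. The exponent 1/3 comes from the points +-pi/2, where the second
  derivative of 2 t cos x vanishes.

  The residues at the zeros of w enter with unspecified coefficients. The kernel is recognised as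
  P_c because it annihilates every eigenvector and differs from the identity by eigenvectors. That
  the poles are simple follows from |Im E| |f_+(k) f_-(k)| <= |W|, a resolvent bound obtained from
  the symmetry of H: it makes w at p + i eps at least of order eps near a zero p.\<close>

lemma has_vector_derivative_cis_chain:
  assumes "(\<psi> has_real_derivative d) (at x)"
  shows "((\<lambda>x. cis (\<psi> x)) has_vector_derivative d *\<^sub>R (\<i> * cis (\<psi> x))) (at x)"
proof -
  have "((\<lambda>x. complex_of_real (cos (\<psi> x)) + \<i> * complex_of_real (sin (\<psi> x))) has_vector_derivative
      complex_of_real (- sin (\<psi> x) * d) + \<i> * complex_of_real (cos (\<psi> x) * d)) (at x)"
    by (intro has_vector_derivative_add has_vector_derivative_mult_right has_vector_derivative_of_real)
      (auto intro!: derivative_eq_intros assms)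
  thus ?thesis by (simp add: cis_conv_exp exp_Euler cos_of_real sin_of_real scaleR_conv_of_real algebra_simps
     flip: cos_of_real sin_of_real)
qed

text \<open>Integrate by parts against cis \<open>\<psi>\<close> / \<open>\<psi>1\<close>. The sign
  of \<open>\<psi>2\<close> makes 1 / \<open>\<psi>1\<close> monotone, so its total variation is a
  difference of endpoint values, at most 1 / \<open>\<mu>\<close> however large
  \<open>\<psi>2\<close> may be. Two boundary terms and this variation produce the factor 3.\<close>

lemma oscillatory_first_derivative:
  fixes \<psi> \<psi>1 \<psi>2 :: "real \<Rightarrow> real" and g g1 :: "real \<Rightarrow> complex"
  assumes ab: "a \<le> b" and mu: "\<mu> > 0"
    and d1: "\<And>x. x \<in> {a..b} \<Longrightarrow> (\<psi> has_real_derivative \<psi>1 x) (at x)"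
    and d2: "\<And>x. x \<in> {a..b} \<Longrightarrow> (\<psi>1 has_real_derivative \<psi>2 x) (at x)"
    and c2: "continuous_on {a..b} \<psi>2" and p2: "\<And>x. x \<in> {a..b} \<Longrightarrow> \<psi>2 x \<ge> 0"
    and dg: "\<And>x. x \<in> {a..b} \<Longrightarrow> (g has_vector_derivative g1 x) (at x)"
    and cg: "continuous_on {a..b} g1"
    and G: "\<And>x. x \<in> {a..b} \<Longrightarrow> cmod (g x) \<le> G" and G1: "\<And>x. x \<in> {a..b} \<Longrightarrow> cmod (g1 x) \<le> G1"
    and sep: "(\<forall>x\<in>{a..b}. \<psi>1 x \<ge> \<mu>) \<or> (\<forall>x\<in>{a..b}. \<psi>1 x \<le> -\<mu>)"
  shows "cmod (integral {a..b} (\<lambda>x. cis (\<psi> x) * g x)) \<le> (3 * G + G1 * (b - a)) / \<mu>"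
proof -
  have nz: "\<psi>1 x \<noteq> 0" if "x \<in> {a..b}" for x using sep that mu by fastforce
  have am: "\<bar>\<psi>1 x\<bar> \<ge> \<mu>" if "x \<in> {a..b}" for x using sep that mu by fastforce
  have cp: "continuous_on {a..b} \<psi>" "continuous_on {a..b} \<psi>1" "continuous_on {a..b} g"
    using d1 d2 dg by (meson DERIV_isCont continuous_at_imp_continuous_on
        has_vector_derivative_continuous)+
  have Gp: "G \<ge> 0" using G[of a] ab by (smt (verit) atLeastAtMost_iff norm_ge_zero)
  have G1p: "G1 \<ge> 0" using G1[of a] ab by (smt (verit) atLeastAtMost_iff norm_ge_zero)
  define F where "F = (\<lambda>x. cis (\<psi> x) * g x * complex_of_real (inverse (\<psi>1 x)))"
  define R where "R = (\<lambda>x. cis (\<psi> x) * g1 x * complex_of_real (inverse (\<psi>1 x))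
      - cis (\<psi> x) * g x * complex_of_real (\<psi>2 x * (inverse (\<psi>1 x))\<^sup>2))"
  have dF: "(F has_vector_derivative (\<i> * (cis (\<psi> x) * g x) + R x)) (at x within {a..b})"
    if x: "x \<in> {a..b}" for x
  proof -
    have a1: "((\<lambda>x. cis (\<psi> x)) has_vector_derivative (\<psi>1 x) *\<^sub>R (\<i> * cis (\<psi> x))) (at x)"
      by (rule has_vector_derivative_cis_chain[OF d1[OF x]])
    have "((\<lambda>x. inverse (\<psi>1 x)) has_real_derivative (- (\<psi>2 x * (inverse (\<psi>1 x))\<^sup>2))) (at x)"
      using DERIV_inverse_fun[OF d2[OF x] nz[OF x]]
      by (simp add: power2_eq_square field_simps)
    hence a2: "((\<lambda>x. complex_of_real (inverse (\<psi>1 x))) has_vector_derivative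
        complex_of_real (- (\<psi>2 x * (inverse (\<psi>1 x))\<^sup>2))) (at x)"
      by (rule has_vector_derivative_of_real)
    have "(F has_vector_derivative (cis (\<psi> x) * g x * complex_of_real (- (\<psi>2 x * (inverse (\<psi>1 x))\<^sup>2))
       + (cis (\<psi> x) * g1 x + (\<psi>1 x) *\<^sub>R (\<i> * cis (\<psi> x)) * g x) * complex_of_real (inverse (\<psi>1 x)))) (at x)"
      unfolding F_def
      by (rule has_vector_derivative_mult has_vector_derivative_mult[OF has_vector_derivative_mult[OF a1 dg[OF x]] a2])+
    also have "(cis (\<psi> x) * g x * complex_of_real (- (\<psi>2 x * (inverse (\<psi>1 x))\<^sup>2))
       + (cis (\<psi> x) * g1 x + (\<psi>1 x) *\<^sub>R (\<i> * cis (\<psi> x)) * g x) * complex_of_real (inverse (\<psi>1 x)))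
       = \<i> * (cis (\<psi> x) * g x) + R x"
      using nz[OF x] by (simp add: R_def scaleR_conv_of_real field_simps)
    finally show ?thesis using has_vector_derivative_at_within by blast
  qed
  have I1: "((\<lambda>x. \<i> * (cis (\<psi> x) * g x) + R x) has_integral (F b - F a)) {a..b}"
    by (rule fundamental_theorem_of_calculus[OF ab]) (use dF in auto)
  have cR: "continuous_on {a..b} R" unfolding R_def
    by (intro continuous_intros continuous_on_cis cp cg c2) (use nz in auto)
  have ci: "continuous_on {a..b} (\<lambda>x. cis (\<psi> x) * g x)"
    by (intro continuous_intros continuous_on_cis cp)
  have eq: "\<i> * integral {a..b} (\<lambda>x. cis (\<psi> x) * g x) = F b - F a - integral {a..b} R"
  proof -
    have "integral {a..b} (\<lambda>x. \<i> * (cis (\<psi> x) * g x) + R x)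
       = integral {a..b} (\<lambda>x. \<i> * (cis (\<psi> x) * g x)) + integral {a..b} R"
      by (intro integral_add integrable_continuous_real continuous_intros ci cR)
    thus ?thesis using integral_unique[OF I1] by simp
  qed
  have nF: "cmod (F x) \<le> G / \<mu>" if x: "x \<in> {a..b}" for x
  proof -
    have "cmod (F x) = cmod (g x) / \<bar>\<psi>1 x\<bar>" by (simp add: F_def norm_mult norm_inverse divide_inverse)
    also have "\<dots> \<le> G / \<mu>" by (intro frac_le G x am mu Gp)
    finally show ?thesis .
  qed
  have I2: "((\<lambda>x. \<psi>2 x * (inverse (\<psi>1 x))\<^sup>2) has_integral (inverse (\<psi>1 a) - inverse (\<psi>1 b))) {a..b}"
  proof -
    have "((\<lambda>x. \<psi>2 x * (inverse (\<psi>1 x))\<^sup>2) has_integral (- inverse (\<psi>1 b) - (- inverse (\<psi>1 a)))) {a..b}"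
    proof (rule fundamental_theorem_of_calculus[OF ab])
      fix x assume x: "x \<in> {a..b}"
      have "((\<lambda>x. - inverse (\<psi>1 x)) has_real_derivative (\<psi>2 x * (inverse (\<psi>1 x))\<^sup>2)) (at x)"
        using DERIV_minus[OF DERIV_inverse_fun[OF d2[OF x] nz[OF x]]]
        by (simp add: power2_eq_square field_simps)
      thus "((\<lambda>x. - inverse (\<psi>1 x)) has_vector_derivative \<psi>2 x * (inverse (\<psi>1 x))\<^sup>2) (at x within {a..b})"
        by (simp add: has_real_derivative_iff_has_vector_derivative has_vector_derivative_at_within)
    qed
    thus ?thesis by simp
  qed
  have I2b: "inverse (\<psi>1 a) - inverse (\<psi>1 b) \<le> 1 / \<mu>"
  proof -
    have ia: "a \<in> {a..b}" "b \<in> {a..b}" using ab by auto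
    from sep show ?thesis
    proof
      assume "\<forall>x\<in>{a..b}. \<psi>1 x \<ge> \<mu>"
      hence "\<psi>1 a \<ge> \<mu>" "\<psi>1 b \<ge> \<mu>" using ia by auto
      hence "inverse (\<psi>1 a) \<le> inverse \<mu>" "inverse (\<psi>1 b) \<ge> 0" using mu le_imp_inverse_le by auto
      thus ?thesis unfolding divide_inverse by linarith
    next
      assume "\<forall>x\<in>{a..b}. \<psi>1 x \<le> -\<mu>"
      hence "-\<psi>1 a \<ge> \<mu>" "-\<psi>1 b \<ge> \<mu>" using ia by force+
      hence "inverse (- \<psi>1 b) \<le> inverse \<mu>" "inverse (-\<psi>1 a) \<ge> 0"
        using mu le_imp_inverse_le by (blast, simp)
      thus ?thesis unfolding inverse_minus_eq divide_inverse by linarith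
    qed
  qed
  have "cmod (integral {a..b} R) \<le> integral {a..b} (\<lambda>x. G1 / \<mu> + G * (\<psi>2 x * (inverse (\<psi>1 x))\<^sup>2))"
  proof (rule integral_norm_bound_integral)
    show "R integrable_on {a..b}" by (rule integrable_continuous_real[OF cR])
    show "(\<lambda>x. G1 / \<mu> + G * (\<psi>2 x * (inverse (\<psi>1 x))\<^sup>2)) integrable_on {a..b}"
      by (intro integrable_continuous_real continuous_intros c2 cp) (use nz in auto)
    fix x assume x: "x \<in> {a..b}"
    have "cmod (R x) \<le> cmod (cis (\<psi> x) * g1 x * complex_of_real (inverse (\<psi>1 x)))
      + cmod (cis (\<psi> x) * g x * complex_of_real (\<psi>2 x * (inverse (\<psi>1 x))\<^sup>2))"
      unfolding R_def by (rule norm_triangle_ineq4)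
    also have "\<dots> = cmod (g1 x) / \<bar>\<psi>1 x\<bar> + cmod (g x) * (\<psi>2 x * (inverse (\<psi>1 x))\<^sup>2)"
      using p2[OF x] by (simp add: norm_mult norm_inverse divide_inverse norm_power power_inverse)
    also have "\<dots> \<le> G1 / \<mu> + G * (\<psi>2 x * (inverse (\<psi>1 x))\<^sup>2)"
      by (intro add_mono frac_le mult_right_mono G G1 x am mu G1p) (use p2[OF x] in auto)
    finally show "cmod (R x) \<le> G1 / \<mu> + G * (\<psi>2 x * (inverse (\<psi>1 x))\<^sup>2)" .
  qed
  also have "\<dots> = G1 / \<mu> * (b - a) + G * (inverse (\<psi>1 a) - inverse (\<psi>1 b))"
  proof -
    have "((\<lambda>x. G1 / \<mu> + G * (\<psi>2 x * (inverse (\<psi>1 x))\<^sup>2)) has_integral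
       (b - a) *\<^sub>R (G1 / \<mu>) + G * (inverse (\<psi>1 a) - inverse (\<psi>1 b))) {a..b}"
      by (intro has_integral_add has_integral_mult_right I2)
        (use has_integral_const_real[of "G1 / \<mu>" a b] ab in simp)
    thus ?thesis using ab by (simp add: integral_unique mult.commute)
  qed
  also have "\<dots> \<le> G1 / \<mu> * (b - a) + G * (1 / \<mu>)"
    by (intro add_left_mono mult_left_mono I2b Gp)
  finally have R: "cmod (integral {a..b} R) \<le> G1 / \<mu> * (b - a) + G * (1 / \<mu>)" .
  have "cmod (integral {a..b} (\<lambda>x. cis (\<psi> x) * g x)) = cmod (F b - F a - integral {a..b} R)"
    by (subst eq[symmetric]) (simp add: norm_mult)
  also have "\<dots> \<le> cmod (F b) + cmod (F a) + cmod (integral {a..b} R)"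
    by (smt (verit) norm_triangle_ineq4)
  also have "\<dots> \<le> G / \<mu> + G / \<mu> + (G1 / \<mu> * (b - a) + G * (1 / \<mu>))"
    by (intro add_mono nF R) (use ab in auto)
  also have "\<dots> = (3 * G + G1 * (b - a)) / \<mu>"
    using mu by (simp add: add_divide_distrib diff_divide_distrib ring_distribs)
  finally show ?thesis .
qed

text \<open>Writing the lower bound as 1 / \<open>\<delta>\<^sup>2\<close> gives
  \<open>\<delta>\<close> a double role: it is the half-width of the interval removed around the
  zero of \<open>\<psi>1\<close>, and 1 / \<open>\<delta>\<close> bounds \<open>\<psi>1\<close> from
  below outside, since \<open>\<psi>1\<close> changes by at least \<open>\<delta>\<close> /
  \<open>\<delta>\<^sup>2\<close> over a distance \<open>\<delta>\<close>. The removed interval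
  costs 2 \<open>\<delta>\<close> \<open>G\<close> and each outer piece one first derivative test,
  whence 8 = 3 + 3 + 2.\<close>

lemma oscillatory_second_derivative:
  fixes \<psi> \<psi>1 \<psi>2 :: "real \<Rightarrow> real" and g g1 :: "real \<Rightarrow> complex"
  assumes ab: "a \<le> b" and dl: "\<delta> > 0"
    and d1: "\<And>x. (\<psi> has_real_derivative \<psi>1 x) (at x)"
    and d2: "\<And>x. (\<psi>1 has_real_derivative \<psi>2 x) (at x)"
    and c2: "continuous_on {a..b} \<psi>2" and p2: "\<And>x. x \<in> {a..b} \<Longrightarrow> \<psi>2 x \<ge> 1 / \<delta>\<^sup>2"
    and dg: "\<And>x. (g has_vector_derivative g1 x) (at x)"
    and cg: "continuous_on {a..b} g1"
    and G: "\<And>x. cmod (g x) \<le> G" and G1: "\<And>x. cmod (g1 x) \<le> G1"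
  shows "cmod (integral {a..b} (\<lambda>x. cis (\<psi> x) * g x)) \<le> \<delta> * (8 * G + 2 * (G1 * (b - a)))"
proof -
  have Gp: "G \<ge> 0" using G[of a] by (smt (verit) norm_ge_zero)
  have G1p: "G1 \<ge> 0" using G1[of a] by (smt (verit) norm_ge_zero)
  have p0: "\<psi>2 x \<ge> 0" if "x \<in> {a..b}" for x using p2[OF that] dl
    by (smt (verit) divide_nonneg_nonneg zero_le_power2)
  have slope: "\<psi>1 y - \<psi>1 x \<ge> (y - x) / \<delta>\<^sup>2" if xy: "a \<le> x" "x \<le> y" "y \<le> b" for x y
  proof (cases "x = y")
    case False
    then obtain z where z: "x < z" "z < y" "\<psi>1 y - \<psi>1 x = (y - x) * \<psi>2 z"
      using MVT2[of x y \<psi>1 \<psi>2] d2 xy by force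
    have "(y - x) * \<psi>2 z \<ge> (y - x) * (1 / \<delta>\<^sup>2)"
      by (intro mult_left_mono p2) (use z xy in auto)
    thus ?thesis using z by simp
  qed auto
  have cont1: "isCont \<psi>1 x" for x using d2 DERIV_isCont by blast
  \<comment> \<open>If \<open>\<psi>1\<close> keeps one sign, \<open>c\<close> is the endpoint where
    it is closest to 0; the outer piece on that side is then empty.\<close>
  obtain c where c: "a \<le> c" "c \<le> b" "c = a \<and> \<psi>1 a \<ge> 0 \<or> c = b \<and> \<psi>1 b \<le> 0 \<or> \<psi>1 c = 0"
  proof (cases "\<psi>1 a \<ge> 0 \<or> \<psi>1 b \<le> 0")
    case True thus ?thesis using that ab by blast
  next
    case False
    then obtain x where "a \<le> x" "x \<le> b" "\<psi>1 x = 0"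
      using IVT[of \<psi>1 a 0 b] ab cont1 by auto
    thus ?thesis using that by blast
  qed
  define p where "p = max a (c - \<delta>)"
  define r where "r = min b (c + \<delta>)"
  have pr: "a \<le> p" "p \<le> r" "r \<le> b" "r - p \<le> 2 * \<delta>" using c dl by (auto simp: p_def r_def)
  have cf: "continuous_on S (\<lambda>x. cis (\<psi> x) * g x)" for S
    by (intro continuous_intros continuous_on_cis)
      (meson d1 dg DERIV_isCont continuous_at_imp_continuous_on has_vector_derivative_continuous)+
  have if': "(\<lambda>x. cis (\<psi> x) * g x) integrable_on {u..v}" for u v
    by (rule integrable_continuous_real[OF cf])
  let ?I = "\<lambda>u v. integral {u..v} (\<lambda>x. cis (\<psi> x) * g x)"
  have dd: "\<delta> / \<delta>\<^sup>2 = 1 / \<delta>" using dl by (simp add: power2_eq_square)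
  have b0: "(3 * G + G1 * (b - a)) * \<delta> \<ge> 0" using Gp G1p ab dl by simp
  have side: "cmod (?I u v) \<le> (3 * G + G1 * (b - a)) * \<delta>"
    if uv: "a \<le> u" "u \<le> v" "v \<le> b"
      and sep: "(\<forall>x\<in>{u..v}. 1 / \<delta> \<le> \<psi>1 x) \<or> (\<forall>x\<in>{u..v}. \<psi>1 x \<le> - (1 / \<delta>))" for u v
  proof -
    have "cmod (?I u v) \<le> (3 * G + G1 * (v - u)) / (1 / \<delta>)"
    proof (rule oscillatory_first_derivative[OF uv(2) _ _ _ _ _ dg _ G G1 sep])
      show "continuous_on {u..v} \<psi>2" "continuous_on {u..v} g1"
        using continuous_on_subset[OF c2] continuous_on_subset[OF cg] uv by auto
      show "0 \<le> \<psi>2 x" if "x \<in> {u..v}" for x using p0 that uv by auto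
    qed (use dl d1 d2 in auto)
    also have "\<dots> \<le> (3 * G + G1 * (b - a)) * \<delta>"
      using uv G1p dl by (auto intro!: mult_right_mono mult_left_mono)
    finally show ?thesis .
  qed
  have L: "cmod (?I a p) \<le> (3 * G + G1 * (b - a)) * \<delta>"
  proof (cases "p = a")
    case False
    hence pc: "p = c - \<delta>" "a < p" by (auto simp: p_def max_def split: if_splits)
    have c0: "\<psi>1 c \<le> 0" using c pc dl by auto
    have "\<psi>1 x \<le> - (1 / \<delta>)" if x: "x \<in> {a..p}" for x
    proof -
      have "\<psi>1 c - \<psi>1 x \<ge> (c - x) / \<delta>\<^sup>2" using slope[of x c] x pc c dl by auto
      moreover have "(c - x) / \<delta>\<^sup>2 \<ge> \<delta> / \<delta>\<^sup>2" by (intro divide_right_mono) (use x pc in auto)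
      ultimately show ?thesis using c0 dd by linarith
    qed
    thus ?thesis using pr by (intro side) auto
  qed (use b0 in simp)
  have R: "cmod (?I r b) \<le> (3 * G + G1 * (b - a)) * \<delta>"
  proof (cases "r = b")
    case False
    hence pc: "r = c + \<delta>" "r < b" by (auto simp: r_def min_def split: if_splits)
    have c0: "\<psi>1 c \<ge> 0" using c pc dl by auto
    have "\<psi>1 x \<ge> 1 / \<delta>" if x: "x \<in> {r..b}" for x
    proof -
      have "\<psi>1 x - \<psi>1 c \<ge> (x - c) / \<delta>\<^sup>2" using slope[of c x] x pc c dl by auto
      moreover have "(x - c) / \<delta>\<^sup>2 \<ge> \<delta> / \<delta>\<^sup>2" by (intro divide_right_mono) (use x pc in auto)
      ultimately show ?thesis using c0 dd by linarith
    qed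
    thus ?thesis using pr by (intro side) auto
  qed (use b0 in simp)
  have M: "cmod (?I p r) \<le> G * (r - p)"
    by (rule integral_bound[OF pr(2) cf]) (use G in \<open>auto simp: norm_mult\<close>)
  have M': "G * (r - p) \<le> G * (2 * \<delta>)" by (intro mult_left_mono pr Gp)
  have sp: "?I u v = ?I u c + ?I c v" if "u \<le> c" "c \<le> v" for u c v
    using Henstock_Kurzweil_Integration.integral_combine[OF that if'] by simp
  have "?I a b = ?I a p + ?I p r + ?I r b"
    using sp[of a p b] sp[of p r b] pr by simp
  hence "cmod (?I a b) \<le> cmod (?I a p) + cmod (?I p r) + cmod (?I r b)"
    by (smt (verit) norm_triangle_ineq)
  also have "\<dots> \<le> \<delta> * (8 * G + 2 * (G1 * (b - a)))"
    using L R M M' by (simp add: algebra_simps)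
  finally show ?thesis .
qed

lemma oscillatory_second_derivative_neg:
  fixes \<psi> \<psi>1 \<psi>2 :: "real \<Rightarrow> real" and g g1 :: "real \<Rightarrow> complex"
  assumes ab: "a \<le> b" and dl: "\<delta> > 0"
    and d1: "\<And>x. (\<psi> has_real_derivative \<psi>1 x) (at x)"
    and d2: "\<And>x. (\<psi>1 has_real_derivative \<psi>2 x) (at x)"
    and c2: "continuous_on {a..b} \<psi>2" and p2: "\<And>x. x \<in> {a..b} \<Longrightarrow> \<psi>2 x \<le> - (1 / \<delta>\<^sup>2)"
    and dg: "\<And>x. (g has_vector_derivative g1 x) (at x)"
    and cg: "continuous_on {a..b} g1"
    and G: "\<And>x. cmod (g x) \<le> G" and G1: "\<And>x. cmod (g1 x) \<le> G1"
  shows "cmod (integral {a..b} (\<lambda>x. cis (\<psi> x) * g x)) \<le> \<delta> * (8 * G + 2 * (G1 * (b - a)))"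
proof -
  have "cmod (integral {a..b} (\<lambda>x. cis (- \<psi> x) * cnj (g x))) \<le> \<delta> * (8 * G + 2 * (G1 * (b - a)))"
  proof (rule oscillatory_second_derivative[OF ab dl, where ?\<psi>1.0 = "\<lambda>x. - \<psi>1 x" and ?\<psi>2.0 = "\<lambda>x. - \<psi>2 x" and ?g1.0 = "\<lambda>x. cnj (g1 x)"])
    show "((\<lambda>x. cnj (g x)) has_vector_derivative cnj (g1 x)) (at x)" for x
      by (rule has_vector_derivative_cnj[OF dg])
  qed (use d1 d2 c2 p2 cg G G1 in \<open>auto intro!: continuous_intros DERIV_minus\<close>, force)
  moreover have "integral {a..b} (\<lambda>x. cis (- \<psi> x) * cnj (g x))
     = cnj (integral {a..b} (\<lambda>x. cis (\<psi> x) * g x))"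
    by (subst integral_cnj) (simp add: cis_cnj)
  ultimately show ?thesis by simp
qed

text \<open>The second derivative -2 t cos x does not see \<open>m\<close>, hence the uniformity.
  Within distance \<open>e\<close> of its zeros +-pi/2 the trivial bound is used; elsewhere |cos x|
  is at least \<open>e\<close> / 2 and the second derivative at least \<open>t * e\<close> in size.
  The choice \<open>e\<close> = t^(-1/3) gives \<open>t * e\<close> = 1 / \<open>e\<^sup>2\<close>,
  so the second derivative test costs a multiple of \<open>e\<close> as well. Three intervals and
  two gaps of length 2 \<open>e\<close> give 28 = 3 * 8 + 2 * 2 and 12 pi = 3 * 4 pi.\<close>

lemma oscillatory_cos:
  fixes g g1 :: "real \<Rightarrow> complex"
  assumes dg: "\<And>x. (g has_vector_derivative g1 x) (at x)"
    and cg: "continuous_on UNIV g1"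
    and G: "\<And>x. cmod (g x) \<le> G" and G1: "\<And>x. cmod (g1 x) \<le> G1" and t: "t \<ge> 1"
  shows "cmod (integral {-pi..pi} (\<lambda>x. cis (2 * t * cos x + m * x) * g x))
      \<le> (28 * G + 12 * pi * G1) * t powr (-1/3)"
proof -
  define e where "e = t powr (-1/3)"
  have Gp: "G \<ge> 0" using G[of 0] by (smt (verit) norm_ge_zero)
  have G1p: "G1 \<ge> 0" using G1[of 0] by (smt (verit) norm_ge_zero)
  have e0: "e > 0" "e \<le> 1"
    using t powr_mono[of "-1/3" 0 t] by (auto simp: e_def)
  have e3: "t * e = 1 / e\<^sup>2"
  proof -
    have "e ^ 3 = t powr (-1)" using t by (simp add: e_def powr_power)
    hence "t * e ^ 3 = 1" using t by (simp add: powr_minus)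
    thus ?thesis using e0 by (simp add: power2_eq_square power3_eq_cube field_simps)
  qed
  \<comment> \<open>Since \<open>e\<close> \<le> 1 < pi / 3, the derivative cos is at least 1/2 on
    [0, \<open>e\<close>].\<close>
  have sin_e: "sin e \<ge> e / 2"
  proof -
    obtain z where z: "0 < z" "z < e" "sin e - sin 0 = (e - 0) * cos z"
      using MVT2[of 0 e sin cos] e0 by auto
    have "cos z \<ge> cos (pi / 3)"
      by (rule cos_monotone_0_pi_le) (use z e0 pi_gt3 in auto)
    hence "e * cos z \<ge> e * (1/2)" using e0 by (intro mult_left_mono) (auto simp: cos_60)
    thus ?thesis using z by simp
  qed
  define \<alpha> where "\<alpha> = pi / 2 - e"
  have al: "0 < \<alpha>" "\<alpha> < pi / 2" using e0 pi_gt3 by (auto simp: \<alpha>_def)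
  have ca: "cos \<alpha> \<ge> e / 2" using sin_e by (simp add: \<alpha>_def cos_diff)
  have cosl: "cos x \<ge> e / 2" if "\<bar>x\<bar> \<le> \<alpha>" for x
  proof -
    have "cos \<bar>x\<bar> \<ge> cos \<alpha>" by (rule cos_monotone_0_pi_le) (use that al in auto)
    thus ?thesis using ca by simp
  qed
  define \<psi> where "\<psi> = (\<lambda>x. 2 * t * cos x + m * x)"
  define \<psi>1 where "\<psi>1 = (\<lambda>x. - 2 * t * sin x + m)"
  define \<psi>2 where "\<psi>2 = (\<lambda>x. - 2 * t * cos x)"
  have d1: "(\<psi> has_real_derivative \<psi>1 x) (at x)" for x
    unfolding \<psi>_def \<psi>1_def by (auto intro!: derivative_eq_intros)
  have d2: "(\<psi>1 has_real_derivative \<psi>2 x) (at x)" for x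
    unfolding \<psi>1_def \<psi>2_def by (auto intro!: derivative_eq_intros)
  have c2: "continuous_on S \<psi>2" for S unfolding \<psi>2_def by (intro continuous_intros)
  have low: "2 * t * c \<ge> 1 / e\<^sup>2" if "c \<ge> e / 2" for c
    using mult_left_mono[OF that, of "2 * t"] t e3 by simp
  let ?I = "\<lambda>u v. integral {u..v} (\<lambda>x. cis (\<psi> x) * g x)"
  have cf: "continuous_on S (\<lambda>x. cis (\<psi> x) * g x)" for S
    by (intro continuous_intros continuous_on_cis)
      (meson d1 dg DERIV_isCont continuous_at_imp_continuous_on has_vector_derivative_continuous)+
  have if': "(\<lambda>x. cis (\<psi> x) * g x) integrable_on {u..v}" for u v
    by (rule integrable_continuous_real[OF cf])
  have len: "e * (8 * G + 2 * (G1 * (v - u))) \<le> e * (8 * G + 4 * pi * G1)" if "v - u \<le> 2 * pi" for u v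
  proof -
    have "G1 * (v - u) \<le> G1 * (2 * pi)" using that G1p by (rule mult_left_mono)
    thus ?thesis using e0 by simp
  qed
  have A: "cmod (?I (-\<alpha>) \<alpha>) \<le> e * (8 * G + 4 * pi * G1)"
  proof -
    have "cmod (?I (-\<alpha>) \<alpha>) \<le> e * (8 * G + 2 * (G1 * (\<alpha> - (-\<alpha>))))"
    proof (rule oscillatory_second_derivative_neg[OF _ e0(1) d1 d2 c2 _ dg _ G G1])
      show "\<psi>2 x \<le> - (1 / e\<^sup>2)" if "x \<in> {- \<alpha>..\<alpha>}" for x
        using low[OF cosl[of x]] that by (auto simp: \<psi>2_def)
    qed (use al cg continuous_on_subset in auto)
    also have "\<dots> \<le> e * (8 * G + 4 * pi * G1)" by (rule len) (use al in auto)
    finally show ?thesis .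
  qed
  have cosr: "- cos x \<ge> e / 2" if "\<bar>x - pi\<bar> \<le> \<alpha> \<or> \<bar>x + pi\<bar> \<le> \<alpha>" for x
    using that cosl[of "x - pi"] cosl[of "x + pi"] by auto
  have BC: "cmod (?I u v) \<le> e * (8 * G + 4 * pi * G1)"
    if uv: "u \<le> v" "v - u \<le> 2 * pi" and c: "\<And>x. x \<in> {u..v} \<Longrightarrow> - cos x \<ge> e / 2" for u v
  proof -
    have "cmod (?I u v) \<le> e * (8 * G + 2 * (G1 * (v - u)))"
    proof (rule oscillatory_second_derivative[OF uv(1) e0(1) d1 d2 c2 _ dg _ G G1])
      show "1 / e\<^sup>2 \<le> \<psi>2 x" if "x \<in> {u..v}" for x
        using low[OF c[OF that]] by (simp add: \<psi>2_def)
    qed (use cg continuous_on_subset in auto)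
    also have "\<dots> \<le> e * (8 * G + 4 * pi * G1)" by (rule len[OF uv(2)])
    finally show ?thesis .
  qed
  have B: "cmod (?I (pi - \<alpha>) pi) \<le> e * (8 * G + 4 * pi * G1)"
    and C: "cmod (?I (-pi) (-pi + \<alpha>)) \<le> e * (8 * G + 4 * pi * G1)"
    using al by (auto intro!: BC cosr)
  have D: "cmod (?I \<alpha> (pi - \<alpha>)) \<le> G * (2 * e)" "cmod (?I (-pi+\<alpha>) (-\<alpha>)) \<le> G * (2 * e)"
  proof -
    have "cmod (?I \<alpha> (pi - \<alpha>)) \<le> G * ((pi - \<alpha>) - \<alpha>)"
      by (rule integral_bound[OF _ cf]) (use G al in \<open>auto simp: norm_mult\<close>)
    thus "cmod (?I \<alpha> (pi - \<alpha>)) \<le> G * (2 * e)" by (simp add: \<alpha>_def)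
    have "cmod (?I (-pi+\<alpha>) (-\<alpha>)) \<le> G * ((-\<alpha>) - (-pi+\<alpha>))"
      by (rule integral_bound[OF _ cf]) (use G al in \<open>auto simp: norm_mult\<close>)
    thus "cmod (?I (-pi+\<alpha>) (-\<alpha>)) \<le> G * (2 * e)" by (simp add: \<alpha>_def)
  qed
  have sp: "?I u v = ?I u c + ?I c v" if "u \<le> c" "c \<le> v" for u c v
    using Henstock_Kurzweil_Integration.integral_combine[OF that if'] by simp
  have "?I (-pi) pi = ?I (-pi) (-pi+\<alpha>) + ?I (-pi+\<alpha>) (-\<alpha>) + ?I (-\<alpha>) \<alpha> + ?I \<alpha> (pi-\<alpha>) + ?I (pi - \<alpha>) pi"
    using sp[of "-pi" "-pi+\<alpha>" pi] sp[of "-pi+\<alpha>" "-\<alpha>" pi] sp[of "-\<alpha>" \<alpha> pi]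
      sp[of \<alpha> "pi-\<alpha>" pi] al by simp
  hence "cmod (?I (-pi) pi) \<le> cmod (?I (-pi) (-pi+\<alpha>)) + cmod (?I (-pi+\<alpha>) (-\<alpha>)) + cmod (?I (-\<alpha>) \<alpha>)
     + cmod (?I \<alpha> (pi-\<alpha>)) + cmod (?I (pi - \<alpha>) pi)"
    by (smt (verit) norm_triangle_ineq)
  also have "\<dots> \<le> (28 * G + 12 * pi * G1) * e"
    using A B C D by (simp add: algebra_simps)
  finally show ?thesis by (simp add: \<psi>_def e_def)
qed

section \<open>Coefficients of the Jost solutions\<close>

text \<open>\<open>jcoeff q n j\<close> is the coefficient of \<open>\<zeta> ^ j\<close> in the solution of the Volterra equation
  \<open>h n = 1 + (\<Sum>m>n. (\<Sum>i<m-n. \<zeta> ^ (2 * i + 1)) * q m * h m)\<close>, for which \<open>\<zeta> powi n * h n\<close> is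
  the Jost solution at \<open>+\<infinity>\<close>.\<close>

function jcoeff :: "(int \<Rightarrow> real) \<Rightarrow> int \<Rightarrow> nat \<Rightarrow> real" where
  "jcoeff q n 0 = 1"
| "jcoeff q n (Suc j) = (\<Sum>l. q (n + 1 + int l) *
     (\<Sum>i | i \<le> l \<and> 2 * i \<le> j. jcoeff q (n + 1 + int l) (j - 2 * i)))"
  by pat_completeness auto
termination by (relation "Wellfounded.measure (\<lambda>(q, n, j). j)") auto

definition short_range :: "(int \<Rightarrow> real) \<Rightarrow> bool" where
  "short_range q \<longleftrightarrow> (\<lambda>n. (1 + real_of_int \<bar>n\<bar>)\<^sup>2 * \<bar>q n\<bar>) summable_on UNIV"

text \<open>Growth on the wrong half line: the l^1 norm of the coefficients at site \<open>n\<close>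
  will be bounded by a multiple of \<open>lweight n\<close>, that of the differentiated series by a
  multiple of its square.\<close>

definition lweight :: "int \<Rightarrow> real" where "lweight n = 1 + real_of_int (max 0 (- n))"

text \<open>The factor 2 covers the sum of 2 i + 2 over i \<le> l, which is at most 2 (l + 1)^2 and
  arises for the differentiated series. One majorant then serves both norms.\<close>

definition qw :: "(int \<Rightarrow> real) \<Rightarrow> int \<Rightarrow> real" where
  "qw q m = 2 * ((1 + real_of_int \<bar>m\<bar>)\<^sup>2 * \<bar>q m\<bar>)"

definition qtail :: "(int \<Rightarrow> real) \<Rightarrow> int \<Rightarrow> real" where
  "qtail q n = (\<Sum>l. qw q (n + 1 + int l))"

lemma lweight_ge_1: "lweight n \<ge> 1" by (simp add: lweight_def)

lemma lweight_nonneg: "n \<ge> 0 \<Longrightarrow> lweight n = 1" by (simp add: lweight_def)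

lemma qw_nonneg: "qw q m \<ge> 0" by (simp add: qw_def)

lemma has_sum_qw_shift:
  assumes "short_range q"
  shows "summable (\<lambda>l. qw q (n + 1 + int l))" "qtail q n \<le> (\<Sum>\<^sub>\<infinity>m. qw q m)"
proof -
  have s: "qw q summable_on UNIV"
    unfolding qw_def by (rule summable_on_cmult_right) (use assms in \<open>simp add: short_range_def\<close>)
  have inj: "inj (\<lambda>l. n + 1 + int l)" by (auto intro: injI)
  have "qw q summable_on range (\<lambda>l. n + 1 + int l)" using s summable_on_subset_banach by blast
  hence s2: "(\<lambda>l. qw q (n + 1 + int l)) summable_on UNIV"
    using summable_on_reindex[OF inj, of "qw q"] by (simp add: o_def)
  thus "summable (\<lambda>l. qw q (n + 1 + int l))" by (rule summable_on_imp_summable)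
  have "qtail q n = (\<Sum>\<^sub>\<infinity>l. qw q (n + 1 + int l))"
    unfolding qtail_def using s2 by (metis has_sum_imp_sums has_sum_infsum sums_unique)
  also have "\<dots> = infsum (qw q) (range (\<lambda>l. n + 1 + int l))"
    using infsum_reindex[OF inj, of "qw q"] by (simp add: o_def)
  also have "\<dots> \<le> infsum (qw q) UNIV"
    by (rule infsum_mono2) (use s summable_on_subset_banach qw_nonneg in auto)
  finally show "qtail q n \<le> (\<Sum>\<^sub>\<infinity>m. qw q m)" by simp
qed

lemmas summable_qw = has_sum_qw_shift(1)

lemma qtail_step: "short_range q \<Longrightarrow> qtail q n = qw q (n + 1) + qtail q (n + 1)"
  using suminf_split_head[OF summable_qw[of q n]] unfolding qtail_def by (simp add: algebra_simps)

lemma qtail_nonneg: "short_range q \<Longrightarrow> qtail q n \<ge> 0"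
  unfolding qtail_def by (rule suminf_nonneg[OF summable_qw]) (auto simp: qw_nonneg)

lemma qtail_tendsto: "short_range q \<Longrightarrow> (\<lambda>N. qtail q (int N)) \<longlonglongrightarrow> 0"
  using suminf_exist_split2[OF summable_qw[of q 0]] unfolding qtail_def by (simp add: algebra_simps)

text \<open>Discrete Gronwall argument: 1 + x \<le> e^x, taken at x = \<open>qw q (m + 1)\<close>,
  bounds each term by a decrement of \<open>exp (qtail q m)\<close>, and the decrements telescope.
  Hence \<open>exp (qtail q n) - 1\<close> is a bound that one more pass through the Volterra
  equation reproduces.\<close>

lemma qtail_exp_sum:
  assumes "short_range q"
  shows "summable (\<lambda>l. qw q (n + 1 + int l) * exp (qtail q (n + 1 + int l)))"
    "(\<Sum>l. qw q (n + 1 + int l) * exp (qtail q (n + 1 + int l))) \<le> exp (qtail q n) - 1"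
proof -
  have st: "qw q (m + 1) * exp (qtail q (m + 1)) \<le> exp (qtail q m) - exp (qtail q (m + 1))" for m
  proof -
    have "(1 + qw q (m + 1)) * exp (qtail q (m + 1)) \<le> exp (qw q (m + 1)) * exp (qtail q (m + 1))"
      by (intro mult_right_mono exp_ge_add_one_self) auto
    thus ?thesis using qtail_step[OF assms, of m] by (simp add: exp_add algebra_simps)
  qed
  have "(\<Sum>l<N. qw q (n + 1 + int l) * exp (qtail q (n + 1 + int l))) \<le> exp (qtail q n) - exp (qtail q (n + int N))" for N
  proof (induction N)
    case (Suc N)
    thus ?case using st[of "n + int N"] by (simp add: algebra_simps)
  qed auto
  hence p: "(\<Sum>l<N. qw q (n + 1 + int l) * exp (qtail q (n + 1 + int l))) \<le> exp (qtail q n) - 1" for N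
    using qtail_nonneg[OF assms, of "n + int N"] by (smt (verit) one_le_exp_iff)
  show s: "summable (\<lambda>l. qw q (n + 1 + int l) * exp (qtail q (n + 1 + int l)))"
    by (rule bounded_imp_summable[where B = "exp (qtail q n) - 1"])
      (use p in \<open>auto simp: qw_nonneg lessThan_Suc_atMost[symmetric] simp del: sum.lessThan_Suc\<close>)
  show "(\<Sum>l. qw q (n + 1 + int l) * exp (qtail q (n + 1 + int l))) \<le> exp (qtail q n) - 1"
    by (rule suminf_le_const[OF s p])
qed

text \<open>\<open>V\<close> absorbs the growth of the Volterra kernel on the left half line.\<close>

lemma jcoeff_volterra:
  fixes \<omega> :: "nat \<Rightarrow> real"
  assumes q: "short_range q"
    and om1: "\<And>j. \<omega> j \<ge> 1" and wm: "\<And>i j. \<omega> (i + j) \<le> \<omega> i * \<omega> j" and w0: "\<omega> 0 = 1"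
    and V1: "\<And>n. V n \<ge> 1"
    and K: "\<And>n l. (\<Sum>i\<le>l. \<omega> (Suc (2 * i))) * V (n + 1 + int l) * \<bar>q (n + 1 + int l)\<bar>
              \<le> V n * qw q (n + 1 + int l)"
  shows "(\<Sum>j<J. \<omega> (Suc j) * \<bar>jcoeff q n (Suc j)\<bar>) \<le> V n * (exp (qtail q n) - 1)"
    and "summable (\<lambda>l. q (n + 1 + int l) *
     (\<Sum>i | i \<le> l \<and> 2 * i \<le> j. jcoeff q (n + 1 + int l) (j - 2 * i)))"
proof -
  let ?T = "\<lambda>n l. qw q (n + 1 + int l) * exp (qtail q (n + 1 + int l))"
  have wp: "\<omega> j \<ge> 0" for j using om1[of j] by simp
  define A where "A = (\<lambda>n l j. \<bar>q (n + 1 + int l)\<bar> * (\<Sum>i | i \<le> l \<and> 2 * i \<le> j. \<bar>jcoeff q (n + 1 + int l) (j - 2 * i)\<bar>))"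
  \<comment> \<open>One pass of the recursion on truncated sums. After exchanging the sums, each
    \<open>i\<close> shifts the index by 2 i + 1, which costs \<open>\<omega> (Suc (2 * i))\<close>
    by submultiplicativity, and \<open>K\<close> pays for the total cost. Only coefficients of index
    below \<open>J\<close> occur on the right, so the bound for \<open>J - 1\<close> feeds the one
    for \<open>J\<close>.\<close>
  have key: "(\<Sum>j<J. \<omega> (Suc j) * A n l j) \<le> V n * ?T n l"
    if IH: "\<And>n. (\<Sum>j<J - 1. \<omega> (Suc j) * \<bar>jcoeff q n (Suc j)\<bar>) \<le> V n * (exp (qtail q n) - 1)" for J n l
  proof (cases J)
    case 0 thus ?thesis using qw_nonneg[of q "n + 1 + int l"] V1[of n] by simp
  next
    case (Suc J')
    define m where "m = n + 1 + int l"
    have b: "(\<Sum>j<J. \<omega> j * \<bar>jcoeff q m j\<bar>) \<le> V m * exp (qtail q m)"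
    proof -
      have "(\<Sum>j<J. \<omega> j * \<bar>jcoeff q m j\<bar>) = 1 + (\<Sum>j<J'. \<omega> (Suc j) * \<bar>jcoeff q m (Suc j)\<bar>)"
        unfolding Suc sum.lessThan_Suc_shift using w0 by simp
      also have "\<dots> \<le> 1 + V m * (exp (qtail q m) - 1)" using IH[of m] Suc by simp
      also have "\<dots> \<le> V m * exp (qtail q m)" using V1[of m] by (simp add: algebra_simps)
      finally show ?thesis .
    qed
    have "(\<Sum>j<J. \<omega> (Suc j) * (\<Sum>i | i \<le> l \<and> 2 * i \<le> j. \<bar>jcoeff q m (j - 2 * i)\<bar>))
       = (\<Sum>j<J. \<Sum>i\<le>l. if 2 * i \<le> j then \<omega> (Suc j) * \<bar>jcoeff q m (j - 2 * i)\<bar> else 0)"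
    proof (rule sum.cong[OF refl])
      fix j
      have "{i. i \<le> l \<and> 2 * i \<le> j} = {i\<in>{..l}. 2 * i \<le> j}" by auto
      thus "\<omega> (Suc j) * (\<Sum>i | i \<le> l \<and> 2 * i \<le> j. \<bar>jcoeff q m (j - 2 * i)\<bar>)
         = (\<Sum>i\<le>l. if 2 * i \<le> j then \<omega> (Suc j) * \<bar>jcoeff q m (j - 2 * i)\<bar> else 0)"
        by (simp only: sum_distrib_left) (subst sum.inter_filter, auto)
    qed
    also have "\<dots> = (\<Sum>i\<le>l. \<Sum>j<J. if 2 * i \<le> j then \<omega> (Suc j) * \<bar>jcoeff q m (j - 2 * i)\<bar> else 0)"
      by (rule sum.swap)
    also have "\<dots> \<le> (\<Sum>i\<le>l. \<omega> (Suc (2 * i)) * (V m * exp (qtail q m)))"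
    proof (rule sum_mono)
      fix i
      have "(\<Sum>j<J. if 2 * i \<le> j then \<omega> (Suc j) * \<bar>jcoeff q m (j - 2 * i)\<bar> else 0)
        = (\<Sum>j\<in>{2*i..<J}. \<omega> (Suc j) * \<bar>jcoeff q m (j - 2 * i)\<bar>)"
        by (subst sum.inter_filter[symmetric]) (auto intro!: sum.cong)
      also have "\<dots> = (\<Sum>j<J - 2 * i. \<omega> (Suc (2 * i) + j) * \<bar>jcoeff q m j\<bar>)"
        by (rule sum.reindex_bij_witness[where i = "\<lambda>j. j + 2 * i" and j = "\<lambda>j. j - 2 * i"]) auto
      also have "\<dots> \<le> (\<Sum>j<J - 2 * i. \<omega> (Suc (2 * i)) * (\<omega> j * \<bar>jcoeff q m j\<bar>))"
        using wm[of "Suc (2 * i)"] by (intro sum_mono) (simp add: mult_right_mono flip: mult.assoc)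
      also have "\<dots> \<le> (\<Sum>j<J. \<omega> (Suc (2 * i)) * (\<omega> j * \<bar>jcoeff q m j\<bar>))"
        using wp by (intro sum_mono2) (auto intro!: mult_nonneg_nonneg)
      also have "\<dots> \<le> \<omega> (Suc (2 * i)) * (V m * exp (qtail q m))"
        unfolding sum_distrib_left[symmetric] using wp by (intro mult_left_mono b)
      finally show "(\<Sum>j<J. if 2 * i \<le> j then \<omega> (Suc j) * \<bar>jcoeff q m (j - 2 * i)\<bar> else 0)
         \<le> \<omega> (Suc (2 * i)) * (V m * exp (qtail q m))" .
    qed
    also have "\<dots> = (\<Sum>i\<le>l. \<omega> (Suc (2 * i))) * V m * exp (qtail q m)"
      by (simp add: sum_distrib_right mult.assoc)
    finally have "\<bar>q m\<bar> * (\<Sum>j<J. \<omega> (Suc j) * (\<Sum>i | i \<le> l \<and> 2 * i \<le> j. \<bar>jcoeff q m (j - 2 * i)\<bar>))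
       \<le> \<bar>q m\<bar> * ((\<Sum>i\<le>l. \<omega> (Suc (2 * i))) * V m * exp (qtail q m))"
      by (rule mult_left_mono) simp
    also have "\<dots> \<le> (V n * qw q m) * exp (qtail q m)"
      using mult_right_mono[OF K[of l n, folded m_def], of "exp (qtail q m)"] by (simp add: mult_ac)
    finally show ?thesis by (simp add: A_def m_def sum_distrib_left mult_ac)
  qed
  \<comment> \<open>A coefficient is a \<open>suminf\<close>, whose value carries information only
    if the series converges. Convergence for the coefficient of index j + 1 is drawn from the bound
    on the coefficients up to index j, so it must run inside the same induction.\<close>
  have comp: "summable (\<lambda>l. A n l j)"
    if IH: "\<And>n. (\<Sum>j<j. \<omega> (Suc j) * \<bar>jcoeff q n (Suc j)\<bar>) \<le> V n * (exp (qtail q n) - 1)" for j n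
  proof (rule summable_comparison_test'[where N = 0])
    show "summable (\<lambda>l. V n * ?T n l)"
      by (intro summable_mult qtail_exp_sum q)
    fix l
    have Ap: "A n l i \<ge> 0" for i by (simp add: A_def sum_nonneg)
    have "A n l j \<le> \<omega> (Suc j) * A n l j" using om1[of "Suc j"] Ap[of j] by (simp add: mult_le_cancel_right1)
    also have "\<dots> \<le> (\<Sum>j<Suc j. \<omega> (Suc j) * A n l j)"
      using wp Ap by (intro member_le_sum) (auto intro!: mult_nonneg_nonneg)
    also have "\<dots> \<le> V n * ?T n l"
      by (rule key) (use IH in simp)
    finally show "norm (A n l j) \<le> V n * ?T n l"
      using Ap[of j] by simp
  qed
  have ab: "\<bar>q (n + 1 + int l) * (\<Sum>i | i \<le> l \<and> 2 * i \<le> j. jcoeff q (n + 1 + int l) (j - 2 * i))\<bar> \<le> A n l j" for n l j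
    unfolding A_def abs_mult by (intro mult_left_mono sum_abs) auto
  have main: "(\<Sum>j<J. \<omega> (Suc j) * \<bar>jcoeff q n (Suc j)\<bar>) \<le> V n * (exp (qtail q n) - 1)" for J n
  proof (induction J arbitrary: n)
    case 0 thus ?case using V1[of n] qtail_nonneg[OF q, of n] by simp
  next
    case (Suc J)
    have IH': "(\<Sum>j<i. \<omega> (Suc j) * \<bar>jcoeff q n (Suc j)\<bar>) \<le> V n * (exp (qtail q n) - 1)" if "i \<le> J" for i n
    proof -
      have "(\<Sum>j<i. \<omega> (Suc j) * \<bar>jcoeff q n (Suc j)\<bar>) \<le> (\<Sum>j<J. \<omega> (Suc j) * \<bar>jcoeff q n (Suc j)\<bar>)"
        using that wp by (intro sum_mono2) (auto intro!: mult_nonneg_nonneg)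
      thus ?thesis using Suc.IH[of n] by linarith
    qed
    have sm: "summable (\<lambda>l. A n l j)" if "j \<le> J" for j by (rule comp[OF IH'[OF that]])
    have "\<bar>jcoeff q n (Suc j)\<bar> \<le> (\<Sum>l. A n l j)" if j: "j \<le> J" for j
    proof -
      have s: "summable (\<lambda>l. \<bar>q (n + 1 + int l) * (\<Sum>i | i \<le> l \<and> 2 * i \<le> j. jcoeff q (n + 1 + int l) (j - 2 * i))\<bar>)"
        by (rule summable_comparison_test'[OF sm[OF j], where N = 0]) (use ab in simp)
      have "\<bar>jcoeff q n (Suc j)\<bar> \<le> (\<Sum>l. \<bar>q (n + 1 + int l) * (\<Sum>i | i \<le> l \<and> 2 * i \<le> j. jcoeff q (n + 1 + int l) (j - 2 * i))\<bar>)"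
        using summable_rabs[OF s] by simp
      also have "\<dots> \<le> (\<Sum>l. A n l j)" by (rule suminf_le[OF ab s sm[OF j]])
      finally show ?thesis .
    qed
    hence "(\<Sum>j<Suc J. \<omega> (Suc j) * \<bar>jcoeff q n (Suc j)\<bar>) \<le> (\<Sum>j<Suc J. \<omega> (Suc j) * (\<Sum>l. A n l j))"
      using wp by (intro sum_mono mult_left_mono) auto
    also have "\<dots> = (\<Sum>j<Suc J. (\<Sum>l. \<omega> (Suc j) * A n l j))"
      by (intro sum.cong refl suminf_mult[symmetric] sm) auto
    also have "\<dots> = (\<Sum>l. \<Sum>j<Suc J. \<omega> (Suc j) * A n l j)"
      by (intro suminf_sum[symmetric] summable_mult sm) auto
    also have "\<dots> \<le> (\<Sum>l. V n * ?T n l)"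
    proof (rule suminf_le)
      show "(\<Sum>j<Suc J. \<omega> (Suc j) * A n l j) \<le> V n * ?T n l" for l
        by (rule key) (use Suc.IH in simp)
      show "summable (\<lambda>l. \<Sum>j<Suc J. \<omega> (Suc j) * A n l j)"
        by (intro summable_sum summable_mult sm) auto
      show "summable (\<lambda>l. V n * ?T n l)"
        by (intro summable_mult qtail_exp_sum q)
    qed
    also have "\<dots> = V n * (\<Sum>l. ?T n l)"
      by (intro suminf_mult qtail_exp_sum q)
    also have "\<dots> \<le> V n * (exp (qtail q n) - 1)"
      using V1[of n] by (intro mult_left_mono qtail_exp_sum q) auto
    finally show ?case .
  qed
  show "(\<Sum>j<J. \<omega> (Suc j) * \<bar>jcoeff q n (Suc j)\<bar>) \<le> V n * (exp (qtail q n) - 1)" by (rule main)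
  show "summable (\<lambda>l. q (n + 1 + int l) * (\<Sum>i | i \<le> l \<and> 2 * i \<le> j. jcoeff q (n + 1 + int l) (j - 2 * i)))"
    by (rule summable_comparison_test'[OF comp[OF main, of n j], where N = 0]) (use ab in simp)
qed

text \<open>The Volterra kernel is of the size of the distance m - n = l + 1, where m = n + 1 + l,
  and one weight of \<open>q\<close> at m has to pay for it. If m \<ge> 0 the distance is at most
  \<open>lweight n\<close> + |m|; if m < 0 it is at most \<open>lweight n\<close>, while
  \<open>lweight\<close> at m equals 1 + |m|.\<close>

lemma shift_mult_lweight_le:
  "real (Suc l) * lweight (n + 1 + int l) \<le> lweight n * (1 + real_of_int \<bar>n + 1 + int l\<bar>)"
proof (cases "n + 1 + int l \<ge> 0")
  case True
  have "real (Suc l) \<le> lweight n + real_of_int \<bar>n + 1 + int l\<bar>" using True by (simp add: lweight_def)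
  also have "\<dots> \<le> lweight n + lweight n * real_of_int \<bar>n + 1 + int l\<bar>"
    using lweight_ge_1[of n] by (simp add: mult_le_cancel_right1)
  finally show ?thesis using True by (simp add: lweight_nonneg algebra_simps)
next
  case False
  show ?thesis by (rule mult_mono) (use False in \<open>auto simp: lweight_def\<close>)
qed

text \<open>With constant weight the kernel sum just counts its l + 1 terms, which is the distance
  that the trade above pays for.\<close>

lemma jcoeff_sum_bound:
  assumes q: "short_range q"
  shows "(\<Sum>j<J. \<bar>jcoeff q n (Suc j)\<bar>) \<le> lweight n * (exp (qtail q n) - 1)"
    and "summable (\<lambda>l. q (n + 1 + int l) *
     (\<Sum>i | i \<le> l \<and> 2 * i \<le> j. jcoeff q (n + 1 + int l) (j - 2 * i)))"
proof -
  have K: "(\<Sum>i\<le>l. 1) * lweight (n + 1 + int l) * \<bar>q (n + 1 + int l)\<bar> \<le> lweight n * qw q (n + 1 + int l)" for n l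
  proof -
    define m where "m = n + 1 + int l"
    have "real (Suc l) * lweight m \<le> lweight n * (2 * (1 + real_of_int \<bar>m\<bar>)\<^sup>2)"
    proof -
      have "real (Suc l) * lweight m \<le> lweight n * (1 + real_of_int \<bar>m\<bar>)" unfolding m_def by (rule shift_mult_lweight_le)
      also have "\<dots> \<le> lweight n * (2 * (1 + real_of_int \<bar>m\<bar>)\<^sup>2)"
        using lweight_ge_1[of n] by (intro mult_left_mono) (auto simp: power2_eq_square algebra_simps)
      finally show ?thesis .
    qed
    from mult_right_mono[OF this, of "\<bar>q m\<bar>"] show ?thesis by (simp add: m_def qw_def mult_ac)
  qed
  note * = jcoeff_volterra[where \<omega> = "\<lambda>_. 1" and V = lweight, OF q _ _ _ lweight_ge_1 K, simplified]
  show "(\<Sum>j<J. \<bar>jcoeff q n (Suc j)\<bar>) \<le> lweight n * (exp (qtail q n) - 1)"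
    using *(1) by simp
  show "summable (\<lambda>l. q (n + 1 + int l) *
     (\<Sum>i | i \<le> l \<and> 2 * i \<le> j. jcoeff q (n + 1 + int l) (j - 2 * i)))" using *(2) by simp
qed

text \<open>The weight 1 + j is submultiplicative and its kernel sum is quadratic in the distance.
  The trade between distance and weight is therefore used squared, which explains both the square of
  \<open>lweight\<close> and the square inside \<open>qw\<close>.\<close>

lemma jcoeff_weighted_sum_bound:
  assumes q: "short_range q"
  shows "(\<Sum>j<J. (1 + real (Suc j)) * \<bar>jcoeff q n (Suc j)\<bar>) \<le> (lweight n)\<^sup>2 * (exp (qtail q n) - 1)"
proof (rule jcoeff_volterra(1)[where \<omega> = "\<lambda>j. 1 + real j" and V = "\<lambda>n. (lweight n)\<^sup>2", OF q])
  show "1 \<le> (lweight n)\<^sup>2" for n using lweight_ge_1[of n] by (simp add: one_le_power)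
  fix n l
  define m where "m = n + 1 + int l"
  have s: "(\<Sum>i\<le>l. 1 + real (Suc (2 * i))) \<le> 2 * (real (Suc l))\<^sup>2"
  proof -
    have "(\<Sum>i\<le>l. 1 + real (Suc (2 * i))) \<le> (\<Sum>i\<le>l. 2 * real (Suc l))"
      by (intro sum_mono) auto
    also have "\<dots> = 2 * (real (Suc l))\<^sup>2" by (simp add: power2_eq_square algebra_simps)
    finally show ?thesis .
  qed
  have "(real (Suc l))\<^sup>2 * (lweight m)\<^sup>2 \<le> (lweight n)\<^sup>2 * (1 + real_of_int \<bar>m\<bar>)\<^sup>2"
    unfolding power_mult_distrib[symmetric]
  proof (rule power_mono)
    show "real (Suc l) * lweight m \<le> lweight n * (1 + real_of_int \<bar>m\<bar>)" unfolding m_def by (rule shift_mult_lweight_le)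
  qed (use lweight_ge_1[of m] in simp)
  hence "(\<Sum>i\<le>l. 1 + real (Suc (2 * i))) * (lweight m)\<^sup>2 \<le> (lweight n)\<^sup>2 * (2 * (1 + real_of_int \<bar>m\<bar>)\<^sup>2)"
    using mult_right_mono[OF s, of "(lweight m)\<^sup>2"] by simp
  from mult_right_mono[OF this, of "\<bar>q m\<bar>"]
  show "(\<Sum>i\<le>l. 1 + real (Suc (2 * i))) * (lweight (n + 1 + int l))\<^sup>2 * \<bar>q (n + 1 + int l)\<bar>
       \<le> (lweight n)\<^sup>2 * qw q (n + 1 + int l)" by (simp add: m_def qw_def mult_ac)
qed (auto simp: algebra_simps)

section \<open>Difference equation for the coefficients\<close>

definition jcoeff_diff :: "(int \<Rightarrow> real) \<Rightarrow> int \<Rightarrow> nat \<Rightarrow> real" where "jcoeff_diff q n j = jcoeff q n j - jcoeff q (n + 1) j"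

lemma jcoeff_diff_0: "jcoeff_diff q n 0 = 0" by (simp add: jcoeff_diff_def)

text \<open>Passing from \<open>n\<close> to \<open>n + 1\<close> removes the last term i = l from
  the geometric kernel sum at each site. The difference of the two Volterra series keeps just these
  terms and is in effect a finite sum, because the index j - 2 l cannot be negative.\<close>

lemma jcoeff_diff_Suc:
  assumes q: "short_range q"
  shows "summable (\<lambda>l. if 2 * l \<le> j then q (n + 1 + int l) * jcoeff q (n + 1 + int l) (j - 2 * l) else 0)"
    "jcoeff_diff q n (Suc j) = (\<Sum>l. if 2 * l \<le> j then q (n + 1 + int l) * jcoeff q (n + 1 + int l) (j - 2 * l) else 0)"
proof -
  let ?f = "\<lambda>l. if 2 * l \<le> j then q (n + 1 + int l) * jcoeff q (n + 1 + int l) (j - 2 * l) else 0"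
  show sf: "summable ?f"
    by (rule summable_finite[of "{..j}"]) auto
  \<comment> \<open>\<open>P l L\<close> separates the site from the upper limit of the kernel sum:
    at one and the same site the series for \<open>n\<close> sums up to l + 1 where the series for
    \<open>n + 1\<close> sums up to l.\<close>
  define P where "P = (\<lambda>l L. (\<Sum>i | i \<le> L \<and> 2 * i \<le> j. jcoeff q (n + 1 + int l) (j - 2 * i)))"
  have s1: "summable (\<lambda>l. q (n + 1 + int l) * P l l)" unfolding P_def by (rule jcoeff_sum_bound(2)[OF q])
  have s2: "summable (\<lambda>l. q (n + 1 + int (Suc l)) * P (Suc l) l)"
    using jcoeff_sum_bound(2)[OF q, of "n + 1" j] unfolding P_def by (simp add: algebra_simps)
  have P0: "P 0 0 = jcoeff q (n + 1) j"
  proof -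
    have "{i. i \<le> (0::nat) \<and> 2 * i \<le> j} = {0}" by auto
    thus ?thesis by (simp add: P_def)
  qed
  have PS: "P (Suc l) (Suc l) = P (Suc l) l + (if 2 * Suc l \<le> j then jcoeff q (n + 1 + int (Suc l)) (j - 2 * Suc l) else 0)" for l
  proof (cases "2 * Suc l \<le> j")
    case True
    have e: "{i. i \<le> Suc l \<and> 2 * i \<le> j} = insert (Suc l) {i. i \<le> l \<and> 2 * i \<le> j}" using True by auto
    have "finite {i. i \<le> l \<and> 2 * i \<le> j}" by (rule finite_subset[of _ "{..l}"]) auto
    thus ?thesis using True unfolding P_def e by (subst sum.insert) auto
  next
    case False
    have e: "{i. i \<le> Suc l \<and> 2 * i \<le> j} = {i. i \<le> l \<and> 2 * i \<le> j}"
      using False by (auto simp: le_Suc_eq)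
    show ?thesis using False unfolding P_def e by simp
  qed
  have s1': "summable (\<lambda>l. q (n + 1 + int (Suc l)) * P (Suc l) (Suc l))"
    using s1 by (subst summable_Suc_iff)
  have "jcoeff_diff q n (Suc j) = (\<Sum>l. q (n + 1 + int l) * P l l) - (\<Sum>l. q (n + 1 + int (Suc l)) * P (Suc l) l)"
    by (simp add: jcoeff_diff_def P_def algebra_simps)
  also have "(\<Sum>l. q (n + 1 + int l) * P l l) = q (n + 1) * P 0 0 + (\<Sum>l. q (n + 1 + int (Suc l)) * P (Suc l) (Suc l))"
    using suminf_split_head[OF s1] by simp
  also have "\<dots> - (\<Sum>l. q (n + 1 + int (Suc l)) * P (Suc l) l) = ?f 0 + (\<Sum>l. ?f (Suc l))"
  proof -
    have "(\<Sum>l. q (n + 1 + int (Suc l)) * P (Suc l) (Suc l)) - (\<Sum>l. q (n + 1 + int (Suc l)) * P (Suc l) l) = (\<Sum>l. ?f (Suc l))"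
      by (subst suminf_diff[OF s1' s2], rule suminf_cong) (simp add: PS algebra_simps)
    thus ?thesis by (simp add: P0)
  qed
  also have "\<dots> = suminf ?f" using suminf_split_head[OF sf] by simp
  finally show "jcoeff_diff q n (Suc j) = suminf ?f" .
qed

text \<open>Coefficientwise form of h(n) - h(n+1) = \<zeta> q(n+1) h(n+1) + \<zeta>^2 (h(n+1) -
  h(n+2)), which is the eigenvalue equation for \<zeta>^n h(n). It holds because a site other than n
  + 1 carries, seen from n, \<zeta>^2 times the kernel power that it carries seen from n +
  1.\<close>

lemma jcoeff_diff_rec:
  assumes q: "short_range q"
  shows "jcoeff_diff q n 1 = q (n + 1)" "jcoeff_diff q n (Suc (Suc j)) = q (n + 1) * jcoeff q (n + 1) (Suc j) + jcoeff_diff q (n + 1) j"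
proof -
  have sp: "jcoeff_diff q n (Suc i) = q (n + 1) * jcoeff q (n + 1) i
     + (\<Sum>l. if 2 * Suc l \<le> i then q (n + 1 + int (Suc l)) * jcoeff q (n + 1 + int (Suc l)) (i - 2 * Suc l) else 0)" for i
    using suminf_split_head[OF jcoeff_diff_Suc(1)[OF q, of i n]] jcoeff_diff_Suc(2)[OF q, of n i] by simp
  show "jcoeff_diff q n 1 = q (n + 1)" using sp[of 0] by simp
  show "jcoeff_diff q n (Suc (Suc j)) = q (n + 1) * jcoeff q (n + 1) (Suc j) + jcoeff_diff q (n + 1) j"
  proof (cases j)
    case 0 thus ?thesis using sp[of 1] by (simp add: jcoeff_diff_0)
  next
    case (Suc i)
    have "(\<Sum>l. if 2 * Suc l \<le> Suc j then q (n + 1 + int (Suc l)) * jcoeff q (n + 1 + int (Suc l)) (Suc j - 2 * Suc l) else 0)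
       = jcoeff_diff q (n + 1) j"
      unfolding Suc jcoeff_diff_Suc(2)[OF q] by (rule suminf_cong) (simp add: algebra_simps)
    thus ?thesis using sp[of "Suc j"] by simp
  qed
qed

section \<open>Absolutely convergent power series on the circle\<close>

definition pser :: "(nat \<Rightarrow> complex) \<Rightarrow> complex \<Rightarrow> complex" where
  "pser b z = (\<Sum>j. b j * z ^ j)"

text \<open>The weight makes the series and its angular derivative converge absolutely on the whole
  circle.\<close>

definition wl1 :: "(nat \<Rightarrow> complex) \<Rightarrow> bool" where
  "wl1 b \<longleftrightarrow> summable (\<lambda>j. (1 + real j) * cmod (b j))"

lemma wl1_summable: "wl1 b \<Longrightarrow> summable (\<lambda>j. cmod (b j))"
  unfolding wl1_def by (rule summable_comparison_test'[where N = 0]) (auto simp: algebra_simps)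

context
  fixes b :: "nat \<Rightarrow> complex"
  assumes b: "summable (\<lambda>j. cmod (b j))"
begin

lemma pser_term_le: "cmod z \<le> 1 \<Longrightarrow> cmod (b j * z ^ j) \<le> cmod (b j)"
  by (simp add: norm_mult norm_power mult_left_le power_le_one)

lemma pser_summable: "cmod z \<le> 1 \<Longrightarrow> summable (\<lambda>j. cmod (b j * z ^ j))"
  by (rule summable_comparison_test'[OF b, where N = 0]) (use pser_term_le in simp)

lemma pser_sums: "cmod z \<le> 1 \<Longrightarrow> (\<lambda>j. b j * z ^ j) sums pser b z"
  unfolding pser_def by (rule summable_sums[OF summable_norm_cancel[OF pser_summable]])

lemma pser_norm_le: "cmod z \<le> 1 \<Longrightarrow> cmod (pser b z) \<le> (\<Sum>j. cmod (b j))"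
  unfolding pser_def
  by (rule order.trans[OF summable_norm[OF pser_summable]], assumption)
    (intro suminf_le pser_term_le pser_summable b)

lemma pser_uniform_limit:
  "uniform_limit (cball 0 1) (\<lambda>N z. \<Sum>j<N. b j * z ^ j) (pser b) sequentially"
  unfolding pser_def by (rule Weierstrass_m_test[OF _ b]) (auto intro: pser_term_le)

lemma pser_continuous: "continuous_on (cball 0 1) (pser b)"
  by (rule uniform_limit_theorem[OF _ pser_uniform_limit])
    (auto intro!: always_eventually continuous_intros)

lemma pser_holomorphic: "pser b holomorphic_on ball 0 1"
  by (rule power_series_holomorphic[where a = b]) (use pser_sums in auto)

lemma pser_cis_continuous: "continuous_on S (\<lambda>x. pser b (cis x))"
  by (rule continuous_on_compose2[OF pser_continuous]) (auto intro!: continuous_intros)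

lemma pser_integral_sums:
  assumes F: "continuous_on {-pi..pi} F"
  shows "(\<lambda>j. b j * integral {-pi..pi} (\<lambda>x. cis (real j * x) * F x))
     sums integral {-pi..pi} (\<lambda>x. pser b (cis x) * F x)"
proof -
  have u: "uniform_limit {-pi..pi} (\<lambda>N x. \<Sum>j<N. b j * cis x ^ j) (\<lambda>x. pser b (cis x)) sequentially"
    by (rule uniform_limit_compose'[OF pser_uniform_limit]) auto
  have u2: "uniform_limit {-pi..pi} (\<lambda>N x. (\<Sum>j<N. b j * cis x ^ j) * F x) (\<lambda>x. pser b (cis x) * F x) sequentially"
  proof (rule uniform_lim_mult[OF u uniform_limit_const])
    show "bounded ((\<lambda>x. pser b (cis x)) ` {-pi..pi})"
      by (intro compact_imp_bounded compact_continuous_image pser_cis_continuous) auto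
    show "bounded (F ` {-pi..pi})"
      by (intro compact_imp_bounded compact_continuous_image F) auto
  qed
  have c: "continuous_on {-pi..pi} (\<lambda>x. (\<Sum>j<N. b j * cis x ^ j) * F x)" for N
    by (intro continuous_intros F)
  obtain I J where IJ: "\<And>N. ((\<lambda>x. (\<Sum>j<N. b j * cis x ^ j) * F x) has_integral I N) {-pi..pi}"
    "((\<lambda>x. pser b (cis x) * F x) has_integral J) {-pi..pi}" "I \<longlonglongrightarrow> J"
    using uniform_limit_integral[OF u2 c] by auto
  have "I N = (\<Sum>j<N. b j * integral {-pi..pi} (\<lambda>x. cis (real j * x) * F x))" for N
  proof -
    have "((\<lambda>x. \<Sum>j<N. b j * (cis (real j * x) * F x)) has_integral
        (\<Sum>j<N. b j * integral {-pi..pi} (\<lambda>x. cis (real j * x) * F x))) {-pi..pi}"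
      by (intro has_integral_sum has_integral_mult_right integrable_integral
          integrable_continuous_real continuous_intros F) auto
    hence "((\<lambda>x. (\<Sum>j<N. b j * cis x ^ j) * F x) has_integral
        (\<Sum>j<N. b j * integral {-pi..pi} (\<lambda>x. cis (real j * x) * F x))) {-pi..pi}"
      by (simp add: sum_distrib_right Complex.DeMoivre mult.assoc)
    thus ?thesis using IJ(1) has_integral_unique by blast
  qed
  hence "I = (\<lambda>N. \<Sum>j<N. b j * integral {-pi..pi} (\<lambda>x. cis (real j * x) * F x))" by blast
  thus ?thesis using IJ(2,3) by (simp add: sums_def integral_unique)
qed

text \<open>Expansion into frequencies: bounds for \<open>F\<close> against every cis (j x) pass to
  the amplitude \<open>pser b (cis x) * F x\<close> at the cost of the coefficients of the
  series.\<close>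

lemma pser_integral_bound:
  assumes F: "continuous_on {-pi..pi} F"
    and M: "\<And>j. cmod (integral {-pi..pi} (\<lambda>x. cis (real j * x) * F x)) \<le> M j"
    and s: "summable (\<lambda>j. cmod (b j) * M j)"
  shows "cmod (integral {-pi..pi} (\<lambda>x. pser b (cis x) * F x)) \<le> (\<Sum>j. cmod (b j) * M j)"
proof -
  have le: "cmod (b j * integral {-pi..pi} (\<lambda>x. cis (real j * x) * F x)) \<le> cmod (b j) * M j" for j
    unfolding norm_mult by (intro mult_left_mono M) auto
  have s2: "summable (\<lambda>j. cmod (b j * integral {-pi..pi} (\<lambda>x. cis (real j * x) * F x)))"
    by (rule summable_comparison_test'[OF s, where N = 0]) (use le in simp)
  show ?thesis
    unfolding sums_unique[OF pser_integral_sums[OF F]]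
    by (rule order.trans[OF summable_norm[OF s2]]) (intro suminf_le le s s2)
qed

end

lemma pser_mult:
  assumes a: "summable (\<lambda>j. cmod (a j))" and b: "summable (\<lambda>j. cmod (b j))" and z: "cmod z \<le> 1"
  shows "pser a z * pser b z = pser (\<lambda>k. \<Sum>i\<le>k. a i * b (k - i)) z"
proof -
  have "pser a z * pser b z = (\<Sum>k. \<Sum>i\<le>k. (a i * z ^ i) * (b (k - i) * z ^ (k - i)))"
    unfolding pser_def by (rule Cauchy_product[OF pser_summable[OF a z] pser_summable[OF b z]])
  also have "\<dots> = pser (\<lambda>k. \<Sum>i\<le>k. a i * b (k - i)) z"
    unfolding pser_def
  proof (rule suminf_cong)
    fix k
    have "(a i * z ^ i) * (b (k - i) * z ^ (k - i)) = a i * b (k - i) * z ^ k" if "i \<le> k" for i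
      using that by (simp add: power_add[symmetric] mult_ac)
    thus "(\<Sum>i\<le>k. (a i * z ^ i) * (b (k - i) * z ^ (k - i))) = (\<Sum>i\<le>k. a i * b (k - i)) * z ^ k"
      unfolding sum_distrib_right by (intro sum.cong) auto
  qed
  finally show ?thesis .
qed

lemma wl1_mult:
  assumes "wl1 a" "wl1 b"
  shows "wl1 (\<lambda>k. \<Sum>i\<le>k. a i * b (k - i))"
proof -
  have "summable (\<lambda>k. \<Sum>i\<le>k. ((1 + real i) * cmod (a i)) * ((1 + real (k - i)) * cmod (b (k - i))))"
    by (rule summable_Cauchy_product) (use assms in \<open>auto simp: wl1_def norm_mult\<close>)
  thus ?thesis unfolding wl1_def
  proof (rule summable_comparison_test'[where N = 0])
    fix k
    have "(1 + real k) * cmod (\<Sum>i\<le>k. a i * b (k - i)) \<le> (1 + real k) * (\<Sum>i\<le>k. cmod (a i) * cmod (b (k - i)))"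
      by (intro mult_left_mono sum_norm_le) (auto simp: norm_mult)
    also have "\<dots> \<le> (\<Sum>i\<le>k. ((1 + real i) * cmod (a i)) * ((1 + real (k - i)) * cmod (b (k - i))))"
      unfolding sum_distrib_left
    proof (rule sum_mono)
      fix i assume "i \<in> {..k}"
      hence k: "real k = real i + real (k - i)" by simp
      have "1 + real k \<le> (1 + real i) * (1 + real (k - i))"
        unfolding k by (simp add: algebra_simps del: of_nat_diff)
      from mult_right_mono[OF this, of "cmod (a i) * cmod (b (k - i))"]
      show "(1 + real k) * (cmod (a i) * cmod (b (k - i))) \<le>
         ((1 + real i) * cmod (a i)) * ((1 + real (k - i)) * cmod (b (k - i)))" by (simp add: mult_ac)
    qed
    finally show "norm ((1 + real k) * cmod (\<Sum>i\<le>k. a i * b (k - i))) \<le>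
       (\<Sum>i\<le>k. ((1 + real i) * cmod (a i)) * ((1 + real (k - i)) * cmod (b (k - i))))" by simp
  qed
qed

lemma wl1_diff: "wl1 a \<Longrightarrow> wl1 b \<Longrightarrow> wl1 (\<lambda>j. a j - b j)"
  unfolding wl1_def
  by (drule (1) summable_add, erule summable_comparison_test'[where N = 0])
    (auto simp: distrib_left[symmetric] intro!: mult_left_mono norm_triangle_ineq4)

lemma pser_diff:
  assumes "summable (\<lambda>j. cmod (a j))" "summable (\<lambda>j. cmod (b j))" "cmod z \<le> 1"
  shows "pser (\<lambda>j. a j - b j) z = pser a z - pser b z"
  using sums_unique[OF sums_diff[OF pser_sums[OF assms(1,3)] pser_sums[OF assms(2,3)]]]
  by (simp add: pser_def algebra_simps)

lemma wl1_monom: "wl1 (\<lambda>j. if j = k then c else 0)"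
  unfolding wl1_def by (rule summable_finite[of "{k}"]) auto

lemma pser_monom: "pser (\<lambda>j. if j = k then c else 0) z = c * z ^ k"
  unfolding pser_def by (subst suminf_finite[of "{k}"]) auto

text \<open>Hiding the coefficients makes closure under products and differences usable directly, so
  that the Wronskian belongs to the class without an explicit coefficient formula.\<close>

definition wiener1 :: "(complex \<Rightarrow> complex) \<Rightarrow> bool" where
  "wiener1 f \<longleftrightarrow> (\<exists>b. wl1 b \<and> (\<forall>z. cmod z \<le> 1 \<longrightarrow> f z = pser b z))"

lemma wiener1_mult: "wiener1 f \<Longrightarrow> wiener1 g \<Longrightarrow> wiener1 (\<lambda>z. f z * g z)"
  unfolding wiener1_def by (metis (no_types, lifting) wl1_mult pser_mult wl1_summable)

lemma wiener1_diff: "wiener1 f \<Longrightarrow> wiener1 g \<Longrightarrow> wiener1 (\<lambda>z. f z - g z)"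
  unfolding wiener1_def by (metis (no_types, lifting) wl1_diff pser_diff wl1_summable)

lemma wiener1_power: "wiener1 (\<lambda>z. z ^ k)"
  unfolding wiener1_def using wl1_monom[of k 1] pser_monom[of k 1] by auto

lemma wiener1_pser: "wl1 b \<Longrightarrow> wiener1 (pser b)"
  unfolding wiener1_def by blast

definition angular :: "(nat \<Rightarrow> complex) \<Rightarrow> nat \<Rightarrow> complex" where
  "angular b j = \<i> * of_nat j * b j"

lemma angular_summable: "wl1 b \<Longrightarrow> summable (\<lambda>j. cmod (angular b j))"
  unfolding wl1_def by (rule summable_comparison_test'[where N = 0])
    (auto simp: angular_def norm_mult mult_right_mono)

text \<open>The circle may bound the disc of convergence, so the derivative is taken along the
  circle, term by term; the weight in \<open>wl1\<close> makes the differentiated series converge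
  uniformly there.\<close>

lemma pser_cis_derivative:
  assumes b: "wl1 b"
  shows "((\<lambda>x. pser b (cis x)) has_vector_derivative pser (angular b) (cis x)) (at x)"
proof -
  have "\<exists>g. \<forall>x\<in>UNIV. (\<lambda>j. b j * cis x ^ j) sums (g x) \<and>
      (g has_derivative (\<lambda>h. h *\<^sub>R pser (angular b) (cis x))) (at x within UNIV)"
  proof (rule has_derivative_series[where f' = "\<lambda>j x h. h *\<^sub>R (angular b j * cis x ^ j)"])
    show "(\<lambda>j. b j * cis 0 ^ j) sums pser b (cis 0)"
      by (rule pser_sums[OF wl1_summable[OF b]]) simp
    fix j x
    have "((\<lambda>x. cis (real j * x)) has_vector_derivative real j *\<^sub>R (\<i> * cis (real j * x))) (at x)"
      by (rule has_vector_derivative_cis_chain) (auto intro!: derivative_eq_intros)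
    hence "((\<lambda>x. b j * cis (real j * x)) has_vector_derivative b j * (real j *\<^sub>R (\<i> * cis (real j * x)))) (at x)"
      by (rule has_vector_derivative_mult_right)
    thus "((\<lambda>x. b j * cis x ^ j) has_derivative (\<lambda>h. h *\<^sub>R (angular b j * cis x ^ j))) (at x within UNIV)"
      by (simp add: Complex.DeMoivre angular_def has_vector_derivative_def scaleR_conv_of_real mult_ac)
  next
    fix e :: real assume "e > 0"
    hence "\<forall>\<^sub>F n in sequentially. \<forall>z\<in>cball 0 1. dist (\<Sum>j<n. angular b j * z ^ j) (pser (angular b) z) < e"
      using pser_uniform_limit[OF angular_summable[OF b]] by (auto simp: uniform_limit_iff)
    thus "\<forall>\<^sub>F n in sequentially. \<forall>x\<in>UNIV. \<forall>h. norm ((\<Sum>j<n. h *\<^sub>R (angular b j * cis x ^ j)) - h *\<^sub>R pser (angular b) (cis x)) \<le> e * norm h"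
    proof eventually_elim
      case (elim n)
      show ?case
      proof (intro ballI allI)
        fix x h :: real
        have "dist (\<Sum>j<n. angular b j * cis x ^ j) (pser (angular b) (cis x)) < e" using elim by simp
        hence "\<bar>h\<bar> * norm ((\<Sum>j<n. angular b j * cis x ^ j) - pser (angular b) (cis x)) \<le> \<bar>h\<bar> * e"
          by (intro mult_left_mono) (auto simp: dist_norm)
        thus "norm ((\<Sum>j<n. h *\<^sub>R (angular b j * cis x ^ j)) - h *\<^sub>R pser (angular b) (cis x)) \<le> e * norm h"
          by (simp add: scaleR_sum_right[symmetric] scaleR_diff_right[symmetric] mult.commute)
      qed
    qed
  qed auto
  then obtain g where g: "\<And>x. (\<lambda>j. b j * cis x ^ j) sums (g x)"
     "\<And>x. (g has_derivative (\<lambda>h. h *\<^sub>R pser (angular b) (cis x))) (at x)" by auto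
  have "g = (\<lambda>x. pser b (cis x))" using g(1) by (auto simp: pser_def sums_iff)
  thus ?thesis using g(2) by (simp add: has_vector_derivative_def)
qed

section \<open>Dispersive bound for a single frequency\<close>

lemma oscillatory_cos_uniform:
  fixes g g1 :: "real \<Rightarrow> complex"
  assumes dg: "\<And>x. (g has_vector_derivative g1 x) (at x)" and cg: "continuous_on UNIV g1"
    and G: "\<And>x. cmod (g x) \<le> G" and G1: "\<And>x. cmod (g1 x) \<le> G1"
  obtains C where "C \<ge> 0" "\<And>t m. t \<ge> 1 \<Longrightarrow>
    cmod (integral {-pi..pi} (\<lambda>x. cis (2 * t * cos x) * (cis (m * x) * g x))) \<le> C * t powr (-1/3)"
proof
  have "G \<ge> 0" "G1 \<ge> 0" using G[of 0] G1[of 0] norm_ge_zero order.trans by blast+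
  thus "28 * G + 12 * pi * G1 \<ge> 0" by simp
  show "cmod (integral {-pi..pi} (\<lambda>x. cis (2 * t * cos x) * (cis (m * x) * g x))) \<le>
     (28 * G + 12 * pi * G1) * t powr (-1/3)" if "t \<ge> 1" for t m
    using oscillatory_cos[OF dg cg G G1 that, of m] by (simp add: cis_mult mult.assoc[symmetric])
qed

text \<open>The factor \<open>cis (- x) - cis x\<close> equals -2 i sin x, that is i / t times the
  derivative of the phase 2 t cos x. The series \<open>b\<close> will be that of
  \<open>jwr\<close>.\<close>

definition osc :: "(nat \<Rightarrow> complex) \<Rightarrow> real \<Rightarrow> real \<Rightarrow> complex" where
  "osc b t x = cis (2 * t * cos x) * (cis (- x) - cis x) / pser b (cis x)"

text \<open>Integration by parts gains 1/t, and the derivative falls either on cis (m x), which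
  costs |m|, or on the reciprocal 1/f of the series f, which gives -f'/f^2. Here 1/f^2 is C^1 but f'
  is just an absolutely convergent series. So f' is expanded and each of its frequencies is moved
  into the phase, where the van der Corput bound does not notice it.\<close>

lemma dispersive_fourier:
  assumes b: "wl1 b" and nz: "\<And>z. cmod z = 1 \<Longrightarrow> pser b z \<noteq> 0"
  obtains C where "C \<ge> 0" "\<And>t m. t \<ge> 1 \<Longrightarrow>
    cmod (integral {-pi..pi} (\<lambda>x. cis (real_of_int m * x) * osc b t x)) \<le> C * t powr (-4/3) * (1 + real_of_int \<bar>m\<bar>)"
proof -
  note sb = wl1_summable[OF b] and sd = angular_summable[OF b]
  define g where "g = (\<lambda>x. inverse (pser b (cis x)))"
  define p1 where "p1 = (\<lambda>x. pser (angular b) (cis x))"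
  define g1 where "g1 = (\<lambda>x. - (p1 x * (g x)\<^sup>2))"
  have nz': "pser b (cis x) \<noteq> 0" for x by (rule nz) simp
  have dg: "(g has_vector_derivative g1 x) (at x)" for x
    using field_vector_diff_chain_at[OF pser_cis_derivative[OF b] DERIV_inverse[OF nz'], of x]
    by (simp add: o_def g_def g1_def p1_def power2_eq_square mult.assoc)
  have cont_g: "continuous_on S g" for S
    unfolding g_def by (intro continuous_intros pser_cis_continuous sb) (use nz' in auto)
  have cont_p1: "continuous_on S p1" for S unfolding p1_def by (rule pser_cis_continuous[OF sd])
  have cont_g1: "continuous_on S g1" for S
    unfolding g1_def by (intro continuous_intros cont_g cont_p1)
  obtain G where G: "\<And>x. cmod (g x) \<le> G"
  proof -
    have "compact ((\<lambda>z. inverse (pser b z)) ` sphere 0 1)"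
      by (intro compact_continuous_image continuous_intros continuous_on_subset[OF pser_continuous[OF sb]])
        (use nz in auto)
    then obtain G where "\<forall>z\<in>sphere 0 1. cmod (inverse (pser b z)) \<le> G"
      using compact_imp_bounded by (force simp: bounded_iff)
    hence "cmod (g x) \<le> G" for x by (auto simp: g_def simp del: norm_inverse)
    thus ?thesis using that by blast
  qed
  have Gp: "G \<ge> 0" using G[of 0] norm_ge_zero order.trans by blast
  define P where "P = (\<Sum>j. cmod (angular b j))"
  have P: "cmod (p1 x) \<le> P" for x unfolding p1_def P_def by (rule pser_norm_le[OF sd]) simp
  have Pp: "P \<ge> 0" using P[of 0] norm_ge_zero order.trans by blast
  have G1: "cmod (g1 x) \<le> P * G\<^sup>2" for x
    unfolding g1_def norm_minus_cancel norm_mult norm_power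
    by (intro mult_mono power_mono P G) (use Pp in auto)
  have dg2: "((\<lambda>x. g x * g x) has_vector_derivative g x * g1 x + g1 x * g x) (at x)" for x
    by (rule has_vector_derivative_mult[OF dg dg])
  have cont_dg2: "continuous_on UNIV (\<lambda>x. g x * g1 x + g1 x * g x)"
    by (intro continuous_intros cont_g cont_g1)
  have G2: "cmod (g x * g x) \<le> G * G" for x
    unfolding norm_mult by (intro mult_mono G Gp) auto
  have G3: "cmod (g x * g1 x + g1 x * g x) \<le> G * (P * G\<^sup>2) + (P * G\<^sup>2) * G" for x
    by (rule order.trans[OF norm_triangle_ineq], unfold norm_mult, intro add_mono mult_mono G G1)
      (use Gp Pp in auto)
  obtain C1 where C1: "C1 \<ge> 0" "\<And>t m. t \<ge> 1 \<Longrightarrow>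
    cmod (integral {-pi..pi} (\<lambda>x. cis (2 * t * cos x) * (cis (m * x) * g x))) \<le> C1 * t powr (-1/3)"
    using oscillatory_cos_uniform[OF dg cont_g1 G G1] by blast
  obtain C2 where C2: "C2 \<ge> 0" "\<And>t m. t \<ge> 1 \<Longrightarrow>
    cmod (integral {-pi..pi} (\<lambda>x. cis (2 * t * cos x) * (cis (m * x) * (g x * g x)))) \<le> C2 * t powr (-1/3)"
    using oscillatory_cos_uniform[OF dg2 cont_dg2 G2 G3] by blast
  show ?thesis
  proof (rule that[of "C1 + P * C2"])
    show "C1 + P * C2 \<ge> 0" using C1 C2 Pp by simp
    fix t :: real and m :: int assume t: "t \<ge> 1"
    define E where "E = (\<lambda>x. cis (2 * t * cos x))"
    define U where "U = (\<lambda>x. cis (real_of_int m * x) * g x)"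
    define E1 where "E1 = (\<lambda>x. (- (2 * t * sin x)) *\<^sub>R (\<i> * E x))"
    define U1 where "U1 = (\<lambda>x. cis (real_of_int m * x) * g1 x + real_of_int m *\<^sub>R (\<i> * cis (real_of_int m * x)) * g x)"
    have cE: "continuous_on S E" for S unfolding E_def by (intro continuous_intros)
    have dE: "(E has_vector_derivative E1 x) (at x)" for x
      unfolding E_def E1_def
      by (rule has_vector_derivative_cis_chain) (auto intro!: derivative_eq_intros)
    have dU: "(U has_vector_derivative U1 x) (at x)" for x
      unfolding U_def U1_def
      by (rule has_vector_derivative_mult[OF has_vector_derivative_cis_chain dg])
        (auto intro!: derivative_eq_intros)
    have eq: "cis (real_of_int m * x) * (E x * (cis (- x) - cis x) / pser b (cis x)) = (1 / t) *\<^sub>R (E1 x * U x)" for x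
    proof -
      have D: "cis (- x) - cis x = - (2 * \<i> * complex_of_real (sin x))"
        by (simp add: complex_eq_iff)
      show ?thesis unfolding D using t by (simp add: E1_def U_def g_def scaleR_conv_of_real divide_inverse)
    qed
    have "((\<lambda>x. E1 x * U x + E x * U1 x) has_integral (E pi * U pi - E (-pi) * U (-pi))) {-pi..pi}"
    proof (rule fundamental_theorem_of_calculus)
      show "((\<lambda>x. E x * U x) has_vector_derivative E1 x * U x + E x * U1 x) (at x within {-pi..pi})" for x
        using has_vector_derivative_at_within[OF has_vector_derivative_mult[OF dE dU]] by (simp add: add.commute)
    qed simp
    \<comment> \<open>The boundary terms cancel by periodicity, since \<open>m\<close> is an
      integer.\<close>
    moreover have "E pi * U pi - E (-pi) * U (-pi) = 0"
    proof -
      have "cis (real_of_int m * (- pi)) = cis (real_of_int m * pi)"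
        by (simp add: complex_eq_iff sin_times_pi_eq_0)
      moreover have "cis (- pi) = cis pi" by (simp add: complex_eq_iff)
      ultimately show ?thesis by (simp add: E_def U_def g_def)
    qed
    ultimately have ibp: "((\<lambda>x. E1 x * U x + E x * U1 x) has_integral 0) {-pi..pi}" by simp
    have cU1: "continuous_on S U1" for S
      unfolding U1_def by (intro continuous_intros cont_g cont_g1)
    have iU: "((\<lambda>x. E x * U1 x) has_integral integral {-pi..pi} (\<lambda>x. E x * U1 x)) {-pi..pi}"
      by (intro integrable_integral integrable_continuous_real continuous_intros cE cU1)
    have "((\<lambda>x. E1 x * U x) has_integral (0 - integral {-pi..pi} (\<lambda>x. E x * U1 x))) {-pi..pi}"
      using has_integral_diff[OF ibp iU] by simp
    hence i1: "integral {-pi..pi} (\<lambda>x. E1 x * U x) = - integral {-pi..pi} (\<lambda>x. E x * U1 x)"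
      by (simp add: integral_unique)
    have "integral {-pi..pi} (\<lambda>x. E x * U1 x)
      = of_int m * \<i> * integral {-pi..pi} (\<lambda>x. E x * (cis (real_of_int m * x) * g x))
       - integral {-pi..pi} (\<lambda>x. pser (angular b) (cis x) * (E x * (cis (real_of_int m * x) * (g x * g x))))"
      (is "_ = _ * ?I1 - ?I2")
    proof -
      have "((\<lambda>x. of_int m * \<i> * (E x * (cis (real_of_int m * x) * g x)) -
          pser (angular b) (cis x) * (E x * (cis (real_of_int m * x) * (g x * g x)))) has_integral
          of_int m * \<i> * ?I1 - ?I2) {-pi..pi}"
        by (intro has_integral_diff has_integral_mult_right integrable_integral
          integrable_continuous_real continuous_intros cE cont_g pser_cis_continuous sd)
      moreover have "(\<lambda>x. of_int m * \<i> * (E x * (cis (real_of_int m * x) * g x)) -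
          pser (angular b) (cis x) * (E x * (cis (real_of_int m * x) * (g x * g x)))) = (\<lambda>x. E x * U1 x)"
        by (simp add: fun_eq_iff U1_def g1_def p1_def scaleR_conv_of_real algebra_simps power2_eq_square)
      ultimately show ?thesis by (simp add: integral_unique)
    qed
    hence "cmod (integral {-pi..pi} (\<lambda>x. E x * U1 x)) \<le> real_of_int \<bar>m\<bar> * cmod ?I1 + cmod ?I2"
    proof -
      assume e: "integral {-pi..pi} (\<lambda>x. E x * U1 x) = of_int m * \<i> * ?I1 - ?I2"
      have "cmod (of_int m * \<i> * ?I1) = real_of_int \<bar>m\<bar> * cmod ?I1" by (simp add: norm_mult)
      thus ?thesis unfolding e using norm_triangle_ineq4[of "of_int m * \<i> * ?I1" ?I2] by linarith
    qed
    also have "cmod ?I1 \<le> C1 * t powr (-1/3)" unfolding E_def by (rule C1(2)[OF t])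
    also have "cmod ?I2 \<le> (\<Sum>j. cmod (angular b j) * (C2 * t powr (-1/3)))"
    proof (rule pser_integral_bound[OF sd])
      show "continuous_on {-pi..pi} (\<lambda>x. E x * (cis (real_of_int m * x) * (g x * g x)))"
        by (intro continuous_intros cE cont_g)
      show "cmod (integral {-pi..pi} (\<lambda>x. cis (real j * x) * (E x * (cis (real_of_int m * x) * (g x * g x)))))
         \<le> C2 * t powr (-1/3)" for j
      proof -
        have "(\<lambda>x. cis (real j * x) * (E x * (cis (real_of_int m * x) * (g x * g x))))
           = (\<lambda>x. E x * (cis ((real j + real_of_int m) * x) * (g x * g x)))"
          by (simp add: fun_eq_iff distrib_right flip: cis_mult)
        thus ?thesis using C2(2)[OF t, of "real j + real_of_int m"] by (simp add: E_def)
      qed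
      show "summable (\<lambda>j. cmod (angular b j) * (C2 * t powr (-1/3)))" by (rule summable_mult2[OF sd])
    qed
    also have "(\<Sum>j. cmod (angular b j) * (C2 * t powr (-1/3))) = P * (C2 * t powr (-1/3))"
      unfolding P_def by (rule suminf_mult2[OF sd, symmetric])
    finally have fin: "cmod (integral {-pi..pi} (\<lambda>x. E x * U1 x)) \<le>
        real_of_int \<bar>m\<bar> * (C1 * t powr (-1/3)) + P * (C2 * t powr (-1/3))"
      by (simp add: mult_left_mono)
    also have "\<dots> \<le> (C1 + P * C2) * (1 + real_of_int \<bar>m\<bar>) * t powr (-1/3)"
      using C1 C2 Pp by (simp add: algebra_simps)
    finally have "cmod (integral {-pi..pi} (\<lambda>x. E x * U1 x)) \<le> (C1 + P * C2) * (1 + real_of_int \<bar>m\<bar>) * t powr (-1/3)" .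
    hence "(1 / t) * cmod (integral {-pi..pi} (\<lambda>x. E x * U1 x)) \<le> (1 / t) * ((C1 + P * C2) * (1 + real_of_int \<bar>m\<bar>) * t powr (-1/3))"
      using t by (intro mult_left_mono) auto
    moreover have "integral {-pi..pi} (\<lambda>x. cis (real_of_int m * x) * (E x * (cis (- x) - cis x) / pser b (cis x)))
       = (1 / t) *\<^sub>R (- integral {-pi..pi} (\<lambda>x. E x * U1 x))"
      unfolding eq i1[symmetric] by (rule integral_cmul)
    ultimately have "cmod (integral {-pi..pi} (\<lambda>x. cis (real_of_int m * x) * (E x * (cis (- x) - cis x) / pser b (cis x))))
      \<le> (1 / t) * ((C1 + P * C2) * (1 + real_of_int \<bar>m\<bar>) * t powr (-1/3))"
      using t by simp
    also have "\<dots> = (C1 + P * C2) * t powr (-4/3) * (1 + real_of_int \<bar>m\<bar>)"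
    proof -
      have "t powr (-4/3) = t powr (-1) * t powr (-1/3)" by (subst powr_add[symmetric]) simp
      moreover have "t powr (-1) = 1 / t" using t by (simp add: powr_neg_one)
      ultimately show ?thesis by simp
    qed
    finally show "cmod (integral {-pi..pi} (\<lambda>x. cis (real_of_int m * x) * osc b t x)) \<le> (C1 + P * C2) * t powr (-4/3) * (1 + real_of_int \<bar>m\<bar>)"
      by (simp add: E_def osc_def)
  qed
qed

section \<open>Jost functions on the closed disc\<close>

declare jcoeff.simps(2) [simp del]

lemma norm_l1_le:
  assumes "\<And>J. (\<Sum>j<J. \<omega> (Suc j) * \<bar>a (Suc j)\<bar>) \<le> V" "\<And>j. \<omega> j \<ge> (0::real)"
  shows "summable (\<lambda>j. \<omega> j * \<bar>a j\<bar>)" "(\<Sum>j. \<omega> (Suc j) * \<bar>a (Suc j)\<bar>) \<le> V"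
    "(\<Sum>j. \<omega> j * \<bar>a j\<bar>) \<le> \<omega> 0 * \<bar>a 0\<bar> + V" "summable (\<lambda>j. \<omega> (Suc j) * \<bar>a (Suc j)\<bar>)"
proof -
  show s: "summable (\<lambda>j. \<omega> (Suc j) * \<bar>a (Suc j)\<bar>)"
    by (rule bounded_imp_summable[where B = V])
      (use assms in \<open>auto simp: lessThan_Suc_atMost[symmetric] simp del: sum.lessThan_Suc\<close>)
  thus s': "summable (\<lambda>j. \<omega> j * \<bar>a j\<bar>)" by (subst (asm) summable_Suc_iff)
  show le: "(\<Sum>j. \<omega> (Suc j) * \<bar>a (Suc j)\<bar>) \<le> V" by (rule suminf_le_const[OF s assms(1)])
  thus "(\<Sum>j. \<omega> j * \<bar>a j\<bar>) \<le> \<omega> 0 * \<bar>a 0\<bar> + V" using suminf_split_head[OF s'] by simp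
qed

definition jcoeffc :: "(int \<Rightarrow> real) \<Rightarrow> int \<Rightarrow> nat \<Rightarrow> complex" where
  "jcoeffc q n j = complex_of_real (jcoeff q n j)"

definition jost :: "(int \<Rightarrow> real) \<Rightarrow> int \<Rightarrow> complex \<Rightarrow> complex" where
  "jost q n = pser (jcoeffc q n)"

definition jconst :: "(int \<Rightarrow> real) \<Rightarrow> real" where "jconst q = exp (\<Sum>\<^sub>\<infinity>m. qw q m)"

context
  fixes q :: "int \<Rightarrow> real"
  assumes q: "short_range q"
begin

lemma jconst_ge_1: "jconst q \<ge> 1"
  by (simp add: jconst_def infsum_nonneg qw_nonneg)

lemma exp_qtail_le: "exp (qtail q n) \<le> jconst q"
  by (simp add: jconst_def has_sum_qw_shift(2)[OF q])

lemma jcoeffc_l1: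
  shows "summable (\<lambda>j. cmod (jcoeffc q n j))" "(\<Sum>j. cmod (jcoeffc q n (Suc j))) \<le> lweight n * (exp (qtail q n) - 1)"
    "(\<Sum>j. cmod (jcoeffc q n j)) \<le> jconst q * lweight n" "summable (\<lambda>j. cmod (jcoeffc q n (Suc j)))"
proof -
  note * = norm_l1_le[where a = "jcoeff q n" and \<omega> = "\<lambda>_. 1", simplified, OF jcoeff_sum_bound(1)[OF q]]
  show "summable (\<lambda>j. cmod (jcoeffc q n j))" "(\<Sum>j. cmod (jcoeffc q n (Suc j))) \<le> lweight n * (exp (qtail q n) - 1)"
     "summable (\<lambda>j. cmod (jcoeffc q n (Suc j)))"
    using * by (simp_all add: jcoeffc_def)
  have "(\<Sum>j. cmod (jcoeffc q n j)) \<le> 1 + lweight n * (exp (qtail q n) - 1)" using *(3) by (simp add: jcoeffc_def)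
  also have "\<dots> \<le> lweight n * exp (qtail q n)" using lweight_ge_1[of n] by (simp add: algebra_simps)
  also have "\<dots> \<le> lweight n * jconst q" using lweight_ge_1[of n] by (intro mult_left_mono exp_qtail_le) auto
  finally show "(\<Sum>j. cmod (jcoeffc q n j)) \<le> jconst q * lweight n" by (simp add: mult.commute)
qed

lemma jcoeffc_wl1:
  shows "wl1 (jcoeffc q n)" "(\<Sum>j. (1 + real j) * cmod (jcoeffc q n j)) \<le> jconst q * (lweight n)\<^sup>2"
proof -
  note * = norm_l1_le[where a = "jcoeff q n" and \<omega> = "\<lambda>j. 1 + real j", OF jcoeff_weighted_sum_bound[OF q]]
  show "wl1 (jcoeffc q n)" using *(1) by (simp add: wl1_def jcoeffc_def)
  have "(\<Sum>j. (1 + real j) * cmod (jcoeffc q n j)) \<le> 1 + (lweight n)\<^sup>2 * (exp (qtail q n) - 1)" using *(3) by (simp add: jcoeffc_def)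
  also have "\<dots> \<le> (lweight n)\<^sup>2 * exp (qtail q n)" using one_le_power[OF lweight_ge_1[of n], of 2] by (simp add: algebra_simps)
  also have "\<dots> \<le> (lweight n)\<^sup>2 * jconst q" by (intro mult_left_mono exp_qtail_le) auto
  finally show "(\<Sum>j. (1 + real j) * cmod (jcoeffc q n j)) \<le> jconst q * (lweight n)\<^sup>2" by (simp add: mult.commute)
qed

lemma wiener1_jost: "wiener1 (jost q n)"
  unfolding jost_def by (rule wiener1_pser[OF jcoeffc_wl1(1)])

lemma jost_sums: "cmod z \<le> 1 \<Longrightarrow> (\<lambda>j. jcoeffc q n j * z ^ j) sums jost q n z"
  unfolding jost_def by (rule pser_sums[OF jcoeffc_l1(1)])

lemma jost_bound: "cmod z \<le> 1 \<Longrightarrow> cmod (jost q n z) \<le> jconst q * lweight n"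
  unfolding jost_def by (rule order.trans[OF pser_norm_le[OF jcoeffc_l1(1)] jcoeffc_l1(3)])

lemma jost_minus_1:
  assumes "cmod z \<le> 1"
  shows "cmod (jost q n z - 1) \<le> lweight n * (exp (qtail q n) - 1)"
proof -
  have "jost q n z = (\<Sum>j. jcoeffc q n (Suc j) * z ^ Suc j) + 1"
    using suminf_split_head[OF sums_summable[OF jost_sums[OF assms, of n]]] sums_unique[OF jost_sums[OF assms, of n]]
    by (simp add: jcoeffc_def)
  hence e: "jost q n z - 1 = (\<Sum>j. jcoeffc q n (Suc j) * z ^ Suc j)" by simp
  have le: "cmod (jcoeffc q n (Suc j) * z ^ Suc j) \<le> cmod (jcoeffc q n (Suc j))" for j
    by (rule pser_term_le[OF jcoeffc_l1(1) assms])
  have s: "summable (\<lambda>j. cmod (jcoeffc q n (Suc j) * z ^ Suc j))"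
    by (rule summable_comparison_test'[OF jcoeffc_l1(4), where N = 0]) (use le in simp)
  have "cmod (jost q n z - 1) \<le> (\<Sum>j. cmod (jcoeffc q n (Suc j)))"
    unfolding e by (rule order.trans[OF summable_norm[OF s]]) (intro suminf_le le s jcoeffc_l1(4))
  thus ?thesis using jcoeffc_l1(2)[of n] by linarith
qed

lemma jost_tendsto:
  assumes "cmod z \<le> 1"
  shows "(\<lambda>N. jost q (int N) z) \<longlonglongrightarrow> 1"
proof -
  have "(\<lambda>N. exp (qtail q (int N)) - 1) \<longlonglongrightarrow> exp 0 - 1"
    by (intro tendsto_intros qtail_tendsto q)
  hence *: "(\<lambda>N. exp (qtail q (int N)) - 1) \<longlonglongrightarrow> 0" by simp
  have "(\<lambda>N. jost q (int N) z - 1) \<longlonglongrightarrow> 0"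
  proof (rule Lim_null_comparison[OF always_eventually *], rule allI)
    fix N show "norm (jost q (int N) z - 1) \<le> exp (qtail q (int N)) - 1"
      using jost_minus_1[OF assms, of "int N"] by (simp add: lweight_nonneg)
  qed
  thus ?thesis by (simp add: LIM_zero_iff)
qed

lemma jost_0: "jost q n 0 = 1"
  unfolding jost_def pser_def by (subst suminf_finite[of "{0}"]) (auto simp: jcoeffc_def)

lemma jost_cnj: "cmod z \<le> 1 \<Longrightarrow> cnj (jost q n z) = jost q n (cnj z)"
  using sums_unique[OF sums_cnj[THEN iffD2, OF jost_sums[of z n]]]
  by (simp add: jost_def pser_def jcoeffc_def)

lemma jost_difference:
  assumes z: "cmod z \<le> 1"
  shows "jost q n z - jost q (n + 1) z =
    complex_of_real (q (n + 1)) * z * jost q (n + 1) z + z\<^sup>2 * (jost q (n + 1) z - jost q (n + 2) z)"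
proof -
  have d: "(\<lambda>j. complex_of_real (jcoeff_diff q n j) * z ^ j) sums (jost q n z - jost q (n + 1) z)" for n
    using sums_diff[OF jost_sums[OF z, of n] jost_sums[OF z, of "n + 1"]]
    by (simp add: jcoeffc_def jcoeff_diff_def algebra_simps)
  have 1: "(\<lambda>j. complex_of_real (jcoeff_diff q n (Suc j)) * z ^ Suc j) sums (jost q n z - jost q (n + 1) z)"
    using d[of n] by (subst sums_Suc_iff) (simp add: jcoeff_diff_0)
  have 2: "(\<lambda>j. (complex_of_real (q (n + 1)) * z) * (jcoeffc q (n + 1) j * z ^ j)) sums
     (complex_of_real (q (n + 1)) * z * jost q (n + 1) z)"
    by (rule sums_mult[OF jost_sums[OF z]])
  have "(\<lambda>j. z\<^sup>2 * (complex_of_real (jcoeff_diff q (n + 1) j) * z ^ j)) sums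
      (z\<^sup>2 * (jost q (n + 1) z - jost q (n + 2) z))"
    using sums_mult[OF d[of "n + 1"], of "z\<^sup>2"] by (simp add: add.assoc)
  \<comment> \<open>The case distinction delays the series by one index: z^2 z^i has to line up with
    z^(j+1) for j = i + 1, and j = 0 gets no contribution from this term.\<close>
  hence 3: "(\<lambda>j. case j of 0 \<Rightarrow> 0 | Suc i \<Rightarrow> z\<^sup>2 * (complex_of_real (jcoeff_diff q (n + 1) i) * z ^ i)) sums
      (z\<^sup>2 * (jost q (n + 1) z - jost q (n + 2) z))"
    using sums_Suc[of "\<lambda>j. case j of 0 \<Rightarrow> 0 | Suc i \<Rightarrow> z\<^sup>2 * (complex_of_real (jcoeff_diff q (n + 1) i) * z ^ i)"] by simp
  have "(complex_of_real (q (n + 1)) * z) * (jcoeffc q (n + 1) j * z ^ j) +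
      (case j of 0 \<Rightarrow> 0 | Suc i \<Rightarrow> z\<^sup>2 * (complex_of_real (jcoeff_diff q (n + 1) i) * z ^ i))
      = complex_of_real (jcoeff_diff q n (Suc j)) * z ^ Suc j" for j
    using jcoeff_diff_rec[OF q, of n] by (cases j) (auto simp: jcoeffc_def algebra_simps power2_eq_square)
  hence "(\<lambda>j. complex_of_real (jcoeff_diff q n (Suc j)) * z ^ Suc j) sums
    (complex_of_real (q (n + 1)) * z * jost q (n + 1) z + z\<^sup>2 * (jost q (n + 1) z - jost q (n + 2) z))"
    using sums_add[OF 2 3] by simp
  thus ?thesis using 1 sums_unique2 by blast
qed

end

section \<open>Dispersive bounds for products of Jost series\<close>

definition norm0 :: "(nat \<Rightarrow> complex) \<Rightarrow> real" where "norm0 a = (\<Sum>j. cmod (a j))"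

definition norm1 :: "(nat \<Rightarrow> complex) \<Rightarrow> real" where "norm1 a = (\<Sum>j. (1 + real j) * cmod (a j))"

text \<open>Frequencies of the factors add, and the cost 1 + |m + i + j| is at most 1 + |m| + i + j,
  a sum. Hence each term of the bound has at most one factor in its differentiated norm.\<close>

lemma dispersive_product:
  assumes b: "wl1 b" and nz: "\<And>z. cmod z = 1 \<Longrightarrow> pser b z \<noteq> 0"
  obtains C where "C \<ge> 0" "\<And>t m a c. t \<ge> 1 \<Longrightarrow> wl1 a \<Longrightarrow> wl1 c \<Longrightarrow>
    cmod (integral {-pi..pi} (\<lambda>x. pser a (cis x) * (pser c (cis x) * (cis (real_of_int m * x) * osc b t x))))
     \<le> C * t powr (-4/3) * (real_of_int \<bar>m\<bar> * norm0 a * norm0 c + norm1 a * norm0 c + norm0 a * norm1 c)"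
proof -
  obtain C where C: "C \<ge> 0" "\<And>t m. t \<ge> 1 \<Longrightarrow>
    cmod (integral {-pi..pi} (\<lambda>x. cis (real_of_int m * x) * osc b t x)) \<le> C * t powr (-4/3) * (1 + real_of_int \<bar>m\<bar>)"
    using dispersive_fourier[OF b nz] by blast
  show ?thesis
  proof (rule that[OF C(1)])
    fix t :: real and m :: int and a c assume t: "t \<ge> 1" and a: "wl1 a" and c: "wl1 c"
    note sa = wl1_summable[OF a] and sc = wl1_summable[OF c]
    define K where "K = C * t powr (-4/3)"
    have K: "K \<ge> 0" using C by (simp add: K_def)
    have C0p: "norm0 c \<ge> 0" unfolding norm0_def by (intro suminf_nonneg sc) auto
    have nz': "pser b (cis x) \<noteq> 0" for x by (rule nz) simp
    define F where "F = osc b t"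
    have cF: "continuous_on S F" for S unfolding F_def osc_def
      by (intro continuous_intros pser_cis_continuous wl1_summable[OF b]) (use nz' in auto)
    have FC: "cmod (integral {-pi..pi} (\<lambda>x. cis (real_of_int l * x) * F x)) \<le> K * (1 + real_of_int \<bar>l\<bar>)" for l
      unfolding F_def K_def by (rule C(2)[OF t])
    \<comment> \<open>Splitting \<open>\<alpha>\<close> + j \<open>\<beta>\<close> as
      (\<open>\<alpha>\<close> - \<open>\<beta>\<close>) + \<open>\<beta>\<close> (1 + j) expresses
      the sum through the two norms. For the inner series the subtracted \<open>norm0\<close>
      cancels the 1 in 1 + |m|.\<close>
    have wsum: "(\<lambda>j. cmod (u j) * (K * (\<alpha> + real j * \<beta>))) sums
        (K * ((\<alpha> - \<beta>) * norm0 u + \<beta> * norm1 u))" if u: "wl1 u" for u \<alpha> \<beta>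
    proof -
      have "(\<lambda>j. K * ((\<alpha> - \<beta>) * cmod (u j) + \<beta> * ((1 + real j) * cmod (u j)))) sums
        (K * ((\<alpha> - \<beta>) * norm0 u + \<beta> * norm1 u))"
        unfolding norm0_def norm1_def by (intro sums_mult sums_add summable_sums wl1_summable[OF u]) (use u in \<open>simp add: wl1_def\<close>)
      moreover have "K * ((\<alpha> - \<beta>) * cmod (u j) + \<beta> * ((1 + real j) * cmod (u j))) = cmod (u j) * (K * (\<alpha> + real j * \<beta>))" for j
        by (simp add: algebra_simps)
      ultimately show ?thesis by simp
    qed
    have inner: "cmod (integral {-pi..pi} (\<lambda>x. cis (real i * x) * (pser c (cis x) * (cis (real_of_int m * x) * F x))))
        \<le> K * ((real_of_int \<bar>m\<bar> * norm0 c + norm1 c) + real i * norm0 c)" for i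
    proof -
      have "cmod (integral {-pi..pi} (\<lambda>x. pser c (cis x) * (cis (real_of_int (m + int i) * x) * F x)))
         \<le> (\<Sum>j. cmod (c j) * (K * ((1 + real_of_int \<bar>m\<bar> + real i) + real j * 1)))"
      proof (rule pser_integral_bound[OF sc])
        show "continuous_on {-pi..pi} (\<lambda>x. cis (real_of_int (m + int i) * x) * F x)"
          by (intro continuous_intros cF)
        fix j
        have "(\<lambda>x. cis (real j * x) * (cis (real_of_int (m + int i) * x) * F x)) =
           (\<lambda>x. cis (real_of_int (m + int i + int j) * x) * F x)"
          by (simp add: fun_eq_iff cis_mult mult.assoc[symmetric] algebra_simps)
        hence "cmod (integral {-pi..pi} (\<lambda>x. cis (real j * x) * (cis (real_of_int (m + int i) * x) * F x)))
           \<le> K * (1 + real_of_int \<bar>m + int i + int j\<bar>)" using FC[of "m + int i + int j"] by simp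
        also have "\<dots> \<le> K * ((1 + real_of_int \<bar>m\<bar> + real i) + real j * 1)"
          by (intro mult_left_mono K) linarith
        finally show "cmod (integral {-pi..pi} (\<lambda>x. cis (real j * x) * (cis (real_of_int (m + int i) * x) * F x)))
           \<le> K * ((1 + real_of_int \<bar>m\<bar> + real i) + real j * 1)" .
      qed (rule sums_summable[OF wsum[OF c]])
      also have "\<dots> = K * ((1 + real_of_int \<bar>m\<bar> + real i - 1) * norm0 c + 1 * norm1 c)"
        by (rule sums_unique[OF wsum[OF c], symmetric])
      also have "(\<lambda>x. pser c (cis x) * (cis (real_of_int (m + int i) * x) * F x)) =
        (\<lambda>x. cis (real i * x) * (pser c (cis x) * (cis (real_of_int m * x) * F x)))"
        by (simp add: fun_eq_iff cis_mult distrib_left mult_ac)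
      finally show ?thesis by (simp add: algebra_simps)
    qed
    have "cmod (integral {-pi..pi} (\<lambda>x. pser a (cis x) * (pser c (cis x) * (cis (real_of_int m * x) * F x))))
        \<le> (\<Sum>i. cmod (a i) * (K * ((real_of_int \<bar>m\<bar> * norm0 c + norm1 c) + real i * norm0 c)))"
      by (rule pser_integral_bound[OF sa _ inner sums_summable[OF wsum[OF a]]])
        (intro continuous_intros cF pser_cis_continuous sc)
    also have "\<dots> = K * ((real_of_int \<bar>m\<bar> * norm0 c + norm1 c - norm0 c) * norm0 a + norm0 c * norm1 a)"
      by (rule sums_unique[OF wsum[OF a], symmetric])
    also have "\<dots> \<le> K * (real_of_int \<bar>m\<bar> * norm0 a * norm0 c + norm1 a * norm0 c + norm0 a * norm1 c)"
    proof (intro mult_left_mono K)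
      have "norm0 a \<ge> 0" unfolding norm0_def by (intro suminf_nonneg sa) auto
      thus "(real_of_int \<bar>m\<bar> * norm0 c + norm1 c - norm0 c) * norm0 a + norm0 c * norm1 a \<le> real_of_int \<bar>m\<bar> * norm0 a * norm0 c + norm1 a * norm0 c + norm0 a * norm1 c"
        using C0p by (simp add: algebra_simps)
    qed
    finally show "cmod (integral {-pi..pi} (\<lambda>x. pser a (cis x) * (pser c (cis x) * (cis (real_of_int m * x) * osc b t x))))
     \<le> C * t powr (-4/3) * (real_of_int \<bar>m\<bar> * norm0 a * norm0 c + norm1 a * norm0 c + norm0 a * norm1 c)"
      by (simp add: F_def K_def)
  qed
qed

text \<open>For \<open>k \<le> n\<close> at most one of the two weights exceeds 1, so the squares fit under the product.\<close>

lemma lweight_product_bound: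
  assumes "k \<le> n"
  shows "real_of_int \<bar>n - k + 1\<bar> * lweight n * lweight (- k) + (lweight n)\<^sup>2 * lweight (- k) + lweight n * (lweight (- k))\<^sup>2
     \<le> 3 * ((1 + real_of_int \<bar>n\<bar>) * (1 + real_of_int \<bar>k\<bar>))"
proof -
  consider "n \<ge> 0" "k \<ge> 0" | "n \<ge> 0" "k < 0" | "n < 0" "k < 0" using assms by linarith
  thus ?thesis
  proof cases
    case 2
    hence "real_of_int k * real_of_int n \<le> 0" by (intro mult_nonpos_nonneg) auto
    thus ?thesis using 2 by (simp add: lweight_def algebra_simps)
  qed (use assms in \<open>auto simp: lweight_def algebra_simps power2_eq_square mult_nonneg_nonneg mult_nonpos_nonpos\<close>)
qed

lemma dispersive_jost:
  assumes b: "wl1 b" and nz: "\<And>z. cmod z = 1 \<Longrightarrow> pser b z \<noteq> 0" and q: "short_range q" and r: "short_range r"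
  obtains C where "C \<ge> 0" "\<And>t n k. t \<ge> 1 \<Longrightarrow> k \<le> n \<Longrightarrow>
    cmod (integral {-pi..pi} (\<lambda>x. jost q n (cis x) * (jost r (- k) (cis x) * (cis (real_of_int (n - k + 1) * x) * osc b t x))))
     \<le> C * t powr (-4/3) * ((1 + real_of_int \<bar>n\<bar>) * (1 + real_of_int \<bar>k\<bar>))"
proof -
  obtain C where C: "C \<ge> 0" "\<And>t m a c. t \<ge> 1 \<Longrightarrow> wl1 a \<Longrightarrow> wl1 c \<Longrightarrow>
    cmod (integral {-pi..pi} (\<lambda>x. pser a (cis x) * (pser c (cis x) * (cis (real_of_int m * x) * osc b t x))))
     \<le> C * t powr (-4/3) * (real_of_int \<bar>m\<bar> * norm0 a * norm0 c + norm1 a * norm0 c + norm0 a * norm1 c)"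
    using dispersive_product[OF b nz] by blast
  define K where "K = jconst q * jconst r"
  have K: "K \<ge> 0" using jconst_ge_1[OF q] jconst_ge_1[OF r] by (simp add: K_def)
  show ?thesis
  proof (rule that[of "C * (3 * K)"])
    show "C * (3 * K) \<ge> 0" using C K by simp
    fix t :: real and n k :: int assume t: "t \<ge> 1" and kn: "k \<le> n"
    define A0 where "A0 = norm0 (jcoeffc q n)"
    define A1 where "A1 = norm1 (jcoeffc q n)"
    define B0 where "B0 = norm0 (jcoeffc r (-k))"
    define B1 where "B1 = norm1 (jcoeffc r (-k))"
    have p: "A0 \<ge> 0" "B0 \<ge> 0" "A1 \<ge> 0" "B1 \<ge> 0"
      unfolding A0_def B0_def A1_def B1_def norm0_def norm1_def using jcoeffc_wl1(1)[OF q, of n] jcoeffc_wl1(1)[OF r, of "-k"]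
      by (auto intro!: suminf_nonneg jcoeffc_l1(1)[OF q] jcoeffc_l1(1)[OF r] simp: wl1_def)
    have u: "A0 \<le> jconst q * lweight n" "B0 \<le> jconst r * lweight (-k)" "A1 \<le> jconst q * (lweight n)\<^sup>2" "B1 \<le> jconst r * (lweight (-k))\<^sup>2"
      unfolding A0_def B0_def A1_def B1_def norm0_def norm1_def by (intro jcoeffc_l1(3) jcoeffc_wl1(2) q r)+
    have w: "jconst q * lweight n \<ge> 0" "jconst q * (lweight n)\<^sup>2 \<ge> 0" using jconst_ge_1[OF q] lweight_ge_1[of n] by auto
    have "real_of_int \<bar>n - k + 1\<bar> * (A0 * B0) + A1 * B0 + A0 * B1 \<le>
      real_of_int \<bar>n - k + 1\<bar> * ((jconst q * lweight n) * (jconst r * lweight (-k))) + (jconst q * (lweight n)\<^sup>2) * (jconst r * lweight (-k))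
       + (jconst q * lweight n) * (jconst r * (lweight (-k))\<^sup>2)"
      by (intro add_mono mult_mono mult_left_mono u p w) auto
    also have "\<dots> = K * (real_of_int \<bar>n - k + 1\<bar> * lweight n * lweight (- k) + (lweight n)\<^sup>2 * lweight (- k) + lweight n * (lweight (- k))\<^sup>2)"
      by (simp add: K_def algebra_simps)
    also have "\<dots> \<le> K * (3 * ((1 + real_of_int \<bar>n\<bar>) * (1 + real_of_int \<bar>k\<bar>)))"
      by (intro mult_left_mono lweight_product_bound kn K)
    finally have le: "real_of_int \<bar>n - k + 1\<bar> * A0 * B0 + A1 * B0 + A0 * B1 \<le> K * (3 * ((1 + real_of_int \<bar>n\<bar>) * (1 + real_of_int \<bar>k\<bar>)))"
      by (simp add: mult.assoc)
    have "C * t powr (-4/3) \<ge> 0" using C by simp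
    from order.trans[OF C(2)[OF t jcoeffc_wl1(1)[OF q, of n] jcoeffc_wl1(1)[OF r, of "-k"], of "n - k + 1"]
       mult_left_mono[OF le[unfolded A0_def A1_def B0_def B1_def] this]]
    show "cmod (integral {-pi..pi} (\<lambda>x. jost q n (cis x) * (jost r (- k) (cis x) * (cis (real_of_int (n - k + 1) * x) * osc b t x))))
     \<le> C * (3 * K) * t powr (-4/3) * ((1 + real_of_int \<bar>n\<bar>) * (1 + real_of_int \<bar>k\<bar>))"
      unfolding jost_def by (simp add: mult_ac)
  qed
qed

section \<open>Jost solutions and their Wronskian\<close>

text \<open>\<open>energy\<close> maps the punctured disc onto the complement of \<open>[0, 4]\<close> and the circle onto \<open>[0, 4]\<close>.\<close>

definition energy :: "complex \<Rightarrow> complex" where "energy z = 2 - z - inverse z"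

definition reflect :: "(int \<Rightarrow> real) \<Rightarrow> int \<Rightarrow> real" where "reflect q n = q (- n)"

definition jostR :: "(int \<Rightarrow> real) \<Rightarrow> complex \<Rightarrow> int \<Rightarrow> complex" where
  "jostR q z n = z powi n * jost q n z"

text \<open>Reflecting the lattice turns the solution normalised at -infinity into one normalised at
  +infinity, so the estimates for \<open>jostR\<close> carry over.\<close>

definition jostL :: "(int \<Rightarrow> real) \<Rightarrow> complex \<Rightarrow> int \<Rightarrow> complex" where
  "jostL q z n = jostR (reflect q) z (- n)"

definition sol :: "(int \<Rightarrow> real) \<Rightarrow> complex \<Rightarrow> (int \<Rightarrow> complex) \<Rightarrow> bool" where
  "sol q e u \<longleftrightarrow> Hop q u = (\<lambda>n. e * u n)"

definition wronsk :: "(int \<Rightarrow> complex) \<Rightarrow> (int \<Rightarrow> complex) \<Rightarrow> int \<Rightarrow> complex" where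
  "wronsk u v n = u n * v (n + 1) - u (n + 1) * v n"

text \<open>This is z times the Wronskian of the two Jost solutions, evaluated at site 0 and written
  through the series so that it makes sense at z = 0. The factor z removes the simple pole there and
  leaves the value 1.\<close>

definition jwr :: "(int \<Rightarrow> real) \<Rightarrow> complex \<Rightarrow> complex" where
  "jwr q z = jost q 0 z * jost (reflect q) (-1) z - z\<^sup>2 * (jost q 1 z * jost (reflect q) 0 z)"

lemma reflect_reflect [simp]: "reflect (reflect q) = q"
  by (simp add: reflect_def fun_eq_iff)

lemma short_range_reflect:
  assumes "short_range q" shows "short_range (reflect q)"
proof -
  have "bij_betw uminus (UNIV :: int set) UNIV" by (intro bij_betwI[where g = uminus]) auto
  from summable_on_reindex_bij_betw[OF this, of "\<lambda>n. (1 + real_of_int \<bar>n\<bar>)\<^sup>2 * \<bar>q n\<bar>"] show ?thesis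
    using assms by (simp add: short_range_def reflect_def)
qed

lemma sol_next: "sol q e u \<Longrightarrow> u (n + 1) = (2 - e + complex_of_real (q n)) * u n - u (n - 1)"
  unfolding sol_def Hop_def by (drule fun_cong[of _ _ n]) (simp add: algebra_simps)

lemma sol_prev: "sol q e u \<Longrightarrow> u (n - 1) = (2 - e + complex_of_real (q n)) * u n - u (n + 1)"
  unfolding sol_def Hop_def by (drule fun_cong[of _ _ n]) (simp add: algebra_simps)

lemma solI: "(\<And>n. u (n + 1) + u (n - 1) = (2 - e + complex_of_real (q n)) * u n) \<Longrightarrow> sol q e u"
  unfolding sol_def Hop_def by (rule ext) (simp add: algebra_simps)

lemma sol_lin:
  assumes "sol q e u" "sol q e v" shows "sol q e (\<lambda>n. a * u n + b * v n)"
  by (rule solI) (simp add: sol_next[OF assms(1)] sol_next[OF assms(2)] algebra_simps)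

lemma sol_reflect: "sol q e u \<Longrightarrow> sol (reflect q) e (\<lambda>n. u (- n))"
proof (rule solI)
  fix n assume "sol q e u"
  from sol_next[OF this, of "- n"]
  show "u (- (n + 1)) + u (- (n - 1)) = (2 - e + complex_of_real (reflect q n)) * u (- n)"
    by (simp add: reflect_def)
qed

lemma sol_cnj:
  assumes "sol q e u" shows "sol q (cnj e) (\<lambda>n. cnj (u n))"
  by (rule solI) (subst sol_next[OF assms], simp add: algebra_simps)

lemma wronsk_const:
  assumes "sol q e u" "sol q e v" shows "wronsk u v n = wronsk u v m"
proof -
  have st: "wronsk u v (n + 1) = wronsk u v n" for n
    unfolding wronsk_def sol_next[OF assms(1), of "n + 1"] sol_next[OF assms(2), of "n + 1"]
    by (simp add: algebra_simps)
  have "wronsk u v n = wronsk u v 0" for n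
  proof (induction n rule: int_induct[where k = 0])
    case (step2 i) thus ?case using st[of "i - 1"] by simp
  qed (use st in auto)
  thus ?thesis by metis
qed

lemma sol_zero:
  assumes u: "sol q e u" and "u m = 0" "u (m + 1) = 0"
  shows "u n = 0"
proof -
  have "u n = 0 \<and> u (n + 1) = 0"
  proof (induction n rule: int_induct[where k = m])
    case (step1 i) thus ?case using sol_next[OF u, of "i + 1"] by simp
  next
    case (step2 i) thus ?case using sol_prev[OF u, of i] by simp
  qed (use assms in auto)
  thus ?thesis by simp
qed

lemma sol_dependent:
  assumes u: "sol q e u" and v: "sol q e v" and w: "wronsk u v m = 0" and nz: "v \<noteq> (\<lambda>_. 0)"
  shows "\<exists>c. u = (\<lambda>n. c * v n)"
proof -
  have ne: "\<not> (v m = 0 \<and> v (m + 1) = 0)" using sol_zero[OF v, of m] nz by auto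
  obtain c where c: "u m = c * v m" "u (m + 1) = c * v (m + 1)"
  proof (cases "v m = 0")
    case True
    hence "v (m + 1) \<noteq> 0" "u m = 0" using ne w by (auto simp: wronsk_def)
    thus ?thesis using that[of "u (m + 1) / v (m + 1)"] True by simp
  next
    case False
    thus ?thesis using that[of "u m / v m"] w by (simp add: wronsk_def field_simps)
  qed
  have s: "sol q e (\<lambda>n. 1 * u n + (- c) * v n)" by (rule sol_lin[OF u v])
  have "1 * u n + (- c) * v n = 0" for n by (rule sol_zero[OF s, of m]) (use c in auto)
  thus ?thesis by (intro exI[of _ c]) (auto simp: fun_eq_iff)
qed

context
  fixes q :: "int \<Rightarrow> real"
  assumes q: "short_range q"
begin

lemma sol_jostR:
  assumes z: "z \<noteq> 0" "cmod z \<le> 1" shows "sol q (energy z) (jostR q z)"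
proof (rule solI)
  fix n
  have a: "jost q (n - 1) z = (1 + z\<^sup>2 + complex_of_real (q n) * z) * jost q n z - z\<^sup>2 * jost q (n + 1) z"
    using jost_difference[OF q z(2), of "n - 1"] by (simp add: algebra_simps)
  have b: "jostR q z (n + 1) = z powi n * (z * jost q (n + 1) z)"
    "jostR q z (n - 1) = z powi n * (inverse z * jost q (n - 1) z)"
    using z by (simp_all add: jostR_def power_int_add power_int_diff divide_inverse)
  show "jostR q z (n + 1) + jostR q z (n - 1) = (2 - energy z + complex_of_real (q n)) * jostR q z n"
    unfolding a b using z by (simp add: jostR_def energy_def field_simps power2_eq_square)
qed

lemma jost_eventually_nonzero: "cmod z \<le> 1 \<Longrightarrow> eventually (\<lambda>N. jost q (int N) z \<noteq> 0) sequentially"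
  by (rule tendsto_imp_eventually_ne[OF jost_tendsto[OF q]]) auto

lemma jostR_nonzero:
  assumes "z \<noteq> 0" "cmod z \<le> 1" shows "jostR q z \<noteq> (\<lambda>_. 0)"
proof
  assume a: "jostR q z = (\<lambda>_. 0)"
  obtain N where "jost q (int N) z \<noteq> 0"
    using jost_eventually_nonzero[OF assms(2)] by (auto simp: eventually_sequentially)
  thus False using fun_cong[OF a, of "int N"] assms by (simp add: jostR_def)
qed

lemma jostR_bound:
  assumes "z \<noteq> 0" "cmod z \<le> 1" "n \<ge> 0" shows "cmod (jostR q z n) \<le> jconst q * cmod z ^ nat n"
proof -
  have "cmod (jostR q z n) = cmod z ^ nat n * cmod (jost q n z)"
    using assms by (simp add: jostR_def norm_mult norm_power power_int_def)
  also have "\<dots> \<le> cmod z ^ nat n * (jconst q * lweight n)"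
    by (intro mult_left_mono jost_bound q assms) auto
  finally show ?thesis using assms by (simp add: lweight_nonneg mult.commute)
qed

text \<open>The Wronskian is constant in \<open>n\<close>, hence computable at +infinity, where the
  series tend to 1 and the powers of z and \<open>cnj z\<close> cancel because their product is
  1.\<close>

lemma wronsk_jostR_cnj:
  assumes z: "cmod z = 1" shows "wronsk (jostR q z) (jostR q (cnj z)) n = cnj z - z"
proof -
  have nz: "z \<noteq> 0" "cnj z \<noteq> 0" using z by auto
  have zc: "z * cnj z = 1" using z by (simp add: complex_norm_square[symmetric])
  have inv: "inverse z = cnj z" "inverse (cnj z) = z"
    using zc by (auto intro: inverse_unique simp: mult.commute)
  have e: "energy (cnj z) = energy z" by (simp add: energy_def inv)
  have s: "sol q (energy z) (jostR q z)" "sol q (energy z) (jostR q (cnj z))"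
    using sol_jostR[of z] sol_jostR[of "cnj z"] nz z by (simp_all add: e)
  have *: "wronsk (jostR q z) (jostR q (cnj z)) (int N) = cnj z * (jost q (int N) z * jost q (int (Suc N)) (cnj z))
      - z * (jost q (int (Suc N)) z * jost q (int N) (cnj z))" for N
  proof -
    have p: "z ^ N * cnj z ^ N = 1" using zc by (simp add: power_mult_distrib[symmetric])
    have "int N + 1 = int (Suc N)" by simp
    hence "wronsk (jostR q z) (jostR q (cnj z)) (int N) = (z ^ N * cnj z ^ N) * (cnj z * (jost q (int N) z * jost q (int (Suc N)) (cnj z))
      - z * (jost q (int (Suc N)) z * jost q (int N) (cnj z)))"
      unfolding wronsk_def jostR_def by (simp only: power_int_of_nat power_Suc) (simp add: algebra_simps)
    thus ?thesis by (simp add: p)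
  qed
  have "(\<lambda>N. cnj z * (jost q (int N) z * jost q (int (Suc N)) (cnj z))
      - z * (jost q (int (Suc N)) z * jost q (int N) (cnj z))) \<longlonglongrightarrow> cnj z * (1 * 1) - z * (1 * 1)"
    by (intro tendsto_intros jost_tendsto q LIMSEQ_Suc[OF jost_tendsto[OF q]]) (use z in auto)
  hence "(\<lambda>N. wronsk (jostR q z) (jostR q (cnj z)) n) \<longlonglongrightarrow> cnj z - z"
    unfolding trans[OF *[symmetric] wronsk_const[OF s, of _ n]] by simp
  thus ?thesis by (simp add: LIMSEQ_const_iff)
qed

end

lemma sol_jostL: "short_range q \<Longrightarrow> z \<noteq> 0 \<Longrightarrow> cmod z \<le> 1 \<Longrightarrow> sol q (energy z) (jostL q z)"
  using sol_reflect[OF sol_jostR[OF short_range_reflect], of q z] by (simp add: jostL_def[abs_def])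

lemma jostL_nonzero: "short_range q \<Longrightarrow> z \<noteq> 0 \<Longrightarrow> cmod z \<le> 1 \<Longrightarrow> jostL q z \<noteq> (\<lambda>_. 0)"
  using jostR_nonzero[OF short_range_reflect, of q z] by (auto simp: jostL_def fun_eq_iff) (metis minus_minus)

lemma jostR_cnj:
  assumes "short_range q" "cmod z \<le> 1" shows "cnj (jostR q z n) = jostR q (cnj z) n"
  using assms by (simp add: jostR_def jost_cnj)

lemma wronsk_jostR_jostL:
  assumes "z \<noteq> 0" shows "z * wronsk (jostR q z) (jostL q z) 0 = jwr q z"
  using assms by (simp add: wronsk_def jostR_def jostL_def jwr_def power_int_minus power2_eq_square algebra_simps)

text \<open>A zero makes the two Jost solutions proportional. At z = 1 and z = -1, of energies 0 and
  4, the common solution is bounded on both half lines, hence a resonance. Elsewhere the Wronskian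
  of a solution with its conjugate is a conserved flux, nonzero and of opposite signs for the right
  and the left solution; proportionality with factor \<open>c\<close> would give 1 + |c|^2 =
  0.\<close>

lemma jwr_nonzero_circle:
  assumes q: "short_range q" and nr: "\<not> resonance q 0" "\<not> resonance q 4" and z: "cmod z = 1"
  shows "jwr q z \<noteq> 0"
proof
  assume w0: "jwr q z = 0"
  have nz: "z \<noteq> 0" "cmod z \<le> 1" using z by auto
  note r = short_range_reflect[OF q]
  note sp = sol_jostR[OF q nz] and sm = sol_jostL[OF q nz]
  have "wronsk (jostR q z) (jostL q z) 0 = 0" using wronsk_jostR_jostL[OF nz(1), of q] w0 nz by simp
  then obtain c where c: "jostR q z = (\<lambda>n. c * jostL q z n)"
    using sol_dependent[OF sp sm _ jostL_nonzero[OF q nz]] by blast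
  have c0: "c \<noteq> 0" using jostR_nonzero[OF q nz] c by auto
  show False
  proof (cases "z = 1 \<or> z = -1")
    case True
    have bp: "cmod (jostR q z n) \<le> jconst q" if "n \<ge> 0" for n using jostR_bound[OF q nz that] z by simp
    have bm: "cmod (jostL q z n) \<le> jconst (reflect q)" if "n \<le> 0" for n
      using jostR_bound[OF r nz, of "- n"] z that by (simp add: jostL_def)
    have "cmod (jostR q z n) \<le> max (jconst q) (cmod c * jconst (reflect q))" for n
    proof (cases "n \<ge> 0")
      case True thus ?thesis using bp[of n] by simp
    next
      case False
      hence "cmod (jostR q z n) \<le> cmod c * jconst (reflect q)"
        using bm[of n] c by (simp add: norm_mult mult_left_mono)
      thus ?thesis by simp
    qed
    hence "bounded (range (jostR q z))" unfolding bounded_iff by blast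
    hence "resonance q (if z = 1 then 0 else 4)"
      unfolding resonance_def using True sp jostR_nonzero[OF q nz]
      by (intro exI[of _ "jostR q z"]) (auto simp: sol_def energy_def)
    thus False using nr by (auto split: if_splits)
  next
    case False
    have im: "cnj z - z \<noteq> 0"
    proof
      assume "cnj z - z = 0"
      hence "Im z = 0" by (simp add: complex_eq_iff)
      hence "\<bar>Re z\<bar> = 1" using z by (simp add: cmod_def)
      thus False using False \<open>Im z = 0\<close> by (auto simp: complex_eq_iff abs_if split: if_splits)
    qed
    have cp: "jostR q (cnj z) n = cnj (jostR q z n)" "jostR (reflect q) (cnj z) n = cnj (jostR (reflect q) z n)" for n
      using jostR_cnj[OF q nz(2)] jostR_cnj[OF r nz(2)] by auto
    have fm': "jostR (reflect q) z n = jostL q z (- n)" for n by (simp add: jostL_def)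
    have "cnj z - z = wronsk (jostR q z) (jostR q (cnj z)) 0" by (rule wronsk_jostR_cnj[OF q z, symmetric])
    also have "\<dots> = (c * cnj c) * (jostL q z 0 * cnj (jostL q z 1) - jostL q z 1 * cnj (jostL q z 0))"
      unfolding wronsk_def cp c by (simp add: algebra_simps)
    also have "jostL q z 0 * cnj (jostL q z 1) - jostL q z 1 * cnj (jostL q z 0) = - wronsk (jostR (reflect q) z) (jostR (reflect q) (cnj z)) (-1)"
      unfolding wronsk_def cp fm' by simp
    also have "\<dots> = - (cnj z - z)" by (simp add: wronsk_jostR_cnj[OF r z])
    finally have "(cnj z - z) * (1 + c * cnj c) = 0" by (simp add: algebra_simps)
    hence "1 + c * cnj c = 0" using im by simp
    hence "complex_of_real (1 + (cmod c)\<^sup>2) = 0" using complex_norm_square[of c] by simp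
    hence "1 + (cmod c)\<^sup>2 = 0" unfolding of_real_eq_0_iff .
    thus False by (smt (verit) zero_le_power2)
  qed
qed

lemma jostL_bound:
  assumes "short_range q" "z \<noteq> 0" "cmod z \<le> 1" "n \<le> 0"
  shows "cmod (jostL q z n) \<le> jconst (reflect q) * cmod z ^ nat (- n)"
  using jostR_bound[OF short_range_reflect[OF assms(1)] assms(2,3), of "- n"] assms(4) by (simp add: jostL_def)

lemma wiener1_jwr: "short_range q \<Longrightarrow> wiener1 (jwr q)"
  unfolding jwr_def[abs_def]
  by (intro wiener1_diff wiener1_mult wiener1_power wiener1_jost short_range_reflect)

text \<open>\<open>jostR\<close> decays at +infinity and \<open>jostL\<close> at -infinity, so a
  solution proportional to both decays at both ends.\<close>

lemma jwr_zero_decay: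
  assumes q: "short_range q" and z: "z \<noteq> 0" "cmod z < 1" and w: "jwr q z = 0"
  obtains c K where "c \<noteq> 0" "jostR q z = (\<lambda>n. c * jostL q z n)"
    "\<And>n. cmod (jostL q z n) \<le> K * cmod z ^ nat \<bar>n\<bar>"
proof -
  have nz: "z \<noteq> 0" "cmod z \<le> 1" using z by auto
  have "wronsk (jostR q z) (jostL q z) 0 = 0" using wronsk_jostR_jostL[OF nz(1), of q] w nz by simp
  then obtain c where c: "jostR q z = (\<lambda>n. c * jostL q z n)"
    using sol_dependent[OF sol_jostR[OF q nz] sol_jostL[OF q nz] _ jostL_nonzero[OF q nz]] by blast
  have c0: "c \<noteq> 0" using jostR_nonzero[OF q nz] c by auto
  show ?thesis
  proof (rule that[OF c0 c])
    fix n
    let ?K = "max (jconst (reflect q)) (jconst q / cmod c)"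
    show "cmod (jostL q z n) \<le> ?K * cmod z ^ nat \<bar>n\<bar>"
    proof (cases "n \<le> 0")
      case True
      have "cmod (jostL q z n) \<le> jconst (reflect q) * cmod z ^ nat \<bar>n\<bar>" using jostL_bound[OF q nz True] True by simp
      also have "\<dots> \<le> ?K * cmod z ^ nat \<bar>n\<bar>" by (intro mult_right_mono) auto
      finally show ?thesis .
    next
      case False
      have "cmod (jostL q z n) = cmod (jostR q z n) / cmod c" using c c0 by (simp add: norm_mult)
      also have "\<dots> \<le> (jconst q * cmod z ^ nat \<bar>n\<bar>) / cmod c"
        using jostR_bound[OF q nz, of n] False by (intro divide_right_mono) auto
      also have "\<dots> = (jconst q / cmod c) * cmod z ^ nat \<bar>n\<bar>" by simp
      also have "\<dots> \<le> ?K * cmod z ^ nat \<bar>n\<bar>" by (intro mult_right_mono) auto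
      finally show ?thesis .
    qed
  qed
qed

section \<open>Residues and summation by parts\<close>

text \<open>On the circle itself \<open>N\<close> and \<open>V\<close> are just continuous. The
  residue theorem is therefore applied to circles of radius r < 1 enclosing all zeros of
  \<open>V\<close>, and its value, independent of r, is carried to r = 1 by continuity.\<close>

lemma circle_integral_simple_poles:
  fixes N V :: "complex \<Rightarrow> complex"
  assumes hN: "N holomorphic_on ball 0 1" and cN: "continuous_on (cball 0 1) N"
    and hV: "V holomorphic_on ball 0 1" and cV: "continuous_on (cball 0 1) V"
    and nz: "\<And>z. cmod z = 1 \<Longrightarrow> V z \<noteq> 0"
    and simple: "\<And>z. cmod z < 1 \<Longrightarrow> V z = 0 \<Longrightarrow> deriv V z \<noteq> 0"
  defines "Z \<equiv> {z. cmod z < 1 \<and> V z = 0}"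
  shows "finite Z"
    and "integral {-pi..pi} (\<lambda>x. N (cis x) / V (cis x) * cis x) = 2 * pi * (\<Sum>p\<in>Z. N p / deriv V p)"
proof -
  \<comment> \<open>As \<open>V\<close> has no zero on the circle, its zeros in the closed disc form
    a compact subset of the open disc. They are finite in number unless \<open>V\<close> is
    constant, in which case there are none.\<close>
  have Zeq: "Z = {z \<in> cball 0 1. V z = 0}"
    using nz by (auto simp: Z_def order.order_iff_strict)
  have "closed Z"
    unfolding Zeq using continuous_closed_preimage_constant[OF cV, of 0] by simp
  hence cZ: "compact Z" unfolding compact_eq_bounded_closed Zeq
    by (auto intro: bounded_subset[OF bounded_cball[of 0 1]])
  have Zb: "Z \<subseteq> ball 0 1" by (auto simp: Z_def)
  show finZ: "finite Z"
  proof (cases "V constant_on ball 0 1")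
    case True
    then obtain c where c: "\<And>z. z \<in> ball 0 1 \<Longrightarrow> V z = c" by (auto simp: constant_on_def)
    have "V 1 = c"
      using continuous_constant_on_closure[of "ball 0 1" V c 1] cV c by auto
    hence "Z = {}" using nz[of 1] c by (auto simp: Z_def)
    thus ?thesis by simp
  next
    case False
    have "finite {z \<in> Z. V z = 0}"
      by (rule holomorphic_compact_finite_zeros[OF hV _ _ cZ Zb False]) auto
    thus ?thesis by (simp add: Z_def)
  qed
  \<comment> \<open>Inserting 0 keeps the maximum defined when there are no zeros. Between
    \<open>r1\<close>, halfway from \<open>r0\<close> to 1, and the circle the quotient is
    continuous.\<close>
  define r0 where "r0 = Max (insert 0 (cmod ` Z))"
  have r0: "0 \<le> r0" "r0 < 1" "\<And>p. p \<in> Z \<Longrightarrow> cmod p \<le> r0"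
    using finZ by (auto simp: r0_def Z_def)
  define r1 where "r1 = (1 + r0) / 2"
  have r1: "r0 < r1" "0 < r1" "r1 < 1" using r0 by (auto simp: r1_def)
  define F where "F = (\<lambda>z. N z / V z)"
  define \<Sigma> where "\<Sigma> = (\<Sum>p\<in>Z. N p / deriv V p)"
  have res: "residue F p = N p / deriv V p" if p: "p \<in> Z" for p
  proof (rule residue_simple'[where s = "ball 0 1 - (Z - {p})"])
    show "open (ball 0 1 - (Z - {p}))" using finZ by (intro open_Diff finite_imp_closed) auto
    show "p \<in> ball 0 1 - (Z - {p})" using p Zb by auto
    show "F holomorphic_on ball 0 1 - (Z - {p}) - {p}" unfolding F_def
      by (intro holomorphic_on_divide holomorphic_on_subset[OF hN] holomorphic_on_subset[OF hV])
        (auto simp: Z_def)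
    have dV: "(V has_field_derivative deriv V p) (at p)"
      using hV p Zb by (auto intro: holomorphic_derivI)
    have "(\<lambda>w. (V w - V p) / (w - p)) \<midarrow>p\<rightarrow> deriv V p"
      using dV by (simp add: has_field_derivative_iff)
    hence l: "(\<lambda>w. V w / (w - p)) \<midarrow>p\<rightarrow> deriv V p" using p by (simp add: Z_def)
    have "isCont N p" using hN p Zb
      by (meson continuous_on_eq_continuous_at holomorphic_on_imp_continuous_on open_ball subsetD)
    hence "(\<lambda>w. N w / (V w / (w - p))) \<midarrow>p\<rightarrow> N p / deriv V p"
      using p simple[of p] by (intro tendsto_divide l) (auto simp: isCont_def Z_def)
    thus "(\<lambda>w. F w * (w - p)) \<midarrow>p\<rightarrow> N p / deriv V p" by (simp add: F_def)
  qed
  define J where "J = (\<lambda>r. integral (cbox 0 (2 * pi)) (\<lambda>t. F (of_real r * cis t) * cis t))"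
  have Jr: "of_real r * J r = 2 * pi * \<Sigma>" if r: "r1 \<le> r" "r < 1" for r
  proof -
    have rp: "r > 0" using r r1 by auto
    have "contour_integral (circlepath 0 r) F
      = 2 * pi * \<i> * (\<Sum>p\<in>Z. winding_number (circlepath 0 r) p * residue F p)"
    proof (rule Residue_theorem[of "ball 0 1"])
      show "F holomorphic_on ball 0 1 - Z" unfolding F_def
        by (intro holomorphic_on_divide holomorphic_on_subset[OF hN] holomorphic_on_subset[OF hV])
          (auto simp: Z_def)
      have "sphere 0 r \<inter> Z = {}" using r0(3) r r1 by force
      thus "path_image (circlepath 0 r) \<subseteq> ball 0 1 - Z" using rp r by auto
      show "\<forall>z. z \<notin> ball 0 1 \<longrightarrow> winding_number (circlepath 0 r) z = 0"
        using rp r by (intro allI impI winding_number_zero_outside[of _ "cball 0 r"]) auto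
    qed (use finZ in auto)
    also have "(\<Sum>p\<in>Z. winding_number (circlepath 0 r) p * residue F p) = \<Sigma>"
      unfolding \<Sigma>_def
    proof (intro sum.cong refl)
      fix p assume p: "p \<in> Z"
      have "winding_number (circlepath 0 r) p = 1"
        using r0(3)[OF p] r r1 by (intro winding_number_circlepath) auto
      thus "winding_number (circlepath 0 r) p * residue F p = N p / deriv V p" by (simp add: res[OF p])
    qed
    also have "contour_integral (circlepath 0 r) F
        = integral {0..2*pi} (\<lambda>t. F (0 + r * cis t) * r * \<i> * cis t)"
      unfolding circlepath_def by (rule contour_integral_part_circlepath_eq) auto
    also have "\<dots> = integral {0..2*pi} (\<lambda>t. (r * \<i>) * (F (of_real r * cis t) * cis t))"
      by (simp add: mult_ac)
    also have "\<dots> = (r * \<i>) * J r" by (simp add: J_def)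
    finally have "\<i> * (of_real r * J r) = \<i> * (2 * pi * \<Sigma>)" by (simp add: mult_ac)
    thus ?thesis by simp
  qed
  have cF: "continuous_on {z. r1 \<le> cmod z \<and> cmod z \<le> 1} F" unfolding F_def
  proof (intro continuous_on_divide ballI)
    show "continuous_on {z. r1 \<le> cmod z \<and> cmod z \<le> 1} N" by (rule continuous_on_subset[OF cN]) auto
    show "continuous_on {z. r1 \<le> cmod z \<and> cmod z \<le> 1} V" by (rule continuous_on_subset[OF cV]) auto
    fix z assume "z \<in> {z. r1 \<le> cmod z \<and> cmod z \<le> 1}"
    moreover have "cmod z \<le> r0" if "V z = 0" "cmod z < 1" using r0(3)[of z] that by (simp add: Z_def)
    ultimately show "V z \<noteq> 0" using nz[of z] r1 by force
  qed
  have "continuous_on {r1..1} J" unfolding J_def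
  proof (rule integral_continuous_on_param)
    have "continuous_on ({r1..1} \<times> cbox 0 (2 * pi)) (\<lambda>x. F (of_real (fst x) * cis (snd x)) * cis (snd x))"
    proof (intro continuous_intros continuous_on_compose2[OF cF])
      show "(\<lambda>x. complex_of_real (fst x) * cis (snd x)) ` ({r1..1} \<times> cbox 0 (2 * pi)) \<subseteq> {z. r1 \<le> cmod z \<and> cmod z \<le> 1}"
        using r1 by (auto simp: norm_mult)
    qed
    thus "continuous_on ({r1..1} \<times> cbox 0 (2 * pi)) (\<lambda>(r, t). F (of_real r * cis t) * cis t)"
      by (simp add: case_prod_unfold)
  qed
  hence "continuous_on {r1..1} (\<lambda>r. of_real r * J r)" by (intro continuous_intros)
  hence "of_real 1 * J 1 = 2 * pi * \<Sigma>"
    using continuous_constant_on_closure[of "{r1..<1}" "\<lambda>r. of_real r * J r" "2 * pi * \<Sigma>" 1] Jr r1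
    by (simp add: closure_atLeastLessThan)
  hence J1: "integral {0..2*pi} (\<lambda>t. F (cis t) * cis t) = 2 * pi * \<Sigma>" by (simp add: J_def)
  define G where "G = (\<lambda>t. F (cis t) * cis t)"
  have cG: "continuous_on S G" for S unfolding G_def
    by (intro continuous_intros continuous_on_compose2[OF cF]) (use r1 in auto)
  have sp: "integral {u..v} G = integral {u..c} G + integral {c..v} G" if "u \<le> c" "c \<le> v" for u c v
    using Henstock_Kurzweil_Integration.integral_combine[OF that integrable_continuous_real[OF cG]] by simp
  have per: "G \<circ> (+) (2 * pi) = G"
    by (simp add: fun_eq_iff G_def cis_mult[symmetric])
  have "integral {-pi..0} G = integral {pi..2*pi} G"
    using integral_shift_Icc_real[of "-pi" 0 G "2 * pi"] per by simp
  hence "integral {-pi..pi} G = integral {0..2*pi} G"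
    using sp[of "-pi" 0 pi] sp[of 0 pi "2*pi"] by simp
  thus "integral {-pi..pi} (\<lambda>x. N (cis x) / V (cis x) * cis x) = 2 * pi * (\<Sum>p\<in>Z. N p / deriv V p)"
    using J1 by (simp add: G_def F_def \<Sigma>_def)
qed

section \<open>Weighted sequences and summation by parts\<close>

lemma has_sum_minus:
  fixes f g :: "'a \<Rightarrow> complex"
  assumes "(f has_sum a) A" "(g has_sum b) A"
  shows "((\<lambda>x. f x - g x) has_sum (a - b)) A"
  using has_sum_add[OF assms(1) has_sum_uminusI[OF assms(2)]] by simp

definition weight :: "int \<Rightarrow> real" where "weight n = 1 + real_of_int \<bar>n\<bar>"

lemma weight_ge_1: "weight n \<ge> 1" by (simp add: weight_def)

lemma weight_nonneg [simp]: "weight n \<ge> 0" by (simp add: weight_def)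

lemma summable_weight_geometric:
  assumes r: "0 \<le> \<rho>" "\<rho> < 1"
  shows "(\<lambda>n. weight n * \<rho> ^ nat \<bar>n\<bar>) summable_on UNIV"
proof -
  let ?f = "\<lambda>n. weight n * \<rho> ^ nat \<bar>n\<bar>"
  \<comment> \<open>The sequence \<open>diffs (\<lambda>_. 1)\<close> holds the coefficients n + 1
    of the derivative of the geometric series.\<close>
  have "summable (\<lambda>n. diffs (\<lambda>_. 1) n * \<rho> ^ n)"
    by (rule termdiff_converges[where K = 1]) (use r in \<open>auto simp: summable_geometric\<close>)
  hence "summable (\<lambda>n. real (Suc n) * \<rho> ^ n)" by (simp add: diffs_def)
  hence s: "(\<lambda>n. real (Suc n) * \<rho> ^ n) summable_on UNIV"
    by (intro summable_nonneg_imp_summable_on) (use r in auto)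
  have 1: "?f summable_on range int"
    using s by (subst summable_on_reindex) (auto simp: o_def weight_def)
  have 2: "?f summable_on range (\<lambda>n. - int n)"
    using s by (subst summable_on_reindex) (auto simp: o_def weight_def inj_on_def)
  have "?f summable_on (range int \<union> range (\<lambda>n. - int n))" by (rule summable_on_union[OF 1 2])
  moreover have "range int \<union> range (\<lambda>n. - int n) = UNIV"
  proof (intro equalityI subsetI UNIV_I)
    fix x :: int show "x \<in> range int \<union> range (\<lambda>n. - int n)"
      by (cases x) (auto intro: range_eqI[of _ _ "Suc _"])
  qed
  ultimately show ?thesis by simp
qed

text \<open>This is l^1_1, the space of initial data. In the nonresonant case it also contains all
  eigenvectors, because they decay geometrically.\<close>

definition rapid :: "(int \<Rightarrow> complex) \<Rightarrow> bool" where
  "rapid u \<longleftrightarrow> (\<lambda>n. weight n * cmod (u n)) summable_on UNIV"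

lemma rapid_geometric:
  assumes "0 \<le> \<rho>" "\<rho> < 1" "\<And>n. cmod (u n) \<le> K * \<rho> ^ nat \<bar>n\<bar>"
  shows "rapid u"
  unfolding rapid_def
proof (rule summable_on_comparison_test)
  show "(\<lambda>n. K * (weight n * \<rho> ^ nat \<bar>n\<bar>)) summable_on UNIV"
    by (intro summable_on_cmult_right summable_weight_geometric assms)
  show "weight n * cmod (u n) \<le> K * (weight n * \<rho> ^ nat \<bar>n\<bar>)" for n
    using mult_left_mono[OF assms(3), of "weight n" n] weight_ge_1[of n] by (simp add: mult_ac)
qed simp

lemma rapid_mult_summable:
  assumes u: "rapid u" and M: "\<And>n. cmod (M n) \<le> C * weight n"
  shows "(\<lambda>n. norm (M n * u n)) summable_on UNIV"
proof (rule summable_on_comparison_test)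
  show "(\<lambda>n. C * (weight n * cmod (u n))) summable_on UNIV"
    using u unfolding rapid_def by (rule summable_on_cmult_right)
  show "norm (M n * u n) \<le> C * (weight n * cmod (u n))" for n
    using mult_right_mono[OF M, of "cmod (u n)" n] by (simp add: norm_mult mult_ac)
qed simp

lemma rapid_bounded:
  assumes "rapid u" obtains C where "\<And>n. cmod (u n) \<le> C"
proof -
  have "cmod (u n) \<le> (\<Sum>\<^sub>\<infinity>n. weight n * cmod (u n))" for n
  proof -
    have "cmod (u n) \<le> weight n * cmod (u n)" using weight_ge_1[of n] by (simp add: mult_le_cancel_right1)
    also have "\<dots> = infsum (\<lambda>n. weight n * cmod (u n)) {n}" by simp
    also have "\<dots> \<le> (\<Sum>\<^sub>\<infinity>n. weight n * cmod (u n))"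
      by (rule infsum_mono2) (use assms in \<open>auto simp: rapid_def\<close>)
    finally show ?thesis .
  qed
  thus ?thesis using that by blast
qed

text \<open>The potential cancels and the summand is d(n) - d(n-1), with \<open>d\<close> the
  Wronskian of \<open>M\<close> and \<open>u\<close>. The weight on \<open>u\<close> outweighs the
  linear growth of \<open>M\<close>, so \<open>d\<close> is summable, and a sum over all integers is
  invariant under the shift. The growth allowed for \<open>M\<close> matches that of the spectral
  kernels.\<close>

lemma has_sum_green:
  assumes u: "rapid u" and M: "\<And>n. cmod (M n) \<le> C * weight n"
  shows "((\<lambda>n. Hop q M n * u n - M n * Hop q u n) has_sum 0) UNIV"
proof -
  have C: "C \<ge> 0" using M[of 0] by (simp add: weight_def) (smt (verit) norm_ge_zero)
  define d where "d = (\<lambda>n. M n * u (n + 1) - M (n + 1) * u n)"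
  have b: "bij_betw (\<lambda>n::int. n + 1) UNIV UNIV" "bij_betw (\<lambda>n::int. n - 1) UNIV UNIV"
    by (auto intro: bij_betwI[where g = "\<lambda>n. n - 1"] bij_betwI[where g = "\<lambda>n. n + 1"])
  have M1: "cmod (M (n + 1)) \<le> (2 * C) * weight n" "cmod (M (n - 1)) \<le> (2 * C) * weight n" for n
  proof -
    have "weight (n + 1) \<le> 2 * weight n" "weight (n - 1) \<le> 2 * weight n" by (auto simp: weight_def)
    from mult_left_mono[OF this(1) C] mult_left_mono[OF this(2) C]
    show "cmod (M (n + 1)) \<le> (2 * C) * weight n" "cmod (M (n - 1)) \<le> (2 * C) * weight n"
      using M[of "n + 1"] M[of "n - 1"] by auto
  qed
  have s1: "(\<lambda>n. M (n + 1) * u n) summable_on UNIV"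
    by (rule abs_summable_summable[OF rapid_mult_summable[OF u M1(1)]])
  have "(\<lambda>n. M (n - 1) * u n) summable_on UNIV"
    by (rule abs_summable_summable[OF rapid_mult_summable[OF u M1(2)]])
  hence s2: "(\<lambda>n. M n * u (n + 1)) summable_on UNIV"
    using summable_on_reindex_bij_betw[OF b(1), of "\<lambda>n. M (n - 1) * u n"] by simp
  have "d summable_on UNIV" unfolding d_def
    using has_sum_minus[OF has_sum_infsum[OF s2] has_sum_infsum[OF s1]] by (auto simp: summable_on_def)
  then obtain S where S: "(d has_sum S) UNIV" by (auto simp: summable_on_def)
  have "((\<lambda>n. d (n - 1)) has_sum S) UNIV"
    using has_sum_reindex_bij_betw[OF b(2), of d S] S by simp
  from has_sum_minus[OF S this] have "((\<lambda>n. d n - d (n - 1)) has_sum 0) UNIV" by simp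
  moreover have "d n - d (n - 1) = Hop q M n * u n - M n * Hop q u n" for n
    by (simp add: d_def Hop_def algebra_simps)
  ultimately show ?thesis by simp
qed

text \<open>Off the diagonal just one of the two solutions moves with \<open>n\<close>; on the
  diagonal the eigenvalue equation fails by the Wronskian. This is the resolvent kernel before
  division by the Wronskian.\<close>

lemma Hop_green_function:
  assumes u: "sol q e u" and v: "sol q e v"
  shows "Hop q (\<lambda>n. u (max n k) * v (min n k)) n
     = e * (u (max n k) * v (min n k)) + (if n = k then wronsk u v k else 0)"
proof -
  consider "n < k" | "n = k" | "n > k" by linarith
  thus ?thesis
  proof cases
    case 1
    hence "max (n + 1) k = k" "max (n - 1) k = k" "max n k = k" "min (n + 1) k = n + 1" "min (n - 1) k = n - 1" "min n k = n"
      by auto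
    thus ?thesis using 1 by (simp add: Hop_def sol_prev[OF v, of n] algebra_simps)
  next
    case 2
    thus ?thesis by (simp add: Hop_def wronsk_def sol_prev[OF v, of k] algebra_simps)
  next
    case 3
    hence "max (n + 1) k = n + 1" "max (n - 1) k = n - 1" "max n k = n" "min (n + 1) k = k" "min (n - 1) k = k" "min n k = k"
      by auto
    thus ?thesis using 3 by (simp add: Hop_def sol_prev[OF u, of n] algebra_simps)
  qed
qed

text \<open>Symmetry of the operator bounds the resolvent off the real axis; this forces the zeros of the
  Wronskian in the disc to be real and simple.\<close>

lemma wronskian_lower_bound:
  assumes q: "short_range q" and z: "z \<noteq> 0" "cmod z < 1"
  shows "\<bar>Im (energy z)\<bar> * cmod (jostR q z k * jostL q z k) \<le> cmod (wronsk (jostR q z) (jostL q z) 0)"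
proof -
  have nz: "z \<noteq> 0" "cmod z \<le> 1" using z by auto
  note sp = sol_jostR[OF q nz] and sm = sol_jostL[OF q nz]
  define W where "W = wronsk (jostR q z) (jostL q z) 0"
  have Wk: "wronsk (jostR q z) (jostL q z) k = W" unfolding W_def by (rule wronsk_const[OF sp sm])
  define g where "g = (\<lambda>n. jostR q z (max n k) * jostL q z (min n k))"
  have Hg: "Hop q g n = energy z * g n + (if n = k then W else 0)" for n
    unfolding g_def Hop_green_function[OF sp sm] Wk ..
  have gr: "rapid g"
  proof -
    define \<rho> where "\<rho> = cmod z"
    have \<rho>: "0 < \<rho>" "\<rho> < 1" using z by (auto simp: \<rho>_def)
    define A where "A = jconst q * cmod (jostL q z k) + jconst (reflect q) * cmod (jostR q z k)"
    \<comment> \<open>The geometric bounds are available beyond |k| on either side; the finitely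
      many sites in between are covered by a maximum.\<close>
    define B where "B = Max ((\<lambda>n. cmod (g n) / \<rho> ^ nat \<bar>n\<bar>) ` {- \<bar>k\<bar>..\<bar>k\<bar>})"
    have A0: "jconst q * cmod (jostL q z k) \<ge> 0" "jconst (reflect q) * cmod (jostR q z k) \<ge> 0"
      using jconst_ge_1[OF q] jconst_ge_1[OF short_range_reflect[OF q]] by auto
    have "cmod (g n) \<le> (max A B) * \<rho> ^ nat \<bar>n\<bar>" for n
    proof -
      consider "n \<in> {- \<bar>k\<bar>..\<bar>k\<bar>}" | "n > \<bar>k\<bar>" | "n < - \<bar>k\<bar>" by fastforce
      thus ?thesis
      proof cases
        case 1
        hence "cmod (g n) / \<rho> ^ nat \<bar>n\<bar> \<le> B" unfolding B_def by (intro Max_ge) auto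
        hence "cmod (g n) \<le> B * \<rho> ^ nat \<bar>n\<bar>" using \<rho> by (simp add: field_simps)
        also have "\<dots> \<le> max A B * \<rho> ^ nat \<bar>n\<bar>" using \<rho> by (intro mult_right_mono) auto
        finally show ?thesis .
      next
        case 2
        hence "cmod (g n) = cmod (jostR q z n) * cmod (jostL q z k)" by (auto simp: g_def norm_mult max_def min_def)
        also have "\<dots> \<le> (jconst q * \<rho> ^ nat \<bar>n\<bar>) * cmod (jostL q z k)"
          using jostR_bound[OF q nz, of n] 2 by (intro mult_right_mono) (auto simp: \<rho>_def)
        also have "\<dots> = (jconst q * cmod (jostL q z k)) * \<rho> ^ nat \<bar>n\<bar>" by simp
        also have "\<dots> \<le> max A B * \<rho> ^ nat \<bar>n\<bar>" using \<rho> A0 by (intro mult_right_mono) (auto simp: A_def)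
        finally show ?thesis .
      next
        case 3
        hence "cmod (g n) = cmod (jostL q z n) * cmod (jostR q z k)" by (auto simp: g_def norm_mult max_def min_def)
        also have "\<dots> \<le> (jconst (reflect q) * \<rho> ^ nat \<bar>n\<bar>) * cmod (jostR q z k)"
          using jostL_bound[OF q nz, of n] 3 by (intro mult_right_mono) (auto simp: \<rho>_def)
        also have "\<dots> = (jconst (reflect q) * cmod (jostR q z k)) * \<rho> ^ nat \<bar>n\<bar>" by simp
        also have "\<dots> \<le> max A B * \<rho> ^ nat \<bar>n\<bar>" using \<rho> A0 by (intro mult_right_mono) (auto simp: A_def)
        finally show ?thesis .
      qed
    qed
    thus ?thesis using \<rho> by (intro rapid_geometric[of \<rho>]) auto
  qed
  obtain C where C: "\<And>n. cmod (g n) \<le> C" using rapid_bounded[OF gr] by blast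
  have C0: "C \<ge> 0" using C[of 0] norm_ge_zero order.trans by blast
  have M: "cmod (cnj (g n)) \<le> C * weight n" for n
    using C[of n] mult_left_mono[OF weight_ge_1[of n] C0] by simp
  have Hc: "Hop q (\<lambda>n. cnj (g n)) n = cnj (Hop q g n)" for n by (simp add: Hop_def)
  \<comment> \<open>Green's identity for \<open>g\<close> and its conjugate: since \<open>q\<close>
    is real, the sum of |g|^2 times \<open>cnj (energy z) - energy z\<close> balances the two delta
    terms at \<open>k\<close>, collected in \<open>D\<close>.\<close>
  define D where "D = W * cnj (g k) - cnj W * g k"
  have "((\<lambda>n. (cnj (energy z) - energy z) * complex_of_real ((cmod (g n))\<^sup>2) - (if n = k then D else 0)) has_sum 0) UNIV"
  proof -
    have "Hop q (\<lambda>n. cnj (g n)) n * g n - cnj (g n) * Hop q g n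
      = (cnj (energy z) - energy z) * complex_of_real ((cmod (g n))\<^sup>2) - (if n = k then D else 0)" for n
      unfolding Hc Hg complex_norm_square by (simp add: D_def algebra_simps)
    thus ?thesis using has_sum_green[OF gr M, of q] by simp
  qed
  moreover have "((\<lambda>n. if n = k then D else 0) has_sum D) UNIV"
    by (subst has_sum_cong_neutral[where T = "{k}" and g = "\<lambda>_. D"])
      (use has_sum_finite[of "{k}" "\<lambda>_. D"] in auto)
  ultimately have "((\<lambda>n. ((cnj (energy z) - energy z) * complex_of_real ((cmod (g n))\<^sup>2) - (if n = k then D else 0)) + (if n = k then D else 0)) has_sum (0 + D)) UNIV"
    by (rule has_sum_add)
  hence "((\<lambda>n. (cnj (energy z) - energy z) * complex_of_real ((cmod (g n))\<^sup>2)) has_sum D) UNIV" by simp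
  hence "((\<lambda>n. Im ((cnj (energy z) - energy z) * complex_of_real ((cmod (g n))\<^sup>2))) has_sum Im D) UNIV"
    by (rule has_sum_Im)
  hence "((\<lambda>n. (- sgn (Im (energy z))) * Im ((cnj (energy z) - energy z) * complex_of_real ((cmod (g n))\<^sup>2))) has_sum ((- sgn (Im (energy z))) * Im D)) UNIV"
    by (rule has_sum_cmult_right)
  moreover have "(- sgn (Im (energy z))) * Im ((cnj (energy z) - energy z) * complex_of_real ((cmod (g n))\<^sup>2)) = 2 * \<bar>Im (energy z)\<bar> * (cmod (g n))\<^sup>2" for n
  proof -
    have "Im ((cnj (energy z) - energy z) * complex_of_real ((cmod (g n))\<^sup>2)) = - 2 * Im (energy z) * (cmod (g n))\<^sup>2"
      by (simp add: Im_complex_of_real)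
    thus ?thesis by (simp add: abs_sgn mult_ac)
  qed
  ultimately have hs: "((\<lambda>n. 2 * \<bar>Im (energy z)\<bar> * (cmod (g n))\<^sup>2) has_sum ((- sgn (Im (energy z))) * Im D)) UNIV" by (simp only:)
  \<comment> \<open>The sign factor has made every term nonnegative, so the sum dominates its term
    at \<open>k\<close>; cancelling one factor |g k| then gives the claim.\<close>
  have "2 * \<bar>Im (energy z)\<bar> * (cmod (g k))\<^sup>2 \<le> (- sgn (Im (energy z))) * Im D"
    by (rule has_sum_mono2[OF has_sum_finite[of "{k}" "\<lambda>n. 2 * \<bar>Im (energy z)\<bar> * (cmod (g n))\<^sup>2", simplified] hs]) auto
  also have "\<dots> \<le> \<bar>Im D\<bar>" by (auto simp: sgn_if)
  also have "\<dots> \<le> cmod D" by (rule abs_Im_le_cmod)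
  also have "\<dots> \<le> 2 * (cmod W * cmod (g k))"
    unfolding D_def by (rule order.trans[OF norm_triangle_ineq4]) (simp add: norm_mult)
  finally have "(\<bar>Im (energy z)\<bar> * cmod (g k)) * cmod (g k) \<le> cmod W * cmod (g k)" by (simp add: power2_eq_square mult_ac)
  hence "\<bar>Im (energy z)\<bar> * cmod (g k) \<le> cmod W"
    by (cases "g k = 0") (auto simp: mult_le_cancel_right)
  thus ?thesis by (simp add: g_def W_def)
qed

section \<open>Eigenvectors\<close>

lemma rapid_add: "rapid u \<Longrightarrow> rapid v \<Longrightarrow> rapid (\<lambda>n. u n + v n)"
  unfolding rapid_def
  by (drule (1) summable_on_add, erule summable_on_comparison_test)
    (auto simp: distrib_left[symmetric] intro!: mult_left_mono norm_triangle_ineq)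

lemma rapid_scale: "rapid u \<Longrightarrow> rapid (\<lambda>n. c * u n)"
  unfolding rapid_def by (drule summable_on_cmult_right[where c = "cmod c"]) (simp add: norm_mult mult_ac)

lemma rapid_sum: "finite P \<Longrightarrow> (\<And>p. p \<in> P \<Longrightarrow> rapid (f p)) \<Longrightarrow> rapid (\<lambda>n. \<Sum>p\<in>P. f p n)"
proof (induction P rule: finite_induct)
  case empty thus ?case by (simp add: rapid_def)
next
  case (insert x F) thus ?case by (auto intro!: rapid_add)
qed

lemma rapid_l2: assumes "rapid u" shows "l2 u"
proof -
  obtain C where C: "\<And>n. cmod (u n) \<le> C" using rapid_bounded[OF assms] by blast
  have C0: "C \<ge> 0" using C[of 0] norm_ge_zero order.trans by blast
  show ?thesis unfolding l2_def
  proof (rule summable_on_comparison_test)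
    show "(\<lambda>n. C * (weight n * cmod (u n))) summable_on UNIV"
      using assms unfolding rapid_def by (rule summable_on_cmult_right)
    fix n
    have "cmod (u n) \<le> weight n * cmod (u n)" using weight_ge_1[of n] by (simp add: mult_le_cancel_right1)
    thus "(cmod (u n))\<^sup>2 \<le> C * (weight n * cmod (u n))"
      unfolding power2_eq_square by (intro mult_mono C C0) auto
  qed auto
qed

lemma l2_mult_summable:
  assumes "l2 a" "l2 b" shows "(\<lambda>n. norm (a n * cnj (b n))) summable_on UNIV"
proof (rule summable_on_comparison_test)
  show "(\<lambda>n. (cmod (a n))\<^sup>2 + (cmod (b n))\<^sup>2) summable_on UNIV"
    using assms unfolding l2_def by (rule summable_on_add)
  fix n
  have "2 * (cmod (a n) * cmod (b n)) \<le> (cmod (a n))\<^sup>2 + (cmod (b n))\<^sup>2"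
    using zero_le_power2[of "cmod (a n) - cmod (b n)"] by (simp add: power2_diff)
  moreover have "0 \<le> cmod (a n) * cmod (b n)" by simp
  ultimately show "norm (a n * cnj (b n)) \<le> (cmod (a n))\<^sup>2 + (cmod (b n))\<^sup>2"
    unfolding norm_mult complex_mod_cnj by linarith
qed simp

lemma l2_inner_has_sum: "l2 a \<Longrightarrow> l2 b \<Longrightarrow> ((\<lambda>n. a n * cnj (b n)) has_sum l2_inner a b) UNIV"
  unfolding l2_inner_def by (rule has_sum_infsum[OF abs_summable_summable[OF l2_mult_summable]])

lemma l2_diff:
  assumes "l2 a" "l2 b" shows "l2 (\<lambda>n. a n - b n)"
  unfolding l2_def
proof (rule summable_on_comparison_test)
  show "(\<lambda>n. 2 * ((cmod (a n))\<^sup>2 + (cmod (b n))\<^sup>2)) summable_on UNIV"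
    using assms unfolding l2_def by (intro summable_on_cmult_right summable_on_add)
  fix n
  have "(cmod (a n - b n))\<^sup>2 \<le> (cmod (a n) + cmod (b n))\<^sup>2"
    by (intro power_mono norm_triangle_ineq4) auto
  also have "\<dots> \<le> 2 * ((cmod (a n))\<^sup>2 + (cmod (b n))\<^sup>2)"
    using zero_le_power2[of "cmod (a n) - cmod (b n)"] by (simp add: power2_eq_square algebra_simps)
  finally show "(cmod (a n - b n))\<^sup>2 \<le> 2 * ((cmod (a n))\<^sup>2 + (cmod (b n))\<^sup>2)" .
qed simp

lemma l2_inner_self_zero:
  assumes "l2 d" "l2_inner d d = 0" shows "d n = 0"
proof -
  have "((\<lambda>n. d n * cnj (d n)) has_sum 0) UNIV" using l2_inner_has_sum[OF assms(1,1)] assms(2) by simp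
  hence "((\<lambda>n. Re (d n * cnj (d n))) has_sum Re 0) UNIV" by (rule has_sum_Re)
  hence "((\<lambda>n. (cmod (d n))\<^sup>2) has_sum 0) UNIV" by (simp add: complex_mult_cnj cmod_power2)
  hence "(cmod (d n))\<^sup>2 = 0"
    using nonneg_infsum_le_0D[of "\<lambda>n. (cmod (d n))\<^sup>2" UNIV n] by (auto simp: infsumI summable_on_def)
  thus ?thesis by simp
qed

lemma l2_tendsto:
  assumes "l2 u" "inj g" shows "(\<lambda>N::nat. u (g N)) \<longlonglongrightarrow> 0"
proof -
  have "(\<lambda>n. (cmod (u n))\<^sup>2) summable_on range g"
    using assms(1) unfolding l2_def by (rule summable_on_subset_banach) auto
  hence "(\<lambda>N. (cmod (u (g N)))\<^sup>2) summable_on UNIV"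
    using summable_on_reindex[OF assms(2), of "\<lambda>n. (cmod (u n))\<^sup>2"] by (simp add: o_def)
  hence "(\<lambda>N. (cmod (u (g N)))\<^sup>2) \<longlonglongrightarrow> 0"
    by (intro summable_LIMSEQ_zero summable_on_imp_summable)
  hence "(\<lambda>N. sqrt ((cmod (u (g N)))\<^sup>2)) \<longlonglongrightarrow> sqrt 0" by (rule tendsto_real_sqrt)
  thus ?thesis by (simp add: tendsto_norm_zero_iff)
qed

lemma l2_cnj: "l2 u \<Longrightarrow> l2 (\<lambda>n. cnj (u n))" by (simp add: l2_def)

lemma eigvec_iff: "eigvec q u \<longleftrightarrow> l2 u \<and> u \<noteq> (\<lambda>_. 0) \<and> (\<exists>e. sol q e u)"
  by (simp add: eigvec_def sol_def)

lemma eigvec_cnj: "eigvec q u \<Longrightarrow> eigvec q (\<lambda>n. cnj (u n))"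
  unfolding eigvec_iff by (metis complex_cnj_cnj complex_cnj_zero l2_cnj sol_cnj)

text \<open>The Wronskian of \<open>u\<close> with \<open>jostR\<close> is constant and tends to 0
  at +infinity, where \<open>u\<close> vanishes and \<open>jostR\<close> stays bounded. Including
  |z| = 1 is what later excludes eigenvalues embedded in [0, 4].\<close>

lemma l2_solution_is_jost:
  assumes q: "short_range q" and z: "z \<noteq> 0" "cmod z \<le> 1" and s: "sol q (energy z) u" and l: "l2 u"
  shows "\<exists>c. u = (\<lambda>n. c * jostR q z n)"
proof (rule sol_dependent[OF s sol_jostR[OF q z] _ jostR_nonzero[OF q z]])
  note c = wronsk_const[OF s sol_jostR[OF q z]]
  have l1: "(\<lambda>N. u (int N)) \<longlonglongrightarrow> 0" by (rule l2_tendsto[OF l]) (auto intro: injI)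
  have l2: "(\<lambda>N. u (int N + 1)) \<longlonglongrightarrow> 0" by (rule l2_tendsto[OF l]) (auto intro: injI)
  have b: "cmod (jostR q z (int N)) \<le> jconst q" "cmod (jostR q z (int N + 1)) \<le> jconst q" for N
  proof -
    have "cmod (jostR q z (int N)) \<le> jconst q" for N
    proof -
      have "cmod (jostR q z (int N)) \<le> jconst q * cmod z ^ N" using jostR_bound[OF q z, of "int N"] by simp
      also have "\<dots> \<le> jconst q * 1" using z jconst_ge_1[OF q] by (intro mult_left_mono power_le_one) auto
      finally show ?thesis by simp
    qed
    from this[of N] this[of "Suc N"]
    show "cmod (jostR q z (int N)) \<le> jconst q" "cmod (jostR q z (int N + 1)) \<le> jconst q"
      by (simp_all add: add.commute)
  qed
  have "(\<lambda>N. u (int N) * jostR q z (int N + 1)) \<longlonglongrightarrow> 0"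
    by (rule Lim_null_comparison[where g = "\<lambda>N. cmod (u (int N)) * jconst q"])
      (use b l1 in \<open>auto intro!: always_eventually mult_left_mono tendsto_mult_left_zero tendsto_norm_zero simp: norm_mult\<close>)
  moreover have "(\<lambda>N. u (int N + 1) * jostR q z (int N)) \<longlonglongrightarrow> 0"
    by (rule Lim_null_comparison[where g = "\<lambda>N. cmod (u (int N + 1)) * jconst q"])
      (use b l2 in \<open>auto intro!: always_eventually mult_left_mono tendsto_mult_left_zero tendsto_norm_zero simp: norm_mult\<close>)
  ultimately have "(\<lambda>N. wronsk u (jostR q z) (int N)) \<longlonglongrightarrow> 0 - 0" unfolding wronsk_def by (rule tendsto_diff)
  moreover have "(\<lambda>N. wronsk u (jostR q z) (int N)) = (\<lambda>N. wronsk u (jostR q z) 0)" by (rule ext) (rule c)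
  ultimately have "(\<lambda>N::nat. wronsk u (jostR q z) 0) \<longlonglongrightarrow> 0" by simp
  thus "wronsk u (jostR q z) 0 = 0" by (simp add: LIMSEQ_const_iff)
qed

lemma l2_solution_is_jost_left:
  assumes q: "short_range q" and z: "z \<noteq> 0" "cmod z \<le> 1" and s: "sol q (energy z) u" and l: "l2 u"
  shows "\<exists>c. u = (\<lambda>n. c * jostL q z n)"
proof -
  have "bij_betw uminus (UNIV :: int set) UNIV" by (intro bij_betwI[where g = uminus]) auto
  hence "l2 (\<lambda>n. u (- n))"
    using l summable_on_reindex_bij_betw[of uminus UNIV UNIV "\<lambda>n. (cmod (u n))\<^sup>2"] by (simp add: l2_def)
  then obtain c where "(\<lambda>n. u (- n)) = (\<lambda>n. c * jostR (reflect q) z n)"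
    using l2_solution_is_jost[OF short_range_reflect[OF q] z sol_reflect[OF s]] by blast
  hence "u (- (- n)) = c * jostR (reflect q) z (- n)" for n by (rule fun_cong)
  thus ?thesis by (intro exI[of _ c]) (simp add: fun_eq_iff jostL_def)
qed

text \<open>The equation for z is z^2 - (2 - e) z + 1 = 0. Its roots have product 1, so one of them
  lies in the closed disc.\<close>

lemma energy_surj: "\<exists>z. z \<noteq> 0 \<and> cmod z \<le> 1 \<and> energy z = e"
proof -
  define h where "h = (2 - e) / 2"
  define s where "s = csqrt (h\<^sup>2 - 1)"
  have s2: "s\<^sup>2 = h\<^sup>2 - 1" by (simp add: s_def)
  have p: "(h + s) * (h - s) = 1" using s2 by (simp add: power2_eq_square algebra_simps)
  have inv: "inverse (h + s) = h - s" "inverse (h - s) = h + s"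
    using p by (auto intro: inverse_unique simp: mult.commute)
  have nz: "h + s \<noteq> 0" "h - s \<noteq> 0" using p by auto
  have e: "energy (h + s) = e" "energy (h - s) = e" unfolding energy_def inv by (simp_all add: h_def field_simps)
  have "cmod (h + s) * cmod (h - s) = 1" using p by (metis norm_mult norm_one)
  hence "cmod (h + s) \<le> 1 \<or> cmod (h - s) \<le> 1"
    using mult_strict_mono[of 1 "cmod (h + s)" 1 "cmod (h - s)"] by linarith
  thus ?thesis using nz e by blast
qed

section \<open>Zeros of the Wronskian and eigenvectors\<close>

locale nonresonant =
  fixes q :: "int \<Rightarrow> real"
  assumes q: "short_range q" and nr0: "\<not> resonance q 0" and nr4: "\<not> resonance q 4"
begin

definition Z :: "complex set" where "Z = {p. cmod p < 1 \<and> jwr q p = 0}"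

lemmas r = short_range_reflect[OF q]

lemma jost_cont: "continuous_on (cball 0 1) (jost q n)" "continuous_on (cball 0 1) (jost (reflect q) n)"
  unfolding jost_def by (intro pser_continuous jcoeffc_l1(1) q r)+

lemma jost_holo: "jost q n holomorphic_on ball 0 1" "jost (reflect q) n holomorphic_on ball 0 1"
  unfolding jost_def by (intro pser_holomorphic jcoeffc_l1(1) q r)+

lemma jwr_cont: "continuous_on (cball 0 1) (jwr q)"
  unfolding jwr_def[abs_def] by (intro continuous_intros jost_cont)

lemma jwr_holo: "jwr q holomorphic_on ball 0 1"
  unfolding jwr_def[abs_def] by (intro holomorphic_intros jost_holo)

lemma jwr_0: "jwr q 0 = 1" by (simp add: jwr_def jost_0[OF q] jost_0[OF r])

lemmas jwr_circle = jwr_nonzero_circle[OF q nr0 nr4]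

lemma Z_nonzero: "p \<in> Z \<Longrightarrow> p \<noteq> 0" using jwr_0 by (auto simp: Z_def)

lemma Z_facts:
  assumes "p \<in> Z" obtains c where "c \<noteq> 0" "jostR q p = (\<lambda>n. c * jostL q p n)" "rapid (jostL q p)"
proof -
  have z: "p \<noteq> 0" "cmod p < 1" "jwr q p = 0" using assms Z_nonzero[OF assms] by (auto simp: Z_def)
  obtain c K where "c \<noteq> 0" "jostR q p = (\<lambda>n. c * jostL q p n)" "\<And>n. cmod (jostL q p n) \<le> K * cmod p ^ nat \<bar>n\<bar>"
    using jwr_zero_decay[OF q z] by metis
  thus ?thesis using that rapid_geometric[of "cmod p" "jostL q p" K] z by auto
qed

lemma Z_rapid: "p \<in> Z \<Longrightarrow> rapid (jostL q p)" using Z_facts by blast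

lemma Z_eigvec:
  assumes "p \<in> Z" shows "eigvec q (jostL q p)"
proof -
  have z: "p \<noteq> 0" "cmod p \<le> 1" using assms Z_nonzero[OF assms] by (auto simp: Z_def)
  show ?thesis unfolding eigvec_iff
    using sol_jostL[OF q z] jostL_nonzero[OF q z] rapid_l2[OF Z_rapid[OF assms]] by blast
qed

text \<open>With a vanishing Wronskian the lower bound forces a real energy. The imaginary part of
  \<open>energy p\<close> is that of \<open>p\<close> times 1 / |p|^2 - 1, and the second factor is
  positive inside the disc.\<close>

lemma Z_real:
  assumes "p \<in> Z" shows "Im p = 0"
proof -
  have z: "p \<noteq> 0" "cmod p < 1" "cmod p \<le> 1" "jwr q p = 0" using assms Z_nonzero[OF assms] by (auto simp: Z_def)
  obtain c where c: "c \<noteq> 0" "jostR q p = (\<lambda>n. c * jostL q p n)" using Z_facts[OF assms] by blast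
  obtain k where k: "jostL q p k \<noteq> 0" using jostL_nonzero[OF q z(1,3)] by auto
  have "wronsk (jostR q p) (jostL q p) 0 = 0" using wronsk_jostR_jostL[OF z(1), of q] z by simp
  hence "\<bar>Im (energy p)\<bar> * cmod (jostR q p k * jostL q p k) \<le> 0"
    using wronskian_lower_bound[OF q z(1,2), of k] by simp
  moreover have "cmod (jostR q p k * jostL q p k) > 0" using c k by (simp add: norm_mult)
  ultimately have "Im (energy p) = 0" by (simp add: mult_le_0_iff)
  hence e: "Im p = Im p / (cmod p)\<^sup>2" by (simp add: energy_def cmod_power2)
  have "(cmod p)\<^sup>2 < 1" using z by (simp add: power_less_one_iff abs_square_less_1)
  moreover have "(cmod p)\<^sup>2 > 0" using z by simp
  ultimately show ?thesis using e by (auto simp: field_simps)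
qed

text \<open>Approach \<open>p\<close> vertically, along p + i \<open>\<epsilon>\<close>. As
  \<open>p\<close> is real, the energy there has imaginary part \<open>\<epsilon>\<close> (1 / |P|^2
  - 1), so the lower bound on the Wronskian keeps |jwr| / \<open>\<epsilon>\<close> away from 0,
  whereas a multiple zero would send this quotient to 0.\<close>

lemma Z_simple:
  assumes p: "p \<in> Z" shows "deriv (jwr q) p \<noteq> 0"
proof
  assume d0: "deriv (jwr q) p = 0"
  have z: "p \<noteq> 0" "cmod p < 1" "cmod p \<le> 1" "jwr q p = 0" using assms Z_nonzero[OF assms] by (auto simp: Z_def)
  obtain c where c: "c \<noteq> 0" "jostR q p = (\<lambda>n. c * jostL q p n)" using Z_facts[OF assms] by blast
  obtain k where k: "jostL q p k \<noteq> 0" using jostL_nonzero[OF q z(1,3)] by auto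
  define P where "P = (\<lambda>\<epsilon>. p + \<i> * complex_of_real \<epsilon>)"
  have P0: "(P \<longlongrightarrow> p) (at_right 0)" unfolding P_def by (auto intro!: tendsto_eq_intros)
  have Pat: "filterlim P (at p) (at_right 0)"
    using P0 by (auto simp: filterlim_at P_def eventually_at_filter)
  have "(jwr q has_field_derivative 0) (at p)"
    using holomorphic_derivI[OF jwr_holo open_ball, of p] z d0 by simp
  hence "((\<lambda>w. (jwr q w - jwr q p) / (w - p)) \<longlongrightarrow> 0) (at p)" by (simp add: has_field_derivative_iff)
  from filterlim_compose[OF this Pat]
  have "((\<lambda>\<epsilon>. jwr q (P \<epsilon>) / (\<i> * complex_of_real \<epsilon>)) \<longlongrightarrow> 0) (at_right 0)" by (simp add: P_def z)
  hence lim1: "((\<lambda>\<epsilon>. cmod (jwr q (P \<epsilon>) / (\<i> * complex_of_real \<epsilon>))) \<longlongrightarrow> 0) (at_right 0)"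
    by (rule tendsto_norm_zero)
  have ic: "isCont (jost q n) p" "isCont (jost (reflect q) n) p" for n
    using jost_holo[of n] z
    by (meson continuous_on_eq_continuous_at holomorphic_on_imp_continuous_on open_ball mem_ball_0)+
  have lf: "((\<lambda>\<epsilon>. jostR q (P \<epsilon>) k * jostL q (P \<epsilon>) k) \<longlongrightarrow> jostR q p k * jostL q p k) (at_right 0)"
    unfolding jostL_def jostR_def
    by (intro tendsto_intros P0 isCont_tendsto_compose[OF ic(1)] isCont_tendsto_compose[OF ic(2)] disjI1 z)
  define L where "L = (\<lambda>\<epsilon>. (1 / (cmod (P \<epsilon>))\<^sup>2 - 1) * cmod (jostR q (P \<epsilon>) k * jostL q (P \<epsilon>) k) * cmod (P \<epsilon>))"
  have lim2: "(L \<longlongrightarrow> (1 / (cmod p)\<^sup>2 - 1) * cmod (jostR q p k * jostL q p k) * cmod p) (at_right 0)"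
    unfolding L_def by (intro tendsto_intros P0 lf) (use z in auto)
  have "eventually (\<lambda>\<epsilon>. P \<epsilon> \<in> ball 0 1 - {0}) (at_right 0)"
    by (rule topological_tendstoD[OF P0]) (use z in auto)
  hence "eventually (\<lambda>\<epsilon>. L \<epsilon> \<le> cmod (jwr q (P \<epsilon>) / (\<i> * complex_of_real \<epsilon>))) (at_right 0)"
    using eventually_at_right_less[of 0]
  proof eventually_elim
    case (elim \<epsilon>)
    have Pz: "P \<epsilon> \<noteq> 0" "cmod (P \<epsilon>) < 1" using elim by auto
    have im: "Im (P \<epsilon>) = \<epsilon>" using Z_real[OF p] by (simp add: P_def)
    have "Im (energy (P \<epsilon>)) = \<epsilon> * (1 / (cmod (P \<epsilon>))\<^sup>2 - 1)"
      using im by (simp add: energy_def cmod_power2 right_diff_distrib)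
    moreover have "1 / (cmod (P \<epsilon>))\<^sup>2 \<ge> 1" using Pz by (simp add: power_le_one)
    ultimately have "\<bar>Im (energy (P \<epsilon>))\<bar> = \<epsilon> * (1 / (cmod (P \<epsilon>))\<^sup>2 - 1)" using elim by simp
    from wronskian_lower_bound[OF q Pz, of k, unfolded this]
    have "(\<epsilon> * (1 / (cmod (P \<epsilon>))\<^sup>2 - 1) * cmod (jostR q (P \<epsilon>) k * jostL q (P \<epsilon>) k)) * cmod (P \<epsilon>)
       \<le> cmod (wronsk (jostR q (P \<epsilon>)) (jostL q (P \<epsilon>)) 0) * cmod (P \<epsilon>)" by (rule mult_right_mono) simp
    also have "\<dots> = cmod (jwr q (P \<epsilon>))" by (simp add: wronsk_jostR_jostL[OF Pz(1), symmetric] norm_mult mult.commute)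
    finally show ?case using elim by (simp add: L_def norm_divide norm_mult field_simps)
  qed
  from tendsto_le[OF _ lim1 lim2 this]
  have "(1 / (cmod p)\<^sup>2 - 1) * cmod (jostR q p k * jostL q p k) * cmod p \<le> 0" by simp
  moreover have "1 / (cmod p)\<^sup>2 - 1 > 0"
  proof -
    have "(cmod p)\<^sup>2 < 1" using z by (simp add: power_less_one_iff abs_square_less_1)
    thus ?thesis using z by (simp add: field_simps)
  qed
  hence "(1 / (cmod p)\<^sup>2 - 1) * cmod (jostR q p k * jostL q p k) * cmod p > 0"
    using c k z by (intro mult_pos_pos) auto
  ultimately show False by linarith
qed

text \<open>Pick a point \<open>p\<close> of the closed disc over the eigenvalue. Square summability
  makes the eigenvector a multiple of both Jost solutions, so \<open>jwr\<close> vanishes at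
  \<open>p\<close>; as it has no zero on the circle, \<open>p\<close> lies inside.\<close>

lemma eigvec_Z:
  assumes "eigvec q u"
  obtains p c where "p \<in> Z" "u = (\<lambda>n. c * jostL q p n)" "sol q (energy p) u"
proof -
  obtain e where e: "sol q e u" "l2 u" "u \<noteq> (\<lambda>_. 0)" using assms by (auto simp: eigvec_iff)
  obtain p where p: "p \<noteq> 0" "cmod p \<le> 1" "energy p = e" using energy_surj by blast
  have s: "sol q (energy p) u" using e p by simp
  obtain c c' where c: "u = (\<lambda>n. c * jostR q p n)" "u = (\<lambda>n. c' * jostL q p n)"
    using l2_solution_is_jost[OF q p(1,2) s e(2)] l2_solution_is_jost_left[OF q p(1,2) s e(2)] by blast
  have cn: "c \<noteq> 0" "c' \<noteq> 0" using c e(3) by auto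
  have "jostR q p n = c' / c * jostL q p n" for n
    using fun_cong[OF c(1), of n] fun_cong[OF c(2), of n] cn by (simp add: field_simps)
  hence "wronsk (jostR q p) (jostL q p) 0 = 0" by (simp add: wronsk_def)
  hence w: "jwr q p = 0" using wronsk_jostR_jostL[OF p(1), of q] by simp
  hence "cmod p \<noteq> 1" using jwr_circle[of p] by blast
  hence "p \<in> Z" using p w by (simp add: Z_def)
  thus ?thesis using that c(2) s by blast
qed

end

section \<open>The spectral kernel\<close>

lemma jostR_cis: "jostR q (cis x) n = cis (real_of_int n * x) * jost q n (cis x)"
  by (simp add: jostR_def cis_power_int)

lemma energy_cis: "energy (cis x) = complex_of_real (2 - 2 * cos x)"
  by (simp add: energy_def complex_eq_iff)

lemma energy_cis_bound: "cmod (energy (cis x)) \<le> 4"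
proof -
  have "\<bar>2 - 2 * cos x\<bar> \<le> 4" using cos_le_one[of x] cos_ge_minus_one[of x] by linarith
  thus ?thesis unfolding energy_cis norm_of_real .
qed

lemma lweight_max_min: "lweight (max n k) * lweight (- min n k) \<le> weight n * weight k"
proof (cases "n \<le> k")
  case True
  have "lweight k * lweight (- n) \<le> weight k * weight n" by (intro mult_mono) (auto simp: lweight_def weight_def)
  thus ?thesis using True by (simp add: max_def min_def mult.commute)
next
  case False
  have "lweight n * lweight (- k) \<le> weight n * weight k" by (intro mult_mono) (auto simp: lweight_def weight_def)
  thus ?thesis using False by (simp add: max_def min_def)
qed

lemma Hop_scale: "Hop q (\<lambda>n. c * g n) n = c * Hop q g n"
  by (simp add: Hop_def algebra_simps)

context nonresonant begin

text \<open>\<open>jump\<close> is the jump of the resolvent kernel across the spectrum, pulled back to the circle, and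
  \<open>kern a\<close> is the kernel of the operator \<open>a(H) P\<^sub>c\<close>.\<close>

definition jump :: "int \<Rightarrow> int \<Rightarrow> real \<Rightarrow> complex" where
  "jump n k x = (1 - (cis x)\<^sup>2) / jwr q (cis x) * (jostR q (cis x) (max n k) * jostL q (cis x) (min n k))"

definition kern :: "(real \<Rightarrow> complex) \<Rightarrow> int \<Rightarrow> int \<Rightarrow> complex" where
  "kern a n k = integral {-pi..pi} (\<lambda>x. a x * jump n k x) / (2 * pi)"

definition propag :: "real \<Rightarrow> real \<Rightarrow> complex" where
  "propag t x = exp (- \<i> * complex_of_real t * energy (cis x))"

definition sop :: "(real \<Rightarrow> complex) \<Rightarrow> (int \<Rightarrow> complex) \<Rightarrow> int \<Rightarrow> complex" where
  "sop a u n = (\<Sum>\<^sub>\<infinity>k. kern a n k * u k)"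

lemma jwr_cis: "jwr q (cis x) \<noteq> 0" by (rule jwr_circle) simp

lemma cont_jost_cis: "continuous_on S (\<lambda>x. jost q n (cis x))" "continuous_on S (\<lambda>x. jost (reflect q) n (cis x))"
  unfolding jost_def by (intro pser_cis_continuous jcoeffc_l1(1) q r)+

lemma jump_cont: "continuous_on S (jump n k)"
proof -
  have w: "continuous_on S (\<lambda>x. jwr q (cis x))"
    by (rule continuous_on_compose2[OF jwr_cont]) (auto intro!: continuous_intros)
  show ?thesis unfolding jump_def[abs_def] jostL_def jostR_cis
    by (intro continuous_intros cont_jost_cis w) (use jwr_cis in auto)
qed

lemma jump_bound:
  obtains B where "B \<ge> 0" "\<And>n k x. cmod (jump n k x) \<le> B * (weight n * weight k)"
proof -
  have "compact ((\<lambda>z. inverse (jwr q z)) ` sphere 0 1)"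
    by (intro compact_continuous_image continuous_intros continuous_on_subset[OF jwr_cont])
      (use jwr_circle in auto)
  then obtain D where D: "\<And>z. z \<in> sphere 0 1 \<Longrightarrow> cmod (inverse (jwr q z)) \<le> D"
    using compact_imp_bounded by (force simp: bounded_iff)
  have D0: "D \<ge> 0" using D[of 1] norm_ge_zero order.trans by (metis mem_sphere_0 norm_one)
  show ?thesis
  proof (rule that[of "2 * D * (jconst q * jconst (reflect q))"])
    show "2 * D * (jconst q * jconst (reflect q)) \<ge> 0" using D0 jconst_ge_1[OF q] jconst_ge_1[OF r] by simp
    fix n k x
    have "cmod (jump n k x) = cmod (1 - (cis x)\<^sup>2) * cmod (inverse (jwr q (cis x))) *
       (cmod (jost q (max n k) (cis x)) * cmod (jost (reflect q) (- min n k) (cis x)))"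
      unfolding jump_def jostL_def jostR_cis by (simp add: norm_mult divide_inverse)
    also have "\<dots> \<le> (2 * D) * ((jconst q * lweight (max n k)) * (jconst (reflect q) * lweight (- min n k)))"
    proof (intro mult_mono)
      have "cmod (1 - (cis x)\<^sup>2) \<le> cmod 1 + cmod ((cis x)\<^sup>2)" by (rule norm_triangle_ineq4)
      thus "cmod (1 - (cis x)\<^sup>2) \<le> 2" by (simp add: norm_power)
      show "cmod (inverse (jwr q (cis x))) \<le> D" by (rule D) simp
      show "cmod (jost q (max n k) (cis x)) \<le> jconst q * lweight (max n k)" by (rule jost_bound[OF q]) simp
      show "cmod (jost (reflect q) (- min n k) (cis x)) \<le> jconst (reflect q) * lweight (- min n k)" by (rule jost_bound[OF r]) simp
    qed (use D0 jconst_ge_1[OF q] lweight_ge_1[of "max n k"] in auto)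
    also have "\<dots> = (2 * D * (jconst q * jconst (reflect q))) * (lweight (max n k) * lweight (- min n k))" by simp
    also have "\<dots> \<le> (2 * D * (jconst q * jconst (reflect q))) * (weight n * weight k)"
      using D0 jconst_ge_1[OF q] jconst_ge_1[OF r] by (intro mult_left_mono lweight_max_min) auto
    finally show "cmod (jump n k x) \<le> 2 * D * (jconst q * jconst (reflect q)) * (weight n * weight k)" .
  qed
qed

text \<open>\<open>B\<close> does not depend on the symbol \<open>a\<close>, so the kernel depends
  continuously on \<open>a\<close> in the sup norm. This lets limits of symbols pass to
  operators.\<close>

lemma kern_bound:
  obtains B where "B \<ge> 0" "\<And>a A n k. continuous_on {-pi..pi} a \<Longrightarrow> (\<And>x. x \<in> {-pi..pi} \<Longrightarrow> cmod (a x) \<le> A) \<Longrightarrow>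
    cmod (kern a n k) \<le> A * B * weight n * weight k"
proof -
  obtain B where B: "B \<ge> 0" "\<And>n k x. cmod (jump n k x) \<le> B * (weight n * weight k)" using jump_bound by blast
  show ?thesis
  proof (rule that[OF B(1)])
    fix a :: "real \<Rightarrow> complex" and A n k
    assume a: "continuous_on {-pi..pi} a" and A: "\<And>x. x \<in> {-pi..pi} \<Longrightarrow> cmod (a x) \<le> A"
    have A0: "A \<ge> 0" using A[of 0] norm_ge_zero[of "a 0"] by (smt (verit) atLeastAtMost_iff pi_ge_zero)
    have "cmod (integral {-pi..pi} (\<lambda>x. a x * jump n k x)) \<le> (A * (B * (weight n * weight k))) * (pi - (- pi))"
    proof (rule integral_bound)
      show "continuous_on {-pi..pi} (\<lambda>x. a x * jump n k x)" by (intro continuous_intros a jump_cont)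
      show "norm (a x * jump n k x) \<le> A * (B * (weight n * weight k))" if "x \<in> {-pi..pi}" for x
        unfolding norm_mult by (intro mult_mono A B that A0) auto
    qed simp
    hence "cmod (integral {-pi..pi} (\<lambda>x. a x * jump n k x)) / (2 * pi) \<le> (A * (B * (weight n * weight k))) * (2 * pi) / (2 * pi)"
      by (intro divide_right_mono) auto
    thus "cmod (kern a n k) \<le> A * B * weight n * weight k" by (simp add: kern_def norm_divide mult.assoc)
  qed
qed

lemma kern_growth:
  assumes a: "continuous_on {-pi..pi} a"
  obtains K where "\<And>n k. cmod (kern a n k) \<le> K * weight n * weight k"
proof -
  obtain A where A: "\<And>x. x \<in> {-pi..pi} \<Longrightarrow> cmod (a x) \<le> A"
    using compact_imp_bounded[OF compact_continuous_image[OF a compact_Icc]]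
    unfolding bounded_iff by blast
  show ?thesis by (rule kern_bound) (rule that, blast intro: a A)
qed

lemma kern_sym: "kern a n k = kern a k n"
  unfolding kern_def jump_def by (simp add: max.commute min.commute)

lemma kern_has_integral:
  assumes "continuous_on {-pi..pi} a"
  shows "((\<lambda>x. a x * jump n k x) has_integral (2 * pi * kern a n k)) {-pi..pi}"
proof -
  have "(\<lambda>x. a x * jump n k x) integrable_on {-pi..pi}"
    by (intro integrable_continuous_real continuous_intros assms jump_cont)
  moreover have "2 * pi * kern a n k = integral {-pi..pi} (\<lambda>x. a x * jump n k x)" by (simp add: kern_def)
  ultimately show ?thesis by (simp only: integrable_integral)
qed

lemma kern_lin:
  assumes "continuous_on {-pi..pi} a" "continuous_on {-pi..pi} b"
  shows "kern (\<lambda>x. \<alpha> * a x + \<beta> * b x) n k = \<alpha> * kern a n k + \<beta> * kern b n k"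
proof -
  have "((\<lambda>x. \<alpha> * (a x * jump n k x) + \<beta> * (b x * jump n k x)) has_integral
     (\<alpha> * (2 * pi * kern a n k) + \<beta> * (2 * pi * kern b n k))) {-pi..pi}"
    by (intro has_integral_add has_integral_mult_right kern_has_integral assms)
  hence "((\<lambda>x. (\<alpha> * a x + \<beta> * b x) * jump n k x) has_integral
     (\<alpha> * (2 * pi * kern a n k) + \<beta> * (2 * pi * kern b n k))) {-pi..pi}" by (simp add: algebra_simps)
  from integral_unique[OF this] show ?thesis
    unfolding kern_def[of "\<lambda>x. \<alpha> * a x + \<beta> * b x"] by (simp add: field_simps)
qed

text \<open>The Wronskian is \<open>jwr\<close> / \<zeta>, so the prefactor (1 - \<zeta>^2) /
  \<open>jwr\<close> reduces the delta coefficient to 1/\<zeta> - \<zeta>, which is odd in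
  \<open>x\<close>.\<close>

lemma Hop_jump:
  "Hop q (\<lambda>n. jump n k x) n = energy (cis x) * jump n k x + (if n = k then cis (- x) - cis x else 0)"
proof -
  have z: "cis x \<noteq> 0" "cmod (cis x) \<le> 1" by auto
  note sp = sol_jostR[OF q z] and sm = sol_jostL[OF q z]
  have "(1 - (cis x)\<^sup>2) / jwr q (cis x) * wronsk (jostR q (cis x)) (jostL q (cis x)) k = cis (- x) - cis x"
  proof -
    have "wronsk (jostR q (cis x)) (jostL q (cis x)) k = jwr q (cis x) / cis x"
      using wronsk_const[OF sp sm, of k 0] wronsk_jostR_jostL[OF z(1), of q] by (simp add: field_simps)
    moreover have "(1 - (cis x)\<^sup>2) / cis x = cis (- x) - cis x"
      by (simp add: power2_eq_square divide_inverse left_diff_distrib cis_mult)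
    ultimately show ?thesis using jwr_cis[of x] by simp
  qed
  thus ?thesis
    unfolding jump_def Hop_scale Hop_green_function[OF sp sm] by (auto simp: algebra_simps)
qed

text \<open>The delta in the resolvent equation contributes the integral of an odd function.\<close>

lemma Hop_kern:
  assumes a: "continuous_on {-pi..pi} a" and ev: "\<And>x. a (- x) = a x"
  shows "Hop q (\<lambda>n. kern a n k) n = kern (\<lambda>x. energy (cis x) * a x) n k"
proof -
  have za: "continuous_on {-pi..pi} (\<lambda>x. energy (cis x) * a x)" unfolding energy_cis by (intro continuous_intros a)
  have "((\<lambda>x. Hop q (\<lambda>n. a x * jump n k x) n) has_integral Hop q (\<lambda>n. 2 * pi * kern a n k) n) {-pi..pi}"
    unfolding Hop_def
    by (intro has_integral_add has_integral_diff has_integral_neg has_integral_mult_right kern_has_integral a)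
  hence "((\<lambda>x. a x * Hop q (\<lambda>n. jump n k x) n) has_integral 2 * pi * Hop q (\<lambda>n. kern a n k) n) {-pi..pi}"
    by (simp only: Hop_scale)
  moreover have "((\<lambda>x. a x * (cis (- x) - cis x)) has_integral 0) {-pi..pi}"
  proof -
    have i: "((\<lambda>x. a x * (cis (- x) - cis x)) has_integral integral {-pi..pi} (\<lambda>x. a x * (cis (- x) - cis x))) {-pi..pi}"
      by (intro integrable_integral integrable_continuous_real continuous_intros a)
    hence "((\<lambda>x. a (- x) * (cis (- (- x)) - cis (- x))) has_integral integral {-pi..pi} (\<lambda>x. a x * (cis (- x) - cis x))) {-pi..pi}"
      using has_integral_reflect_real[of "\<lambda>x. a x * (cis (- x) - cis x)" _ pi "-pi"] by simp
    from has_integral_neg[OF this]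
    have "((\<lambda>x. a x * (cis (- x) - cis x)) has_integral - integral {-pi..pi} (\<lambda>x. a x * (cis (- x) - cis x))) {-pi..pi}"
      by (simp add: ev algebra_simps)
    from has_integral_unique[OF i this] show ?thesis using i by simp
  qed
  hence "((\<lambda>x. if n = k then a x * (cis (- x) - cis x) else 0) has_integral 0) {-pi..pi}"
    by (cases "n = k") auto
  ultimately have "((\<lambda>x. a x * Hop q (\<lambda>n. jump n k x) n - (if n = k then a x * (cis (- x) - cis x) else 0))
     has_integral (2 * pi * Hop q (\<lambda>n. kern a n k) n - 0)) {-pi..pi}" by (rule has_integral_diff)
  moreover have "a x * Hop q (\<lambda>n. jump n k x) n - (if n = k then a x * (cis (- x) - cis x) else 0)
     = (energy (cis x) * a x) * jump n k x" for x
    by (simp add: Hop_jump algebra_simps)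
  ultimately have "((\<lambda>x. (energy (cis x) * a x) * jump n k x) has_integral (2 * pi * Hop q (\<lambda>n. kern a n k) n)) {-pi..pi}"
    by simp
  from has_integral_unique[OF this kern_has_integral[OF za]] show ?thesis by simp
qed

text \<open>In the residue theorem the pole at 0 produces the identity and the zeros of the Wronskian
  produce the eigenprojections.\<close>

lemma kern_one_le:
  assumes kn: "k \<le> n"
  shows "finite Z"
    "kern (\<lambda>_. 1) n k = (if n = k then 1 else 0) +
      (\<Sum>p\<in>Z. (1 - p\<^sup>2) / (p * deriv (jwr q) p) * (jostR q p n * jostL q p k))"
proof -
  \<comment> \<open>For k \<le> n the powers \<zeta>^n and \<zeta>^(-k) combine into a nonnegative
    power, so \<open>N\<close> is holomorphic at 0. The factor z in \<open>V\<close> contributes the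
    pole at 0 and cancels the factor \<open>cis x\<close> of the integral lemma.\<close>
  define N where "N = (\<lambda>z. z ^ nat (n - k) * (1 - z\<^sup>2) * jost q n z * jost (reflect q) (- k) z)"
  define V where "V = (\<lambda>z. z * jwr q z)"
  have dV: "deriv V z = jwr q z + z * deriv (jwr q) z" if "cmod z < 1" for z
  proof -
    have "(jwr q has_field_derivative deriv (jwr q) z) (at z)"
      using holomorphic_derivI[OF jwr_holo open_ball, of z] that by simp
    hence "(V has_field_derivative (1 * jwr q z + deriv (jwr q) z * z)) (at z)"
      unfolding V_def by (intro DERIV_mult DERIV_ident)
    thus ?thesis by (simp add: DERIV_imp_deriv mult.commute)
  qed
  have Zi: "{z. cmod z < 1 \<and> V z = 0} = insert 0 Z" by (auto simp: V_def Z_def)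
  have simple: "deriv V z \<noteq> 0" if "cmod z < 1" "V z = 0" for z
  proof (cases "z = 0")
    case True thus ?thesis using dV[of 0] jwr_0 by simp
  next
    case False
    hence "z \<in> Z" using that by (simp add: V_def Z_def)
    thus ?thesis using dV[of z] Z_simple[of z] False that by (simp add: Z_def)
  qed
  have nzc: "V z \<noteq> 0" if "cmod z = 1" for z using jwr_circle[OF that] that by (auto simp: V_def)
  have hN: "N holomorphic_on ball 0 1" unfolding N_def by (intro holomorphic_intros jost_holo)
  have cN: "continuous_on (cball 0 1) N" unfolding N_def by (intro continuous_intros jost_cont)
  have hV: "V holomorphic_on ball 0 1" unfolding V_def by (intro holomorphic_intros jwr_holo)
  have cV: "continuous_on (cball 0 1) V" unfolding V_def by (intro continuous_intros jwr_cont)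
  note main = circle_integral_simple_poles[OF hN cN hV cV nzc simple, unfolded Zi]
  show fin: "finite Z" using main(1) by (simp only: finite_insert)
  have "N (cis x) / V (cis x) * cis x = 1 * jump n k x" for x
  proof -
    have "cis x ^ nat (n - k) = cis (real_of_int n * x) * cis (real_of_int (- k) * x)"
      unfolding Complex.DeMoivre cis_mult distrib_right[symmetric] using kn by simp
    moreover have "max n k = n" "min n k = k" using kn by auto
    ultimately show ?thesis by (simp add: N_def V_def jump_def jostL_def jostR_cis)
  qed
  hence "kern (\<lambda>_. 1) n k = integral {-pi..pi} (\<lambda>x. N (cis x) / V (cis x) * cis x) / (2 * pi)"
    by (simp add: kern_def)
  also have "\<dots> = (\<Sum>p\<in>insert 0 Z. N p / deriv V p)"
  proof -
    have I: "integral {-pi..pi} (\<lambda>x. N (cis x) / V (cis x) * cis x) = 2 * pi * (\<Sum>p\<in>insert 0 Z. N p / deriv V p)"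
      by (rule main(2))
    show ?thesis unfolding I by simp
  qed
  also have "\<dots> = N 0 / deriv V 0 + (\<Sum>p\<in>Z. N p / deriv V p)"
    by (rule sum.insert[OF fin]) (use Z_nonzero in blast)
  \<comment> \<open>The derivative of \<open>V\<close> at 0 is \<open>jwr q 0\<close> = 1, and
    \<open>N 0\<close> is 0 to the power n - k, which is 1 on the diagonal alone.\<close>
  also have "N 0 / deriv V 0 = (if n = k then 1 else 0)"
    using kn dV[of 0] by (auto simp: N_def jwr_0 jost_0[OF q] jost_0[OF r])
  also have "(\<Sum>p\<in>Z. N p / deriv V p) = (\<Sum>p\<in>Z. (1 - p\<^sup>2) / (p * deriv (jwr q) p) * (jostR q p n * jostL q p k))"
  proof (rule sum.cong[OF refl])
    fix p assume p: "p \<in> Z"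
    have p0: "p \<noteq> 0" by (rule Z_nonzero[OF p])
    have "p ^ nat (n - k) = p powi n * p powi (- k)"
      using kn p0 power_int_add[of p n "- k"] by (simp add: power_int_def)
    moreover have "deriv V p = p * deriv (jwr q) p" using dV[of p] p by (simp add: Z_def)
    ultimately show "N p / deriv V p = (1 - p\<^sup>2) / (p * deriv (jwr q) p) * (jostR q p n * jostL q p k)"
      by (simp add: N_def jostL_def jostR_def)
  qed
  finally show "kern (\<lambda>_. 1) n k = (if n = k then 1 else 0) +
      (\<Sum>p\<in>Z. (1 - p\<^sup>2) / (p * deriv (jwr q) p) * (jostR q p n * jostL q p k))" .
qed

lemma finite_Z: "finite Z" by (rule kern_one_le(1)[OF order.refl])

text \<open>Replacing \<open>jostR q p\<close> by its multiple of \<open>jostL q p\<close> makes the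
  residue sum symmetric in \<open>n\<close> and \<open>k\<close>, so the formula extends from k
  \<le> n to all pairs. \<open>R\<close> stays abstract; annihilation of the eigenvectors takes the
  place of computing its normalisation.\<close>

lemma kern_one:
  obtains R where "\<And>n k. kern (\<lambda>_. 1) n k = (if n = k then 1 else 0) + (\<Sum>p\<in>Z. R p * (jostL q p n * jostL q p k))"
proof -
  have "\<forall>p\<in>Z. \<exists>c. jostR q p = (\<lambda>n. c * jostL q p n)" using Z_facts by metis
  then obtain c where c: "\<And>p. p \<in> Z \<Longrightarrow> jostR q p = (\<lambda>n. c p * jostL q p n)" by metis
  define R where "R = (\<lambda>p. (1 - p\<^sup>2) / (p * deriv (jwr q) p) * c p)"
  have le: "kern (\<lambda>_. 1) n k = (if n = k then 1 else 0) + (\<Sum>p\<in>Z. R p * (jostL q p n * jostL q p k))" if "k \<le> n" for n k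
    unfolding kern_one_le(2)[OF that] by (intro arg_cong2[of _ _ _ _ "(+)"] sum.cong refl) (simp add: R_def c)
  show ?thesis
  proof (rule that[of R])
    fix n k
    show "kern (\<lambda>_. 1) n k = (if n = k then 1 else 0) + (\<Sum>p\<in>Z. R p * (jostL q p n * jostL q p k))"
    proof (cases "k \<le> n")
      case False
      have "kern (\<lambda>_. 1) n k = kern (\<lambda>_. 1) k n" by (rule kern_sym)
      also have "\<dots> = (if k = n then 1 else 0) + (\<Sum>p\<in>Z. R p * (jostL q p k * jostL q p n))"
        by (rule le) (use False in simp)
      finally show ?thesis by (simp add: mult.commute eq_commute)
    qed (rule le)
  qed
qed

text \<open>\<open>energy\<close> takes equal values just at z and 1/z, and inversion preserves the
  circle.\<close>

lemma energy_eq_circle: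
  assumes "p \<noteq> 0" "energy p = energy (cis x)" shows "cmod p = 1"
proof -
  have "(p - cis x) * (p * cis x - 1) = 0"
    using assms by (simp add: energy_def field_simps flip: cis_inverse)
  hence "p = cis x \<or> p * cis x = 1" by auto
  thus ?thesis by (metis mult.right_neutral norm_cis norm_mult norm_one)
qed

lemma eigvec_rapid: "eigvec q \<psi> \<Longrightarrow> rapid \<psi>"
  by (erule eigvec_Z) (simp add: rapid_scale Z_rapid)

text \<open>For \<open>a = 1 / (e - energy)\<close>, where \<open>e\<close> is the eigenvalue, \<open>kern 1 = (e - H) (kern a)\<close>; sum by parts.\<close>

lemma kern_orth:
  assumes "eigvec q \<psi>"
  shows "((\<lambda>n. kern (\<lambda>_. 1) n k * \<psi> n) has_sum 0) UNIV"
proof -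
  obtain p c where p: "p \<in> Z" "sol q (energy p) \<psi>" using eigvec_Z[OF assms] by metis
  \<comment> \<open>\<open>p\<close> lies inside the disc, so its energy is not attained on the
    circle and the symbol \<open>a\<close> below has no singularity.\<close>
  have ne: "energy p - energy (cis x) \<noteq> 0" for x
    using energy_eq_circle[OF Z_nonzero[OF p(1)], of x] p(1) by (auto simp: Z_def)
  define a where "a = (\<lambda>x. 1 / (energy p - energy (cis x)))"
  have zc: "continuous_on S (\<lambda>x. energy (cis x))" for S unfolding energy_cis by (intro continuous_intros)
  have ca: "continuous_on S a" for S unfolding a_def by (intro continuous_intros zc) (use ne in auto)
  have ev: "a (- x) = a x" for x by (simp add: a_def energy_cis)
  obtain K where K: "\<And>n k. cmod (kern a n k) \<le> K * weight n * weight k" using kern_growth[OF ca] by blast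
  have M: "cmod (kern a n k) \<le> (K * weight k) * weight n" for n using K[of n k] by (simp add: mult_ac)
  have "Hop q (\<lambda>n. kern a n k) n = energy p * kern a n k - kern (\<lambda>_. 1) n k" for n
  proof -
    have "Hop q (\<lambda>n. kern a n k) n = kern (\<lambda>x. energy (cis x) * a x) n k" by (rule Hop_kern[OF ca ev])
    also have "(\<lambda>x. energy (cis x) * a x) = (\<lambda>x. energy p * a x + (- 1) * 1)"
      using ne by (simp add: a_def fun_eq_iff field_simps)
    also have "kern (\<lambda>x. energy p * a x + (- 1) * 1) n k = energy p * kern a n k + (- 1) * kern (\<lambda>_. 1) n k"
      by (rule kern_lin[OF ca]) (intro continuous_intros)
    finally show ?thesis by simp
  qed
  hence "Hop q (\<lambda>n. kern a n k) n * \<psi> n - kern a n k * Hop q \<psi> n = - (kern (\<lambda>_. 1) n k * \<psi> n)" for n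
  proof -
    assume H: "\<And>n. Hop q (\<lambda>n. kern a n k) n = energy p * kern a n k - kern (\<lambda>_. 1) n k"
    have S: "Hop q \<psi> n = energy p * \<psi> n" using p(2) by (simp add: sol_def)
    show ?thesis unfolding H S by (simp add: algebra_simps)
  qed
  hence "((\<lambda>n. - (kern (\<lambda>_. 1) n k * \<psi> n)) has_sum 0) UNIV"
    using has_sum_green[OF eigvec_rapid[OF assms] M, of q] by simp
  from has_sum_uminusI[OF this] show ?thesis by simp
qed

lemma kern_dispersive:
  obtains C where "C \<ge> 0" "\<And>t n k. t \<ge> 1 \<Longrightarrow>
    cmod (kern (propag t) n k) \<le> C * t powr (-4/3) * (weight n * weight k)"
proof -
  obtain b where b: "wl1 b" "\<And>z. cmod z \<le> 1 \<Longrightarrow> jwr q z = pser b z"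
    using wiener1_jwr[OF q] by (auto simp: wiener1_def)
  have nz: "pser b z \<noteq> 0" if "cmod z = 1" for z using jwr_circle[OF that] b(2)[of z] that by simp
  obtain C where C: "C \<ge> 0" "\<And>t n k. t \<ge> 1 \<Longrightarrow> k \<le> n \<Longrightarrow>
    cmod (integral {-pi..pi} (\<lambda>x. jost q n (cis x) * (jost (reflect q) (- k) (cis x) * (cis (real_of_int (n - k + 1) * x) * osc b t x))))
     \<le> C * t powr (-4/3) * ((1 + real_of_int \<bar>n\<bar>) * (1 + real_of_int \<bar>k\<bar>))"
    using dispersive_jost[OF b(1) nz q r] by blast
  have le: "cmod (kern (propag t) n k) \<le> C / (2 * pi) * t powr (-4/3) * (weight n * weight k)" if t: "t \<ge> 1" and kn: "k \<le> n" for t n k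
  proof -
    let ?G = "\<lambda>x. jost q n (cis x) * (jost (reflect q) (- k) (cis x) * (cis (real_of_int (n - k + 1) * x) * osc b t x))"
    have "propag t x * jump n k x = cis (- 2 * t) * ?G x" for x
    proof -
      have 1: "propag t x = cis (- 2 * t) * cis (2 * t * cos x)"
        unfolding propag_def energy_cis by (simp add: cis_conv_exp exp_add[symmetric] algebra_simps)
      \<comment> \<open>One factor \<zeta> is split off to expose the derivative of the phase; it
        raises the frequency n - k by one.\<close>
      have 2: "(1 - (cis x)\<^sup>2) = cis x * (cis (- x) - cis x)"
        by (simp add: right_diff_distrib cis_mult power2_eq_square)
      have 3: "cis (real_of_int (n - k + 1) * x) = cis x * (cis (real_of_int n * x) * cis (real_of_int (- k) * x))"
        by (simp add: cis_mult algebra_simps)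
      show ?thesis unfolding 1 2 3 osc_def jump_def jostL_def jostR_cis using kn b(2)[of "cis x"]
        by (simp add: max_def min_def)
    qed
    hence "kern (propag t) n k = integral {-pi..pi} (\<lambda>x. cis (- 2 * t) * ?G x) / (2 * pi)"
      unfolding kern_def by simp
    also have "\<dots> = cis (- 2 * t) * integral {-pi..pi} ?G / (2 * pi)"
      unfolding integral_mult_right ..
    finally have "kern (propag t) n k = cis (- 2 * t) * integral {-pi..pi} ?G / (2 * pi)" .
    hence "cmod (kern (propag t) n k) = cmod (integral {-pi..pi} ?G) / (2 * pi)" by (simp add: norm_mult norm_divide)
    also have "\<dots> \<le> C * t powr (-4/3) * (weight n * weight k) / (2 * pi)"
      using C(2)[OF t kn] by (intro divide_right_mono) (auto simp: weight_def)
    finally show ?thesis by simp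
  qed
  show ?thesis
  proof (rule that[of "C / (2 * pi)"])
    show "C / (2 * pi) \<ge> 0" using C by simp
    fix t :: real and n k assume t: "t \<ge> 1"
    show "cmod (kern (propag t) n k) \<le> C / (2 * pi) * t powr (-4/3) * (weight n * weight k)"
    proof (cases "k \<le> n")
      case False
      hence "cmod (kern (propag t) k n) \<le> C / (2 * pi) * t powr (-4/3) * (weight k * weight n)" by (intro le t) auto
      thus ?thesis by (subst kern_sym) (simp add: mult.commute)
    qed (rule le[OF t])
  qed
qed

end

section \<open>Functional calculus on weighted data\<close>

definition weight_norm :: "(int \<Rightarrow> complex) \<Rightarrow> real" where
  "weight_norm u = (\<Sum>\<^sub>\<infinity>n. weight n * cmod (u n))"

lemma rapid_has_sum: "rapid u \<Longrightarrow> ((\<lambda>n. weight n * cmod (u n)) has_sum weight_norm u) UNIV"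
  unfolding rapid_def weight_norm_def by (rule has_sum_infsum)

lemma rapid_pairing:
  assumes "rapid u" "\<And>n. cmod (M n) \<le> C * weight n"
  shows "((\<lambda>n. M n * u n) has_sum (\<Sum>\<^sub>\<infinity>n. M n * u n)) UNIV" "cmod (\<Sum>\<^sub>\<infinity>n. M n * u n) \<le> C * weight_norm u"
proof -
  show s: "((\<lambda>n. M n * u n) has_sum (\<Sum>\<^sub>\<infinity>n. M n * u n)) UNIV"
    by (rule has_sum_infsum[OF abs_summable_summable[OF rapid_mult_summable[OF assms]]])
  show "cmod (\<Sum>\<^sub>\<infinity>n. M n * u n) \<le> C * weight_norm u"
  proof (rule norm_infsum_le[OF s has_sum_cmult_right[OF rapid_has_sum[OF assms(1)]]])
    show "norm (M n * u n) \<le> C * (weight n * cmod (u n))" for n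
      using mult_right_mono[OF assms(2), of "cmod (u n)" n] by (simp add: norm_mult mult_ac)
  qed
qed

text \<open>Bilinear, without conjugation: \<open>kern\<close> is symmetric in its two sites, so it
  moves unchanged from one argument to the other.\<close>

definition pairing :: "(int \<Rightarrow> complex) \<Rightarrow> (int \<Rightarrow> complex) \<Rightarrow> complex" where
  "pairing v u = (\<Sum>\<^sub>\<infinity>n. v n * u n)"

lemma has_sum_sum':
  fixes f :: "'p \<Rightarrow> 'a \<Rightarrow> complex"
  assumes "finite P" "\<And>p. p \<in> P \<Longrightarrow> (f p has_sum s p) A"
  shows "((\<lambda>x. \<Sum>p\<in>P. f p x) has_sum (\<Sum>p\<in>P. s p)) A"
  using assms by (induction P rule: finite_induct) (auto intro!: has_sum_add)

lemma exp_series_uniform: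
  "uniform_limit (cball 0 R) (\<lambda>N v. \<Sum>j<N. v ^ j / fact j) (exp :: complex \<Rightarrow> complex) sequentially"
proof -
  have "uniform_limit (cball 0 R) (\<lambda>N v::complex. \<Sum>j<N. v ^ j / fact j) (\<lambda>v. \<Sum>j. v ^ j / fact j) sequentially"
  proof (rule Weierstrass_m_test)
    show "norm (v ^ j / fact j) \<le> \<bar>R\<bar> ^ j / fact j" if "v \<in> cball 0 R" for j and v :: complex
      using that by (auto simp: norm_divide norm_power intro!: divide_right_mono power_mono)
    show "summable (\<lambda>j. \<bar>R\<bar> ^ j / fact j)"
      using summable_exp[of "\<bar>R\<bar>"] by (simp add: divide_inverse mult.commute)
  qed
  moreover have "(\<lambda>v. \<Sum>j. v ^ j / fact j) = (exp :: complex \<Rightarrow> complex)"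
    by (simp add: exp_def fun_eq_iff scaleR_conv_of_real divide_inverse mult.commute)
  ultimately show ?thesis by simp
qed

context nonresonant begin

lemma sop_has_sum:
  assumes u: "rapid u" and a: "continuous_on {-pi..pi} a"
  shows "((\<lambda>k. kern a n k * u k) has_sum sop a u n) UNIV"
proof -
  obtain K where K: "\<And>n k. cmod (kern a n k) \<le> K * weight n * weight k" using kern_growth[OF a] by blast
  show ?thesis unfolding sop_def by (rule rapid_pairing(1)[OF u K])
qed

lemma sop_bound:
  assumes u: "rapid u"
  obtains K where "\<And>a A. continuous_on {-pi..pi} a \<Longrightarrow> (\<And>x. x \<in> {-pi..pi} \<Longrightarrow> cmod (a x) \<le> A) \<Longrightarrow>
    cmod (sop a u n) \<le> A * K"
proof -
  obtain B where B: "B \<ge> 0" "\<And>a A n k. continuous_on {-pi..pi} a \<Longrightarrow> (\<And>x. x \<in> {-pi..pi} \<Longrightarrow> cmod (a x) \<le> A) \<Longrightarrow>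
    cmod (kern a n k) \<le> A * B * weight n * weight k" using kern_bound by blast
  show ?thesis
  proof (rule that[of "B * weight n * weight_norm u"])
    fix a :: "real \<Rightarrow> complex" and A
    assume a: "continuous_on {-pi..pi} a" and A: "\<And>x. x \<in> {-pi..pi} \<Longrightarrow> cmod (a x) \<le> A"
    show "cmod (sop a u n) \<le> A * (B * weight n * weight_norm u)"
      using rapid_pairing(2)[OF u B(2)[OF a A], of n] by (simp add: sop_def mult.assoc)
  qed
qed

lemma sop_lin:
  assumes u: "rapid u" and a: "continuous_on {-pi..pi} a" and b: "continuous_on {-pi..pi} b"
  shows "sop (\<lambda>x. \<alpha> * a x + \<beta> * b x) u n = \<alpha> * sop a u n + \<beta> * sop b u n"
proof -
  have "((\<lambda>k. \<alpha> * (kern a n k * u k) + \<beta> * (kern b n k * u k)) has_sum (\<alpha> * sop a u n + \<beta> * sop b u n)) UNIV"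
    by (intro has_sum_add has_sum_cmult_right sop_has_sum u a b)
  hence "((\<lambda>k. kern (\<lambda>x. \<alpha> * a x + \<beta> * b x) n k * u k) has_sum (\<alpha> * sop a u n + \<beta> * sop b u n)) UNIV"
    unfolding kern_lin[OF a b] by (simp add: algebra_simps)
  thus ?thesis unfolding sop_def by (rule infsumI)
qed

lemma Hop_sop:
  assumes u: "rapid u" and a: "continuous_on {-pi..pi} a" and ev: "\<And>x. a (- x) = a x"
  shows "Hop q (sop a u) n = sop (\<lambda>x. energy (cis x) * a x) u n"
proof -
  have "((\<lambda>k. Hop q (\<lambda>n. kern a n k * u k) n) has_sum Hop q (sop a u) n) UNIV"
    unfolding Hop_def diff_conv_add_uminus
    by (intro has_sum_add has_sum_uminusI has_sum_cmult_right sop_has_sum u a)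
  moreover have "Hop q (\<lambda>n. kern a n k * u k) n = kern (\<lambda>x. energy (cis x) * a x) n k * u k" for k
    using Hop_scale[of q "u k" "\<lambda>n. kern a n k" n] Hop_kern[OF a ev, of k n] by (simp add: mult.commute)
  ultimately show ?thesis by (simp add: sop_def infsumI)
qed

lemma energy_cont: "continuous_on S (\<lambda>x. energy (cis x) ^ j)"
  unfolding energy_cis by (intro continuous_intros)

lemma Hop_power_sop:
  assumes u: "rapid u"
  shows "(Hop q ^^ j) (sop (\<lambda>_. 1) u) = sop (\<lambda>x. energy (cis x) ^ j) u"
proof (induction j)
  case (Suc j)
  have "Hop q (sop (\<lambda>x. energy (cis x) ^ j) u) n = sop (\<lambda>x. energy (cis x) * energy (cis x) ^ j) u n" for n
    by (rule Hop_sop[OF u energy_cont]) (simp add: energy_cis)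
  hence "Hop q (sop (\<lambda>x. energy (cis x) ^ j) u) = sop (\<lambda>x. energy (cis x) * energy (cis x) ^ j) u" by (rule ext)
  thus ?case by (simp add: Suc)
qed simp

text \<open>H multiplies symbols by the energy, so the partial sums of the exponential series
  applied to \<open>sop (\<lambda>_. 1) u\<close> are \<open>sop\<close> of Taylor polynomials of
  \<open>propag t\<close>. The energy is bounded by 4 on the circle, hence these polynomials
  converge uniformly, and the sup norm bound on \<open>sop\<close> gives convergence at each
  coordinate, the sense in which \<open>evol\<close> is defined.\<close>

lemma evol_sop:
  assumes u: "rapid u"
  shows "evol q t (sop (\<lambda>_. 1) u) n = sop (propag t) u n"
proof -
  define c where "c = (\<lambda>j. (- \<i> * complex_of_real t) ^ j / fact j)"
  define S where "S = (\<lambda>N x. \<Sum>j<N. c j * energy (cis x) ^ j)"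
  have ce: "continuous_on X (propag t)" for X unfolding propag_def energy_cis by (intro continuous_intros)
  have cS: "continuous_on X (S N)" for X N unfolding S_def by (intro continuous_intros energy_cont)
  have part: "sop (S N) u n = (\<Sum>j<N. c j * sop (\<lambda>x. energy (cis x) ^ j) u n)" for N
  proof (induction N)
    case 0
    have "kern (\<lambda>x. 0) n k = 0" for k by (simp add: kern_def)
    thus ?case by (simp add: S_def sop_def)
  next
    case (Suc N)
    have "sop (\<lambda>x. 1 * S N x + c N * energy (cis x) ^ N) u n = 1 * sop (S N) u n + c N * sop (\<lambda>x. energy (cis x) ^ N) u n"
      by (rule sop_lin[OF u cS energy_cont])
    thus ?case using Suc by (simp add: S_def)
  qed
  obtain K where K: "\<And>a A. continuous_on {-pi..pi} a \<Longrightarrow> (\<And>x. x \<in> {-pi..pi} \<Longrightarrow> cmod (a x) \<le> A) \<Longrightarrow>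
    cmod (sop a u n) \<le> A * K" using sop_bound[OF u] by blast
  have K0: "K \<ge> 0" using order.trans[OF norm_ge_zero K[of "\<lambda>_. 0" 1]] by simp
  have "(\<lambda>N. sop (S N) u n) \<longlonglongrightarrow> sop (propag t) u n"
  proof (rule LIMSEQ_I)
    fix \<epsilon> :: real assume \<epsilon>: "\<epsilon> > 0"
    \<comment> \<open>\<open>K\<close> may vanish, hence the division by
      \<open>K + 1\<close>.\<close>
    define \<delta> where "\<delta> = \<epsilon> / (K + 1)"
    have \<delta>: "\<delta> > 0" using \<epsilon> K0 by (simp add: \<delta>_def)
    have "\<forall>\<^sub>F N in sequentially. \<forall>v\<in>cball 0 (4 * \<bar>t\<bar>). dist (\<Sum>j<N. v ^ j / fact j) (exp v :: complex) < \<delta>"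
      using exp_series_uniform[of "4 * \<bar>t\<bar>"] \<delta> by (auto simp: uniform_limit_iff)
    then obtain N0 where N0: "\<And>N v. N \<ge> N0 \<Longrightarrow> v \<in> cball 0 (4 * \<bar>t\<bar>) \<Longrightarrow> dist (\<Sum>j<N. v ^ j / fact j) (exp v :: complex) < \<delta>"
      unfolding eventually_sequentially by blast
    show "\<exists>N0. \<forall>N\<ge>N0. norm (sop (S N) u n - sop (propag t) u n) < \<epsilon>"
    proof (intro exI[of _ N0] allI impI)
      fix N assume N: "N \<ge> N0"
      have le: "cmod (1 * S N x + (- 1) * propag t x) \<le> \<delta>" for x
      proof -
        let ?v = "- \<i> * complex_of_real t * energy (cis x)"
        have "cmod ?v = \<bar>t\<bar> * cmod (energy (cis x))" by (simp add: norm_mult)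
        also have "\<dots> \<le> \<bar>t\<bar> * 4" by (intro mult_left_mono energy_cis_bound) auto
        finally have "?v \<in> cball 0 (4 * \<bar>t\<bar>)" by simp
        from N0[OF N this] have "dist (\<Sum>j<N. ?v ^ j / fact j) (exp ?v) < \<delta>" .
        moreover have "?v ^ j / fact j = c j * energy (cis x) ^ j" for j
          unfolding power_mult_distrib[of "- \<i> * complex_of_real t"] by (simp add: c_def)
        ultimately have "dist (S N x) (propag t x) < \<delta>" unfolding S_def propag_def by (simp only:)
        thus ?thesis by (simp add: dist_norm)
      qed
      have cd: "continuous_on {-pi..pi} (\<lambda>x. 1 * S N x + (- 1) * propag t x)" by (intro continuous_intros cS ce)
      have "cmod (sop (\<lambda>x. 1 * S N x + (- 1) * propag t x) u n) \<le> \<delta> * K" by (rule K[OF cd le])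
      hence "cmod (sop (S N) u n - sop (propag t) u n) \<le> \<delta> * K" unfolding sop_lin[OF u cS ce] by simp
      also have "\<dots> < \<delta> * (K + 1)" using \<delta> by simp
      also have "\<dots> = \<epsilon>" using K0 by (simp add: \<delta>_def)
      finally show "norm (sop (S N) u n - sop (propag t) u n) < \<epsilon>" .
    qed
  qed
  hence "(\<lambda>j. c j * sop (\<lambda>x. energy (cis x) ^ j) u n) sums sop (propag t) u n" unfolding sums_def part .
  thus ?thesis unfolding evol_def Hop_power_sop[OF u] c_def by (simp add: sums_iff)
qed

lemma sop_one:
  obtains R where "\<And>u n. rapid u \<Longrightarrow> sop (\<lambda>_. 1) u n = u n + (\<Sum>p\<in>Z. (R p * pairing (jostL q p) u) * jostL q p n)"
    "\<And>u p. rapid u \<Longrightarrow> p \<in> Z \<Longrightarrow> ((\<lambda>k. jostL q p k * u k) has_sum pairing (jostL q p) u) UNIV"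
proof -
  obtain R where R: "\<And>n k. kern (\<lambda>_. 1) n k = (if n = k then 1 else 0) + (\<Sum>p\<in>Z. R p * (jostL q p n * jostL q p k))"
    using kern_one by blast
  have hs: "((\<lambda>k. jostL q p k * u k) has_sum pairing (jostL q p) u) UNIV" if u: "rapid u" and p: "p \<in> Z" for u p
  proof -
    obtain C where C: "\<And>n. cmod (jostL q p n) \<le> C" using rapid_bounded[OF Z_rapid[OF p]] by blast
    have C0: "C \<ge> 0" using C[of 0] norm_ge_zero order.trans by blast
    show ?thesis unfolding pairing_def
    proof (rule rapid_pairing(1)[OF u])
      show "cmod (jostL q p n) \<le> C * weight n" for n
        using C[of n] mult_left_mono[OF weight_ge_1[of n] C0] by simp
    qed
  qed
  show ?thesis
  proof (rule that[OF _ hs])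
    fix u n assume u: "rapid u"
    have d: "((\<lambda>k. if n = k then u n else 0) has_sum u n) UNIV"
      by (subst has_sum_cong_neutral[where T = "{n}" and g = "\<lambda>_. u n"])
        (use has_sum_finite[of "{n}" "\<lambda>_. u n"] in auto)
    have "((\<lambda>k. (if n = k then u n else 0) + (\<Sum>p\<in>Z. (R p * jostL q p n) * (jostL q p k * u k))) has_sum
       (u n + (\<Sum>p\<in>Z. (R p * jostL q p n) * pairing (jostL q p) u))) UNIV"
      by (intro has_sum_add d has_sum_sum' finite_Z has_sum_cmult_right hs u)
    moreover have "(if n = k then u n else 0) + (\<Sum>p\<in>Z. (R p * jostL q p n) * (jostL q p k * u k)) = kern (\<lambda>_. 1) n k * u k" for k
      unfolding R distrib_right sum_distrib_right by (simp add: mult_ac)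
    ultimately show "sop (\<lambda>_. 1) u n = u n + (\<Sum>p\<in>Z. (R p * pairing (jostL q p) u) * jostL q p n)"
      by (simp add: sop_def infsumI mult_ac)
  qed
qed

text \<open>The difference of \<open>u\<close> and \<open>w\<close> is a finite combination of
  eigenvectors, hence orthogonal to \<open>Hc q\<close>. That \<open>w\<close> itself lies in
  \<open>Hc q\<close> comes from transposing the symmetric kernel onto the eigenvector, which it
  annihilates. Two candidates for the projection differ by an element of \<open>Hc q\<close>
  orthogonal to itself, so the description in \<open>Pc\<close> is unique.\<close>

lemma Pc_eq:
  assumes u: "rapid u" shows "Pc q u = sop (\<lambda>_. 1) u"
proof -
  obtain R where TK1: "\<And>u n. rapid u \<Longrightarrow> sop (\<lambda>_. 1) u n = u n + (\<Sum>p\<in>Z. (R p * pairing (jostL q p) u) * jostL q p n)"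
    and hs: "\<And>u p. rapid u \<Longrightarrow> p \<in> Z \<Longrightarrow> ((\<lambda>k. jostL q p k * u k) has_sum pairing (jostL q p) u) UNIV"
    by (rule sop_one) (rule that)
  define w where "w = sop (\<lambda>_. 1) u"
  define \<alpha> where "\<alpha> = (\<lambda>p. R p * pairing (jostL q p) u)"
  have w: "w = (\<lambda>n. u n + (\<Sum>p\<in>Z. \<alpha> p * jostL q p n))" unfolding w_def \<alpha>_def using TK1[OF u] by blast
  have wr': "rapid w" unfolding w
    by (intro rapid_add u rapid_sum finite_Z rapid_scale Z_rapid)
  have lw: "l2 w" by (rule rapid_l2[OF wr'])
  have lu: "l2 u" by (rule rapid_l2[OF u])
  have "l2_inner w \<phi> = 0" if \<phi>: "eigvec q \<phi>" for \<phi>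
  proof -
    \<comment> \<open>\<open>l2_inner\<close> conjugates its second argument; \<open>\<psi>\<close>
      absorbs this and is again an eigenvector, because \<open>q\<close> is real.\<close>
    define \<psi> where "\<psi> = (\<lambda>n. cnj (\<phi> n))"
    have e\<psi>: "eigvec q \<psi>" unfolding \<psi>_def by (rule eigvec_cnj[OF \<phi>])
    note r\<psi> = eigvec_rapid[OF e\<psi>]
    have orth: "\<psi> k + (\<Sum>p\<in>Z. (R p * jostL q p k) * pairing (jostL q p) \<psi>) = 0" for k
    proof -
      have "kern (\<lambda>_. 1) n k = kern (\<lambda>_. 1) k n" for n by (rule kern_sym)
      hence "sop (\<lambda>_. 1) \<psi> k = 0" using kern_orth[OF e\<psi>, of k] by (simp add: sop_def infsumI)
      thus ?thesis using TK1[OF r\<psi>, of k] by (simp add: mult_ac)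
    qed
    obtain C where C: "\<And>n. cmod (\<psi> n) \<le> C" using rapid_bounded[OF r\<psi>] by blast
    have C0: "C \<ge> 0" using C[of 0] norm_ge_zero order.trans by blast
    have C1: "cmod (\<psi> n) \<le> C * weight n" for n using C[of n] mult_left_mono[OF weight_ge_1[of n] C0] by simp
    have s1: "((\<lambda>n. \<psi> n * u n) has_sum pairing \<psi> u) UNIV"
      unfolding pairing_def by (rule rapid_pairing(1)[OF u C1])
    have "((\<lambda>n. \<psi> n * u n + (\<Sum>p\<in>Z. \<alpha> p * (jostL q p n * \<psi> n))) has_sum
        (pairing \<psi> u + (\<Sum>p\<in>Z. \<alpha> p * pairing (jostL q p) \<psi>))) UNIV"
      by (intro has_sum_add s1 has_sum_sum' finite_Z has_sum_cmult_right hs r\<psi>)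
    moreover have "\<psi> n * u n + (\<Sum>p\<in>Z. \<alpha> p * (jostL q p n * \<psi> n)) = w n * cnj (\<phi> n)" for n
      unfolding w \<psi>_def distrib_right sum_distrib_right by (simp add: mult_ac)
    ultimately have 1: "l2_inner w \<phi> = pairing \<psi> u + (\<Sum>p\<in>Z. \<alpha> p * pairing (jostL q p) \<psi>)"
      by (simp add: l2_inner_def infsumI)
    \<comment> \<open>The same quantity with the residue sum moved from \<open>u\<close> to
      \<open>\<psi>\<close>: it now pairs \<open>u\<close> with the kernel applied to
      \<open>\<psi>\<close>, and by \<open>orth\<close> every term is 0.\<close>
    have "((\<lambda>k. \<psi> k * u k + (\<Sum>p\<in>Z. (R p * pairing (jostL q p) \<psi>) * (jostL q p k * u k))) has_sum
        (pairing \<psi> u + (\<Sum>p\<in>Z. (R p * pairing (jostL q p) \<psi>) * pairing (jostL q p) u))) UNIV"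
      by (intro has_sum_add s1 has_sum_sum' finite_Z has_sum_cmult_right hs u)
    moreover have "\<psi> k * u k + (\<Sum>p\<in>Z. (R p * pairing (jostL q p) \<psi>) * (jostL q p k * u k)) = 0" for k
    proof -
      have "\<psi> k * u k + (\<Sum>p\<in>Z. (R p * pairing (jostL q p) \<psi>) * (jostL q p k * u k))
        = (\<psi> k + (\<Sum>p\<in>Z. (R p * jostL q p k) * pairing (jostL q p) \<psi>)) * u k"
        unfolding distrib_right sum_distrib_right by (simp add: mult_ac)
      thus ?thesis by (simp only: orth mult_zero_left)
    qed
    ultimately have "((\<lambda>_::int. 0) has_sum (pairing \<psi> u +
        (\<Sum>p\<in>Z. (R p * pairing (jostL q p) \<psi>) * pairing (jostL q p) u))) UNIV"
      by (simp only:)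
    from infsumI[OF this]
    have "pairing \<psi> u + (\<Sum>p\<in>Z. (R p * pairing (jostL q p) \<psi>) * pairing (jostL q p) u) = 0"
      by simp
    thus ?thesis unfolding 1 \<alpha>_def by (simp add: mult_ac)
  qed
  hence wHc: "w \<in> Hc q" using lw by (simp add: Hc_def)
  have wproj: "l2_inner (\<lambda>n. u n - w n) v = 0" if v: "v \<in> Hc q" for v
  proof -
    have lv: "l2 v" using v by (simp add: Hc_def)
    have z: "((\<lambda>n. jostL q p n * cnj (v n)) has_sum 0) UNIV" if p: "p \<in> Z" for p
    proof -
      have "((\<lambda>n. v n * cnj (jostL q p n)) has_sum 0) UNIV"
        using l2_inner_has_sum[OF lv rapid_l2[OF Z_rapid[OF p]]] v Z_eigvec[OF p] by (simp add: Hc_def)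
      hence "((\<lambda>n. cnj (v n * cnj (jostL q p n))) has_sum cnj 0) UNIV" by (subst has_sum_cnj_iff)
      thus ?thesis by (simp add: mult.commute)
    qed
    have "((\<lambda>n. \<Sum>p\<in>Z. (- \<alpha> p) * (jostL q p n * cnj (v n))) has_sum (\<Sum>p\<in>Z. (- \<alpha> p) * 0)) UNIV"
      by (intro has_sum_sum' finite_Z has_sum_cmult_right z)
    moreover have "(\<Sum>p\<in>Z. (- \<alpha> p) * (jostL q p n * cnj (v n))) = (u n - w n) * cnj (v n)" for n
      by (simp add: w sum_distrib_right[symmetric] sum_negf mult.assoc[symmetric])
    ultimately show ?thesis by (simp add: l2_inner_def infsumI)
  qed
  have uniq: "w' = w" if w': "w' \<in> Hc q" "\<forall>v\<in>Hc q. l2_inner (\<lambda>n. u n - w' n) v = 0" for w'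
  proof -
    define d where "d = (\<lambda>n. w' n - w n)"
    have lw': "l2 w'" using w' by (simp add: Hc_def)
    have ld: "l2 d" unfolding d_def by (rule l2_diff[OF lw' lw])
    have sub: "l2_inner (\<lambda>n. f n - g n) h = l2_inner f h - l2_inner g h" if "l2 f" "l2 g" "l2 h" for f g h
      using has_sum_minus[OF l2_inner_has_sum[OF that(1,3)] l2_inner_has_sum[OF that(2,3)]]
      by (simp add: l2_inner_def infsumI left_diff_distrib)
    have "d \<in> Hc q"
    proof -
      have "l2_inner d \<phi> = 0" if "eigvec q \<phi>" for \<phi>
      proof -
        have l\<phi>: "l2 \<phi>" using that by (simp add: eigvec_def)
        show ?thesis unfolding d_def sub[OF lw' lw l\<phi>] using w'(1) wHc that by (simp add: Hc_def)
      qed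
      thus ?thesis using ld by (simp add: Hc_def)
    qed
    hence "l2_inner (\<lambda>n. u n - w n) d = 0" "l2_inner (\<lambda>n. u n - w' n) d = 0" using wproj w' by auto
    hence "l2_inner (\<lambda>n. (u n - w n) - (u n - w' n)) d = 0"
      using sub[OF l2_diff[OF lu lw] l2_diff[OF lu lw'] ld] by simp
    hence "l2_inner d d = 0" by (simp add: d_def)
    hence "d n = 0" for n by (rule l2_inner_self_zero[OF ld])
    thus ?thesis by (auto simp: d_def fun_eq_iff)
  qed
  have "Pc q u = w" unfolding Pc_def
  proof (rule the_equality)
    show "w \<in> Hc q \<and> (\<forall>v\<in>Hc q. l2_inner (\<lambda>n. u n - w n) v = 0)" using wHc wproj by blast
  qed (rule uniq, simp_all)
  thus ?thesis by (simp add: w_def)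
qed

lemma dispersive_bound:
  obtains C where "\<And>t u n. t \<ge> 1 \<Longrightarrow> rapid u \<Longrightarrow>
    cmod (evol q t (Pc q u) n) \<le> C * t powr (-4/3) * weight n * weight_norm u"
proof -
  obtain C where C: "C \<ge> 0" "\<And>t n k. t \<ge> 1 \<Longrightarrow>
    cmod (kern (propag t) n k) \<le> C * t powr (-4/3) * (weight n * weight k)"
    using kern_dispersive by blast
  show ?thesis
  proof (rule that[of C])
    fix t :: real and u n assume t: "t \<ge> 1" and u: "rapid u"
    have "cmod (kern (propag t) n k) \<le> (C * t powr (-4/3) * weight n) * weight k" for k
      using C(2)[OF t, of n k] by (simp add: mult_ac)
    from rapid_pairing(2)[OF u this]
    show "cmod (evol q t (Pc q u) n) \<le> C * t powr (-4/3) * weight n * weight_norm u"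
      unfolding Pc_eq[OF u] evol_sop[OF u] unfolding sop_def .
  qed
qed

end

theorem theorem6p1:
  fixes q :: "int \<Rightarrow> real"
  assumes q_l12: "(\<lambda>n. (1 + real_of_int \<bar>n\<bar>) powr 2 * \<bar>q n\<bar>) summable_on UNIV"
    and nonres0: "\<not> resonance q 0"
    and nonres4: "\<not> resonance q 4"
  shows "\<exists>C T. \<forall>t\<ge>T. \<forall>u. l1w 1 u \<longrightarrow>
           (\<forall>n. (1 + real_of_int \<bar>n\<bar>) powr (-1) * cmod (evol q t (Pc q u) n)
              \<le> C * t powr (-4/3) * l1w_norm 1 u)"
proof -
  have p2: "(1 + real_of_int \<bar>n\<bar>) powr 2 = (1 + real_of_int \<bar>n\<bar>)\<^sup>2" for n by simp
  have "short_range q" using q_l12 unfolding short_range_def p2 .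
  then interpret nonresonant q using nonres0 nonres4 by unfold_locales
  have p1: "(1 + real_of_int \<bar>n\<bar>) powr 1 = weight n" for n by (simp add: weight_def)
  have pm: "(1 + real_of_int \<bar>n\<bar>) powr (-1) = 1 / weight n" for n by (simp add: weight_def powr_minus divide_inverse)
  obtain C where C: "\<And>t u n. t \<ge> 1 \<Longrightarrow> rapid u \<Longrightarrow>
    cmod (evol q t (Pc q u) n) \<le> C * t powr (-4/3) * weight n * weight_norm u" using dispersive_bound by blast
  show ?thesis
  proof (rule exI[of _ C], rule exI[of _ 1], intro allI impI)
    fix t :: real and u n assume t: "t \<ge> 1" and u: "l1w 1 u"
    have ur: "rapid u" using u unfolding l1w_def p1 rapid_def .
    have "weight n > 0" using weight_ge_1[of n] by linarith
    hence "1 / weight n * cmod (evol q t (Pc q u) n) \<le> C * t powr (-4/3) * weight_norm u"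
      using C[OF t ur, of n] by (simp add: field_simps)
    thus "(1 + real_of_int \<bar>n\<bar>) powr (-1) * cmod (evol q t (Pc q u) n) \<le> C * t powr (-4/3) * l1w_norm 1 u"
      unfolding pm l1w_norm_def p1 weight_norm_def .
  qed
qed

end
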